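(* For any group $G$ and any integer $k\ge1$, the subset $\mathcal R_G(0)$ is closed in $\mathcal R_G$, and the subset $\bigcup_{1\le i\le k}\mathcal R_G(i)$ is open in $\mathcal R_G$.
   Context: $S^1=\mathbb R/\mathbb Z$, $\pi:\mathbb R\to S^1$ is the projection, $T(x)=x+1$ on $\mathbb R$. $\mathcal H=\mathrm{Homeo}_+(S^1)$ is the group of orientation preserving homeomorphisms of $S^1$ with metric $d(f,h)=\sup_{x\in S^1}|f(x)-h(x)|$. For a group $G$ (arbitrary, countable or not), $\mathcal R_G=\mathrm{Hom}(G,\mathcal H)$, with the topology having as subbase the sets $U(\varphi;g,\varepsilon)=\{\varphi'\in\mathcal R_G: d(\varphi'(g),\varphi(g))<\varepsilon\}$ ($\varphi\in\mathcal R_G$, $g\in G$, $\varepsilon>0$). Semiconjugacy: a map $h:S^1\to S^1$ is degree one monotone if there is a nondecreasing (not necessarily continuous) $\tilde h:\mathbb R\to\mathbb R$ with $\tilde h\circ T=T\circ\tilde h$ and $\pi\circ\tilde h=h\circ\pi$. Let $\mathcal R_G^*$ be the set of $\varphi\in\mathcal R_G$ for which some $x\in S^1$ is fixed by all $\varphi(g)$, $g\in G$. Then $\varphi^1,\varphi^2\in\mathcal R_G$ are semiconjugate if either both lie in $\mathcal R_G^*$, or both lie in $\mathcal R_G\setminus\mathcal R_G^*$ and there is a degree one monotone $h$ with $\varphi^2(g)\circ h=h\circ\varphi^1(g)$ for all $g\in G$. Type: $\varphi\in\mathcal R_G$ is type $0$ if there is a $\varphi(G)$-invariant probability measure on $S^1$.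 If $\varphi$ is not type $0$, a minimal model $\varphi_\sharp$ is a homomorphism semiconjugate to $\varphi$ whose action on $S^1$ is minimal (every orbit dense); it exists and is unique up to topological conjugacy. For $k\in\mathbb N$, $k\geq 1$, let $\pi_k:S^1\to S^1$, $\pi_k(x+\mathbb Z)=kx+\mathbb Z$; $\psi\in\mathcal R_G$ is a $k$-fold lift of $\varphi\in\mathcal R_G$ if $\varphi(g)\circ\pi_k=\pi_k\circ\psi(g)$ for all $g\in G$. For $k\ge1$, $\varphi$ is type $k$ if (1) $\varphi$ is not type $0$; (2) a minimal model $\varphi_\sharp$ is a $k$-fold lift of some homomorphism in $\mathcal R_G$; (3) $k$ is maximal among the integers satisfying (2). $\mathcal R_G(k)$ ($k\ge0$) denotes the set of type $k$ homomorphisms. *)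

theory Defs
  imports "HOL-Probability.Probability" "HOL-Algebra.Group"
begin

section \<open>The circle as the quotient of the reals by the integers\<close>

definition circle_rel :: "real \<Rightarrow> real \<Rightarrow> bool" where
  "circle_rel x y \<longleftrightarrow> x - y \<in> \<int>"

lemma equivp_circle_rel: "equivp circle_rel"
proof (rule equivpI)
  show "reflp circle_rel"
    by (simp add: reflp_def circle_rel_def)
  show "symp circle_rel"
    unfolding symp_def circle_rel_def by (metis Ints_minus minus_diff_eq)
  show "transp circle_rel"
    unfolding transp_def circle_rel_def by (metis Ints_add diff_add_cancel add_diff_eq)
qed

quotient_type circle = real / circle_rel
  morphisms rep_circle circle_proj
  by (rule equivp_circle_rel)

lemma circle_proj_eq_iff: "circle_proj x = circle_proj y \<longleftrightarrow> x - y \<in> \<int>"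
  by (simp add: circle.abs_eq_iff circle_rel_def)

lemma infdist_Ints_attained:
  fixes x :: real
  shows "\<exists>n\<in>\<int>. infdist x \<int> = dist x n"
proof -
  have "\<int> \<noteq> ({} :: real set)" using Ints_0 by blast
  then show ?thesis
    using infdist_attains_inf[of "\<int> :: real set" x] closed_Ints by blast
qed

lemma infdist_Ints_shift:
  fixes x y :: real
  assumes "x - y \<in> \<int>"
  shows "infdist x \<int> = infdist y \<int>"
proof -
  have le: "infdist x \<int> \<le> infdist y \<int>" if "x - y \<in> \<int>" for x y :: real
  proof -
    obtain n where n: "n \<in> \<int>" "infdist y \<int> = dist y n"
      using infdist_Ints_attained by blast
    have "infdist x \<int> \<le> dist x (n + (x - y))"
      using n that by (intro infdist_le) auto
    also have "\<dots> = dist y n" by (simp add: dist_real_def)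
    finally show ?thesis using n by simp
  qed
  have "y - x \<in> \<int>" using Ints_minus[OF assms] by simp
  then show ?thesis using le[OF assms] le[of y x] by linarith
qed

lemma infdist_Ints_triangle:
  fixes x y :: real
  shows "infdist (x + y) \<int> \<le> infdist x \<int> + infdist y \<int>"
proof -
  obtain m where m: "m \<in> \<int>" "infdist x \<int> = dist x m"
    using infdist_Ints_attained by blast
  obtain n where n: "n \<in> \<int>" "infdist y \<int> = dist y n"
    using infdist_Ints_attained by blast
  have "infdist (x + y) \<int> \<le> dist (x + y) (m + n)"
    using m n by (intro infdist_le) auto
  also have "\<dots> \<le> dist x m + dist y n" by (rule dist_triangle_add)
  finally show ?thesis using m n by simp
qed

lemma infdist_Ints_minus:
  fixes x :: real
  shows "infdist (- x) \<int> = infdist x \<int>"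
proof -
  have le: "infdist (- x) \<int> \<le> infdist x \<int>" for x :: real
  proof -
    obtain n where n: "n \<in> \<int>" "infdist x \<int> = dist x n"
      using infdist_Ints_attained by blast
    have "infdist (- x) \<int> \<le> dist (- x) (- n)"
      using n by (intro infdist_le) auto
    then show ?thesis using n by (simp add: dist_real_def)
  qed
  show ?thesis using le[of x] le[of "- x"] by simp
qed

text \<open>The distance is the quotient distance: the minimum of
  \<open>\<bar>x - y - n\<bar>\<close> over all integers \<open>n\<close>.\<close>

instantiation circle :: metric_space
begin

lift_definition dist_circle :: "circle \<Rightarrow> circle \<Rightarrow> real" is
  "\<lambda>x y. infdist (x - y) \<int>"
proof -
  fix x x' y y' :: real
  assume "circle_rel x x'" "circle_rel y y'"
  then have "(x - x') - (y - y') \<in> \<int>"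
    unfolding circle_rel_def by (rule Ints_diff)
  then show "infdist (x - y) \<int> = infdist (x' - y') \<int>"
    by (intro infdist_Ints_shift) (simp add: algebra_simps)
qed

definition uniformity_circle :: "(circle \<times> circle) filter" where
  "uniformity_circle = (INF e\<in>{0<..}. principal {(x, y). dist x y < e})"

definition open_circle :: "circle set \<Rightarrow> bool" where
  "open_circle U \<longleftrightarrow> (\<forall>x\<in>U. \<forall>\<^sub>F (x', y) in uniformity. x' = x \<longrightarrow> y \<in> U)"

instance
proof
  show "(uniformity :: (circle \<times> circle) filter) =
      (INF e\<in>{0<..}. principal {(x, y). dist x y < e})"
    by (rule uniformity_circle_def)
  show "open U \<longleftrightarrow> (\<forall>x\<in>U. \<forall>\<^sub>F (x', y) in uniformity. x' = x \<longrightarrow> y \<in> U)"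
    for U :: "circle set"
    by (rule open_circle_def)
  show "dist x y = 0 \<longleftrightarrow> x = y" for x y :: circle
  proof transfer
    fix x y :: real
    have "x - y \<in> \<int> \<longleftrightarrow> infdist (x - y) \<int> = 0"
      by (rule in_closed_iff_infdist_zero) (auto simp: closed_Ints intro: Ints_0)
    then show "(infdist (x - y) \<int> = 0) = circle_rel x y"
      by (simp add: circle_rel_def)
  qed
  show "dist x y \<le> dist x z + dist y z" for x y z :: circle
  proof transfer
    fix x y z :: real
    show "infdist (x - y) \<int> \<le> infdist (x - z) \<int> + infdist (y - z) \<int>"
      using infdist_Ints_triangle[of "x - z" "z - y"] infdist_Ints_minus[of "y - z"] by simp
  qed
qed

end

text \<open>The metric topology is the quotient topology.\<close>

lemma continuous_on_circle_proj: "continuous_on A circle_proj"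
proof -
  have "dist (circle_proj x) (circle_proj y) \<le> dist x y" for x y
    using infdist_le[of 0 "\<int>" "x - y"] by (simp add: dist_circle.abs_eq dist_real_def)
  then show ?thesis
    unfolding continuous_on_iff by (meson le_less_trans)
qed

lemma open_circle_iff: "open U \<longleftrightarrow> open (circle_proj -` U)"
proof
  assume "open U"
  then show "open (circle_proj -` U)"
    using continuous_on_circle_proj by (rule open_vimage)
next
  assume V: "open (circle_proj -` U)"
  show "open U"
    unfolding open_dist
  proof
    fix p assume "p \<in> U"
    obtain x where x: "p = circle_proj x" using Quotient_abs_rep[OF Quotient_circle] by metis
    with \<open>p \<in> U\<close> V obtain e where e: "e > 0" "\<And>y. dist y x < e \<Longrightarrow> circle_proj y \<in> U"
      unfolding open_dist by (metis vimageD vimageI)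
    have "q \<in> U" if q: "dist q p < e" for q
    proof -
      obtain y where y: "q = circle_proj y" using Quotient_abs_rep[OF Quotient_circle] by metis
      obtain n where n: "n \<in> \<int>" "infdist (y - x) \<int> = dist (y - x) n"
        using infdist_Ints_attained by blast
      have "dist (y - n) x < e"
        using q n by (simp add: x y dist_circle.abs_eq dist_real_def algebra_simps)
      then have "circle_proj (y - n) \<in> U" by (rule e)
      moreover have "circle_proj (y - n) = q"
        using n by (simp add: y circle_proj_eq_iff)
      ultimately show ?thesis by simp
    qed
    with e show "\<exists>e>0. \<forall>q. dist q p < e \<longrightarrow> q \<in> U" by blast
  qed
qed

lift_definition circle_mult :: "nat \<Rightarrow> circle \<Rightarrow> circle" is "\<lambda>k x. real k * x"
proof -
  fix k :: nat and x y :: real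
  assume "circle_rel x y"
  then have "real k * (x - y) \<in> \<int>"
    unfolding circle_rel_def by (intro Ints_mult) auto
  then show "circle_rel (real k * x) (real k * y)"
    by (simp add: circle_rel_def right_diff_distrib)
qed


section \<open>Orientation preserving homeomorphisms\<close>

definition orientation_preserving :: "(circle \<Rightarrow> circle) \<Rightarrow> bool" where
  "orientation_preserving f \<longleftrightarrow>
     (\<exists>F :: real \<Rightarrow> real. continuous_on UNIV F \<and> strict_mono F \<and>
        (\<forall>x. F (x + 1) = F x + 1) \<and> (\<forall>x. circle_proj (F x) = f (circle_proj x)))"

definition Homeo_plus :: "(circle \<Rightarrow> circle) set" where
  "Homeo_plus = {f. (\<exists>f'. homeomorphism UNIV UNIV f f') \<and> orientation_preserving f}"

definition Homeo_plus_group :: "(circle \<Rightarrow> circle) monoid" where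
  "Homeo_plus_group = \<lparr>carrier = Homeo_plus, monoid.mult = (\<circ>), one = id\<rparr>"

definition homeo_dist :: "(circle \<Rightarrow> circle) \<Rightarrow> (circle \<Rightarrow> circle) \<Rightarrow> real" where
  "homeo_dist f h = (SUP x. dist (f x) (h x))"


section \<open>The space of representations\<close>

text \<open>Homomorphisms are taken to be \<^const>\<open>undefined\<close> outside the carrier of \<open>G\<close>, so that
  each homomorphism is represented by exactly one function.\<close>

definition reps :: "('g, 'm) monoid_scheme \<Rightarrow> ('g \<Rightarrow> circle \<Rightarrow> circle) set" where
  "reps G = hom G Homeo_plus_group \<inter> extensional (carrier G)"

definition reps_subbasic ::
  "('g, 'm) monoid_scheme \<Rightarrow> ('g \<Rightarrow> circle \<Rightarrow> circle) \<Rightarrow> 'g \<Rightarrow> real \<Rightarrow> ('g \<Rightarrow> circle \<Rightarrow> circle) set"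
where
  "reps_subbasic G \<phi> g \<epsilon> = {\<phi>' \<in> reps G. homeo_dist (\<phi>' g) (\<phi> g) < \<epsilon>}"

definition reps_topology :: "('g, 'm) monoid_scheme \<Rightarrow> ('g \<Rightarrow> circle \<Rightarrow> circle) topology" where
  "reps_topology G = topology_generated_by
     {reps_subbasic G \<phi> g \<epsilon> | \<phi> g \<epsilon>. \<phi> \<in> reps G \<and> g \<in> carrier G \<and> \<epsilon> > 0}"

lemma topspace_reps_topology:
  assumes "group G"
  shows "topspace (reps_topology G) = reps G"
proof
  show "topspace (reps_topology G) \<subseteq> reps G"
    unfolding reps_topology_def topology_generated_by_topspace
    by (auto simp: reps_subbasic_def)
  show "reps G \<subseteq> topspace (reps_topology G)"
  proof
    fix \<phi> assume \<phi>: "\<phi> \<in> reps G"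
    have "homeo_dist (\<phi> \<one>\<^bsub>G\<^esub>) (\<phi> \<one>\<^bsub>G\<^esub>) = 0"
      by (simp add: homeo_dist_def)
    then have "\<phi> \<in> reps_subbasic G \<phi> \<one>\<^bsub>G\<^esub> 1"
      using \<phi> by (simp add: reps_subbasic_def)
    moreover have "\<one>\<^bsub>G\<^esub> \<in> carrier G"
      using assms by (simp add: group.is_monoid)
    ultimately show "\<phi> \<in> topspace (reps_topology G)"
      unfolding reps_topology_def topology_generated_by_topspace using \<phi>
      by (auto intro!: exI[of _ "reps_subbasic G \<phi> \<one>\<^bsub>G\<^esub> 1"] exI[of _ \<phi>] exI[of _ "\<one>\<^bsub>G\<^esub>"] exI[of _ 1])
  qed
qed


section \<open>Semiconjugacy\<close>

definition degree_one_monotone :: "(circle \<Rightarrow> circle) \<Rightarrow> bool" where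
  "degree_one_monotone h \<longleftrightarrow>
     (\<exists>H :: real \<Rightarrow> real. mono H \<and> (\<forall>x. H (x + 1) = H x + 1) \<and>
        (\<forall>x. circle_proj (H x) = h (circle_proj x)))"

definition reps_fix :: "('g, 'm) monoid_scheme \<Rightarrow> ('g \<Rightarrow> circle \<Rightarrow> circle) set" where
  "reps_fix G = {\<phi> \<in> reps G. \<exists>x. \<forall>g\<in>carrier G. \<phi> g x = x}"

definition semiconjugate ::
  "('g, 'm) monoid_scheme \<Rightarrow> ('g \<Rightarrow> circle \<Rightarrow> circle) \<Rightarrow> ('g \<Rightarrow> circle \<Rightarrow> circle) \<Rightarrow> bool" where
  "semiconjugate G \<phi>1 \<phi>2 \<longleftrightarrow>
     (\<phi>1 \<in> reps_fix G \<and> \<phi>2 \<in> reps_fix G) \<or>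
     (\<phi>1 \<in> reps G - reps_fix G \<and> \<phi>2 \<in> reps G - reps_fix G \<and>
       (\<exists>h. degree_one_monotone h \<and> (\<forall>g\<in>carrier G. \<phi>2 g \<circ> h = h \<circ> \<phi>1 g)))"


section \<open>Types of representations\<close>

definition type_zero :: "('g, 'm) monoid_scheme \<Rightarrow> ('g \<Rightarrow> circle \<Rightarrow> circle) \<Rightarrow> bool" where
  "type_zero G \<phi> \<longleftrightarrow>
     (\<exists>M :: circle measure. prob_space M \<and> sets M = sets borel \<and>
        (\<forall>g\<in>carrier G. distr M borel (\<phi> g) = M))"

definition minimal_action :: "('g, 'm) monoid_scheme \<Rightarrow> ('g \<Rightarrow> circle \<Rightarrow> circle) \<Rightarrow> bool" where
  "minimal_action G \<phi> \<longleftrightarrow> (\<forall>x. closure ((\<lambda>g. \<phi> g x) ` carrier G) = UNIV)"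

definition minimal_model ::
  "('g, 'm) monoid_scheme \<Rightarrow> ('g \<Rightarrow> circle \<Rightarrow> circle) \<Rightarrow> ('g \<Rightarrow> circle \<Rightarrow> circle) \<Rightarrow> bool" where
  "minimal_model G \<phi> \<psi> \<longleftrightarrow> \<psi> \<in> reps G \<and> semiconjugate G \<phi> \<psi> \<and> minimal_action G \<psi>"

definition fold_lift ::
  "('g, 'm) monoid_scheme \<Rightarrow> nat \<Rightarrow> ('g \<Rightarrow> circle \<Rightarrow> circle) \<Rightarrow> ('g \<Rightarrow> circle \<Rightarrow> circle) \<Rightarrow> bool" where
  "fold_lift G k \<psi> \<phi> \<longleftrightarrow> (\<forall>g\<in>carrier G. \<phi> g \<circ> circle_mult k = circle_mult k \<circ> \<psi> g)"

text \<open>A minimal model is unique up to topological conjugacy, and conjugation preserves the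
  property of being a \<open>k\<close>-fold lift; hence it does not matter which minimal model is taken.\<close>

definition model_is_fold_lift ::
  "('g, 'm) monoid_scheme \<Rightarrow> ('g \<Rightarrow> circle \<Rightarrow> circle) \<Rightarrow> nat \<Rightarrow> bool" where
  "model_is_fold_lift G \<phi> k \<longleftrightarrow>
     k \<ge> 1 \<and> (\<exists>\<psi>. minimal_model G \<phi> \<psi> \<and> (\<exists>\<theta>\<in>reps G. fold_lift G k \<psi> \<theta>))"

definition has_type :: "('g, 'm) monoid_scheme \<Rightarrow> ('g \<Rightarrow> circle \<Rightarrow> circle) \<Rightarrow> nat \<Rightarrow> bool" where
  "has_type G \<phi> k \<longleftrightarrow>
     (if k = 0 then type_zero G \<phi>
      else \<not> type_zero G \<phi> \<and> model_is_fold_lift G \<phi> k \<and>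
           (\<forall>m. model_is_fold_lift G \<phi> m \<longrightarrow> m \<le> k))"

definition reps_of_type :: "('g, 'm) monoid_scheme \<Rightarrow> nat \<Rightarrow> ('g \<Rightarrow> circle \<Rightarrow> circle) set" where
  "reps_of_type G k = {\<phi> \<in> reps G. has_type G \<phi> k}"

end

(*
  A quasi-length of defect d for an action is a function D on the intervals of the line which is
  superadditive, fails to be additive by at most d, gives length 1 to every interval [x, x + 1], and
  does not decrease when an interval is pushed by a lift of a group element and enlarged.  The
  representations that admit one form a closed set: quasi-lengths live in a compact space of
  functions, so nonexistence is witnessed by finitely many strict inequalities between finitely many
  lifts, which persist under perturbation.

  Defect 0 means an invariant measure, i.e. type 0.  If a minimal model commutes with the rotation
  by 1/m, then counting the intervals of length 1/m that fit into (x, y] has defect 1/m.  Conversely,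
  for a minimal action without invariant measure, among the increasing maps s > id that commute with
  all lifts there is a least one, tau, and its q-th power is the translation by 1 for some q.  Any interval (x, y)
  with y < tau x can be contracted to a point, so it has quasi-length 0; as q + 1 such intervals
  cover [0, 1], the defect is at least 1/q.  Conjugating tau to the rotation by 1/q exhibits the
  minimal model as a q-fold lift.  Hence the types 1, ..., k are exactly the complement of the closed
  set of representations with a quasi-length of defect 1/(k+1).
*)
theory Submission
  imports Defs
begin

section \<open>Lifts to the line\<close>

text \<open>The type is read off a minimal model, which depends on the whole infinite group at once
  and gives no direct hold on nearby homomorphisms. A quasi-length lives on the original action, and
  each of its push conditions involves a single lift. The strict inequalities \<open>F x < a\<close>
  and \<open>b < F y\<close> serve two ends: they survive a small change of \<open>F\<close>, and
  they pass through a monotone, possibly discontinuous section of the map that collapses gaps.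

  That a least \<open>\<tau>\<close> exists rests on the same compactness. If positive central maps
  could have arbitrarily many iterates of 0 in \<open>[0, 1]\<close>, counting their steps would
  give quasi-lengths of arbitrarily small defect, hence one of defect 0.

  The two estimates match. An m-fold lift yields defect \<open>1 / m\<close>, while the model
  constructed here is a q-fold lift for a q such that every defect is at least \<open>1 / q\<close>.
  So in the absence of an invariant measure, defect \<open>1 / (k + 1)\<close> occurs exactly when
  some fold number exceeds k.\<close>

lemma circle_proj_surj: "\<exists>x. p = circle_proj x"
  using Quotient_abs_rep[OF Quotient_circle] by metis

lemma circle_proj_add_int [simp]: "circle_proj (x + of_int n) = circle_proj x"
  by (simp add: circle_proj_eq_iff)

text \<open>The increment \<open>c\<close> stays general: it is 1 for lifts, the degree for lifts of
  maps of higher degree, and a step still to be determined when a lift is followed along multiples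
  of \<open>1 / m\<close>.\<close>

lemma add_int_of_add_one:
  fixes H :: "real \<Rightarrow> real"
  assumes "\<And>x. H (x + 1) = H x + c"
  shows "H (x + of_int n) = H x + of_int n * c"
proof (induction n rule: int_induct[where k = 0])
  case base
  then show ?case by simp
next
  case (step1 i)
  have "H (x + of_int (i + 1)) = H (x + of_int i) + c"
    using assms[of "x + of_int i"] by (simp add: algebra_simps)
  then show ?case using step1 by (simp add: algebra_simps)
next
  case (step2 i)
  have "H (x + of_int i) = H (x + of_int (i - 1)) + c"
    using assms[of "x + of_int (i - 1)"] by (simp add: algebra_simps)
  then show ?case using step2 by (simp add: algebra_simps)
qed

lemma surj_of_add_one:
  fixes H :: "real \<Rightarrow> real"
  assumes "\<And>x. H (x + 1) = H x + c" "continuous_on UNIV H" "c > 0"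
  shows "\<exists>x. H x = u"
proof -
  obtain n :: nat where n: "\<bar>u - H 0\<bar> / c < real n" using reals_Archimedean2 by blast
  then have n': "\<bar>u - H 0\<bar> < real n * c" using \<open>c > 0\<close> by (simp add: field_simps)
  have "H (real n) = H 0 + real n * c" "H (- real n) = H 0 - real n * c"
    using add_int_of_add_one[of H c 0 "int n"] add_int_of_add_one[of H c 0 "- int n"] assms(1)
    by auto
  then have "H (- real n) \<le> u" "u \<le> H (real n)" using n' by linarith+
  then show ?thesis
    using IVT'[of H "- real n" u "real n"] assms(2) continuous_on_subset by fastforce
qed

text \<open>Distinct integers are at distance at least 1, so a continuous function cannot move
  between them. This turns a congruence modulo 1 at every point into a single integer
  constant.\<close>

lemma continuous_Ints_valued_constant:
  fixes E :: "real \<Rightarrow> real"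
  assumes "continuous_on UNIV E" "\<And>x. E x \<in> \<int>"
  shows "E x = E y"
proof -
  have "\<exists>e>0. \<forall>y. y \<in> UNIV \<and> E y \<noteq> E x \<longrightarrow> e \<le> norm (E y - E x)" for x
  proof (intro exI[of _ 1] conjI allI impI)
    fix y assume "y \<in> UNIV \<and> E y \<noteq> E x"
    moreover have "E y - E x \<in> \<int>" using assms(2) by (rule Ints_diff[OF _ assms(2)])
    ultimately show "1 \<le> norm (E y - E x)" using Ints_nonzero_abs_ge1[of "E y - E x"] by auto
  qed simp
  then have "E constant_on UNIV"
    by (intro continuous_discrete_range_constant[OF connected_UNIV assms(1)]) blast
  then show ?thesis unfolding constant_on_def by auto
qed

lemma continuous_of_mono_surj:
  fixes H :: "real \<Rightarrow> real"
  assumes "mono H" "\<And>u. \<exists>x. H x = u"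
  shows "continuous_on UNIV H"
proof (rule continuous_onI_mono)
  have "range H = UNIV" using assms(2) by (metis surj_def)
  then show "open (range H)" by simp
qed (use assms in \<open>auto simp: mono_def\<close>)

definition lift_of :: "(real \<Rightarrow> real) \<Rightarrow> (circle \<Rightarrow> circle) \<Rightarrow> bool" where
  "lift_of F f \<longleftrightarrow> continuous_on UNIV F \<and> strict_mono F \<and>
     (\<forall>x. F (x + 1) = F x + 1) \<and> (\<forall>x. circle_proj (F x) = f (circle_proj x))"

lemma lift_ofD:
  assumes "lift_of F f"
  shows "continuous_on UNIV F" "strict_mono F" "F (x + 1) = F x + 1"
    "circle_proj (F x) = f (circle_proj x)"
  using assms unfolding lift_of_def by auto

lemma lift_of_add_int:
  assumes "lift_of F f"
  shows "lift_of (\<lambda>x. F x + of_int n) f"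
  using assms unfolding lift_of_def by (auto intro!: continuous_intros simp: strict_mono_def)

lemma lift_of_comp:
  assumes "lift_of F f" "lift_of F' f'"
  shows "lift_of (F \<circ> F') (f \<circ> f')"
  using assms unfolding lift_of_def
  by (auto intro: continuous_on_compose2[of UNIV F UNIV F'] strict_mono_o simp: o_def strict_mono_def)

lemma lift_of_inverse:
  assumes "lift_of F f"
  obtains F' where "\<And>x. F (F' x) = x" "\<And>x. F' (F x) = x" "continuous_on UNIV F'"
    "strict_mono F'" "\<And>x. F' (x + 1) = F' x + 1"
proof -
  note F = lift_ofD[OF assms]
  have surj: "\<exists>x. F x = u" for u using surj_of_add_one[of F 1 u] F by auto
  have inj: "F x = F y \<longleftrightarrow> x = y" for x y using F(2) strict_mono_eq by blast
  define F' where "F' u = (THE x. F x = u)" for u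
  have 1: "F (F' u) = u" for u
    unfolding F'_def by (rule theI') (metis surj inj)
  have 2: "F' (F x) = x" for x using 1[of "F x"] inj by blast
  have 3: "strict_mono F'"
    by (metis "1" F(2) strict_mono_def strict_mono_less)
  have 4: "F' (x + 1) = F' x + 1" for x
    by (metis "1" F(3) inj)
  have 5: "continuous_on UNIV F'"
    by (rule continuous_of_mono_surj) (use 3 2 in \<open>auto intro: strict_mono_mono\<close>)
  show thesis by (rule that[OF 1 2 5 3 4])
qed

text \<open>The circle carries the quotient topology, so openness of a preimage is tested on the
  line.\<close>

lemma continuous_on_lifted:
  assumes "\<And>x. circle_proj (F x) = f (circle_proj x)" "continuous_on UNIV F"
  shows "continuous_on UNIV f"
proof (subst continuous_on_open_vimage[OF open_UNIV], intro allI impI)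
  fix B :: "circle set" assume B: "open B"
  have "circle_proj -` (f -` B) = F -` (circle_proj -` B)"
    using assms(1) by auto
  also have "open \<dots>"
    using B assms(2) by (metis open_circle_iff open_vimage)
  finally show "open (f -` B \<inter> UNIV)" by (simp add: open_circle_iff[of "f -` B"])
qed

lemma Homeo_plusI:
  assumes "lift_of F f" "\<And>p. f (f' p) = p" "\<And>p. f' (f p) = p"
  shows "f \<in> Homeo_plus"
proof -
  obtain F' where F': "\<And>x. F (F' x) = x" "continuous_on UNIV F'"
    using lift_of_inverse[OF assms(1)] by metis
  have "circle_proj (F' x) = f' (circle_proj x)" for x
    by (metis F'(1) assms(1) assms(3) lift_ofD(4))
  then have "continuous_on UNIV f'" using F'(2) continuous_on_lifted by blast
  moreover have "continuous_on UNIV f"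
    by (rule continuous_on_lifted[of F]) (use assms(1) lift_ofD in auto)
  ultimately have "homeomorphism UNIV UNIV f f'"
    using assms(2,3) by (intro homeomorphismI) auto
  moreover have "orientation_preserving f"
    using assms(1) unfolding orientation_preserving_def lift_of_def by blast
  ultimately show ?thesis unfolding Homeo_plus_def by blast
qed

lemma Homeo_plusE:
  assumes "f \<in> Homeo_plus"
  obtains F f' where "lift_of F f" "\<And>p. f (f' p) = p" "\<And>p. f' (f p) = p"
  using assms unfolding Homeo_plus_def orientation_preserving_def lift_of_def homeomorphism_def
  by auto

section \<open>Groups of increasing homeomorphisms of the line\<close>

definition lifts :: "('g, 'm) monoid_scheme \<Rightarrow> ('g \<Rightarrow> circle \<Rightarrow> circle) \<Rightarrow> (real \<Rightarrow> real) set" where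
  "lifts G \<phi> = {F. \<exists>g\<in>carrier G. lift_of F (\<phi> g)}"

text \<open>The arguments on the line use only these properties. They apply to
  \<open>lifts G \<phi>\<close>, the extension of the image of \<phi> by the integer translations,
  and again to the group induced on the line of the minimal model.\<close>

locale line_group =
  fixes \<Gamma> :: "(real \<Rightarrow> real) set"
  assumes continuous: "F \<in> \<Gamma> \<Longrightarrow> continuous_on UNIV F"
    and strict_mono: "F \<in> \<Gamma> \<Longrightarrow> strict_mono F"
    and add_one: "F \<in> \<Gamma> \<Longrightarrow> F (x + 1) = F x + 1"
    and comp: "F \<in> \<Gamma> \<Longrightarrow> F' \<in> \<Gamma> \<Longrightarrow> F \<circ> F' \<in> \<Gamma>"
    and inverse: "F \<in> \<Gamma> \<Longrightarrow> \<exists>F'\<in>\<Gamma>. (\<forall>x. F (F' x) = x) \<and> (\<forall>x. F' (F x) = x)"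
    and translation: "(\<lambda>x. x + 1) \<in> \<Gamma>"
begin

lemma id_mem: "(\<lambda>x. x) \<in> \<Gamma>"
proof -
  obtain F where F: "F \<in> \<Gamma>" "\<forall>x. F x + 1 = x" using inverse[OF translation] by auto
  have "(\<lambda>x. x + 1) \<circ> F \<in> \<Gamma>" using F translation comp by blast
  moreover have "(\<lambda>x. x + 1) \<circ> F = (\<lambda>x. x)" using F by auto
  ultimately show ?thesis by simp
qed

lemma int_translation: "(\<lambda>x. x + of_int n) \<in> \<Gamma>"
proof (induction n rule: int_induct[where k = 0])
  case base
  then show ?case using id_mem by simp
next
  case (step1 i)
  have "(\<lambda>x. x + 1) \<circ> (\<lambda>x. x + of_int i) \<in> \<Gamma>" using step1 translation comp by blast
  then show ?case by (simp add: o_def algebra_simps)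
next
  case (step2 i)
  obtain F where F: "F \<in> \<Gamma>" "\<forall>x. F x + 1 = x" using inverse[OF translation] by auto
  have "F = (\<lambda>x. x - 1)" using F(2) by (metis add_diff_cancel_right')
  then have "(\<lambda>x. x - 1) \<circ> (\<lambda>x. x + of_int i) \<in> \<Gamma>" using step2 F comp by blast
  then show ?case by (simp add: o_def algebra_simps)
qed

lemma add_int: "F \<in> \<Gamma> \<Longrightarrow> F (x + of_int n) = F x + of_int n"
  using add_int_of_add_one[of F 1] add_one by simp

lemma less_iff: "F \<in> \<Gamma> \<Longrightarrow> F x < F y \<longleftrightarrow> x < y"
  using strict_mono strict_mono_less by blast

lemma le_iff: "F \<in> \<Gamma> \<Longrightarrow> F x \<le> F y \<longleftrightarrow> x \<le> y"
  using strict_mono strict_mono_less_eq by blast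

text \<open>\<open>P\<close> is \<open>F\<close> carried through \<open>H\<close>: the fibre
  condition with \<open>n = 0\<close> makes it well defined, and the inverse lift makes it injective
  and onto. The condition with \<open>n = 1\<close> gives degree one even when \<open>H\<close>
  itself has a higher degree.\<close>

lemma descend:
  fixes H :: "real \<Rightarrow> real"
  assumes mono: "mono H" and surj: "\<And>u. \<exists>x. H x = u"
    and fibres: "\<And>F x y n. F \<in> \<Gamma> \<Longrightarrow> H x = H y + of_int n \<Longrightarrow> H (F x) = H (F y) + of_int n"
    and F: "F \<in> \<Gamma>"
  shows "\<exists>P. continuous_on UNIV P \<and> strict_mono P \<and> (\<forall>x. P (x + 1) = P x + 1) \<and>
    (\<forall>x. P (H x) = H (F x))"
proof -
  obtain F' where F': "F' \<in> \<Gamma>" "\<And>x. F (F' x) = x" "\<And>x. F' (F x) = x"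
    using inverse[OF F] by blast
  define R where "R u = (SOME x. H x = u)" for u
  have R: "H (R u) = u" for u unfolding R_def by (rule someI_ex) (rule surj)
  define P where "P u = H (F (R u))" for u
  have PH: "P (H x) = H (F x)" for x
    using fibres[OF F, of "R (H x)" x 0] R by (simp add: P_def)
  have le: "x < y" if "H x < H y" for x y
    using that monoD[OF mono, of y x] by linarith
  have sm: "strict_mono P"
  proof (rule strict_monoI)
    fix u v :: real assume uv: "u < v"
    then have "R u < R v" using le R by metis
    then have "F (R u) < F (R v)" using less_iff[OF F] by blast
    then have "P u \<le> P v" unfolding P_def using mono by (simp add: monoD)
    moreover have "P u \<noteq> P v"
    proof
      assume "P u = P v"
      then have "H (F' (F (R u))) = H (F' (F (R v)))"
        using fibres[OF F'(1), of "F (R u)" "F (R v)" 0] by (simp add: P_def)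
      then show False using uv F'(3) R by simp
    qed
    ultimately show "P u < P v" by simp
  qed
  have "\<exists>v. P v = u" for u
    by (metis F'(2) PH surj)
  then have cP: "continuous_on UNIV P"
    using continuous_of_mono_surj sm strict_mono_mono by blast
  have "P (u + 1) = P u + 1" for u
    using fibres[OF F, of "R (u + 1)" "R u" 1] R by (simp add: P_def)
  then show ?thesis using sm cP PH by blast
qed

end

section \<open>Homomorphisms, their lifts and their quotients\<close>

lemma reps_one:
  assumes "group G" "\<phi> \<in> reps G"
  shows "\<phi> \<one>\<^bsub>G\<^esub> = id"
proof -
  interpret group G by fact
  have \<phi>: "\<phi> \<in> hom G Homeo_plus_group" using assms by (auto simp: reps_def)
  have "\<phi> (\<one>\<^bsub>G\<^esub> \<otimes>\<^bsub>G\<^esub> \<one>\<^bsub>G\<^esub>) = \<phi> \<one>\<^bsub>G\<^esub> \<circ> \<phi> \<one>\<^bsub>G\<^esub>"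
    using hom_mult[OF \<phi> one_closed one_closed] by (simp add: Homeo_plus_group_def)
  then have 1: "\<phi> \<one>\<^bsub>G\<^esub> p = \<phi> \<one>\<^bsub>G\<^esub> (\<phi> \<one>\<^bsub>G\<^esub> p)" for p by (metis comp_apply one_closed r_one)
  have "\<phi> \<one>\<^bsub>G\<^esub> \<in> Homeo_plus" using hom_in_carrier[OF \<phi>] by (simp add: Homeo_plus_group_def)
  then obtain f' where "\<And>p. f' (\<phi> \<one>\<^bsub>G\<^esub> p) = p" using Homeo_plusE by blast
  then show ?thesis using 1 by (metis eq_id_iff)
qed

lemma reps_mult:
  assumes "\<phi> \<in> reps G" "g \<in> carrier G" "h \<in> carrier G"
  shows "\<phi> (g \<otimes>\<^bsub>G\<^esub> h) = \<phi> g \<circ> \<phi> h"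
  using assms hom_mult[of \<phi> G Homeo_plus_group g h] by (auto simp: reps_def Homeo_plus_group_def)

lemma reps_inverse:
  assumes "group G" "\<phi> \<in> reps G" "g \<in> carrier G"
  shows "\<phi> (inv\<^bsub>G\<^esub> g) (\<phi> g p) = p" "\<phi> g (\<phi> (inv\<^bsub>G\<^esub> g) p) = p"
proof -
  interpret group G by fact
  show "\<phi> (inv\<^bsub>G\<^esub> g) (\<phi> g p) = p" "\<phi> g (\<phi> (inv\<^bsub>G\<^esub> g) p) = p"
    using reps_mult[OF assms(2), of "inv\<^bsub>G\<^esub> g" g] reps_mult[OF assms(2), of g "inv\<^bsub>G\<^esub> g"]
      reps_one[OF assms(1,2)] assms(3)
    by (simp_all, metis comp_apply id_apply, metis comp_apply id_apply)
qed

lemma reps_lift: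
  assumes "\<phi> \<in> reps G" "g \<in> carrier G"
  shows "\<exists>F. lift_of F (\<phi> g)"
proof -
  have "\<phi> g \<in> Homeo_plus"
    using assms hom_in_carrier[of \<phi> G Homeo_plus_group g]
    by (auto simp: reps_def Homeo_plus_group_def)
  then show ?thesis using Homeo_plusE by blast
qed

lemma line_group_lifts:
  assumes "group G" "\<phi> \<in> reps G"
  shows "line_group (lifts G \<phi>)"
proof
  interpret group G by fact
  show "F \<in> lifts G \<phi> \<Longrightarrow> continuous_on UNIV F" for F by (auto simp: lifts_def lift_of_def)
  show "F \<in> lifts G \<phi> \<Longrightarrow> strict_mono F" for F by (auto simp: lifts_def lift_of_def)
  show "F \<in> lifts G \<phi> \<Longrightarrow> F (x + 1) = F x + 1" for F x by (auto simp: lifts_def lift_of_def)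
  show "F \<circ> F' \<in> lifts G \<phi>" if FF: "F \<in> lifts G \<phi>" "F' \<in> lifts G \<phi>" for F F'
  proof -
    obtain g g' where g: "g \<in> carrier G" "lift_of F (\<phi> g)" "g' \<in> carrier G" "lift_of F' (\<phi> g')"
      using FF by (auto simp: lifts_def)
    then have "lift_of (F \<circ> F') (\<phi> (g \<otimes>\<^bsub>G\<^esub> g'))"
      using lift_of_comp reps_mult[OF assms(2)] by simp
    then show ?thesis using g m_closed unfolding lifts_def by blast
  qed
  show "(\<lambda>x. x + 1) \<in> lifts G \<phi>"
  proof -
    have "lift_of (\<lambda>x. x + 1) (\<phi> \<one>\<^bsub>G\<^esub>)"
      using circle_proj_add_int[of _ 1]
      by (auto simp: lift_of_def reps_one[OF assms] strict_mono_def intro!: continuous_intros)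
    then show ?thesis unfolding lifts_def by auto
  qed
  show "\<exists>F'\<in>lifts G \<phi>. (\<forall>x. F (F' x) = x) \<and> (\<forall>x. F' (F x) = x)" if F: "F \<in> lifts G \<phi>" for F
  proof -
    obtain g where g: "g \<in> carrier G" "lift_of F (\<phi> g)" using F by (auto simp: lifts_def)
    obtain F' where F': "\<And>x. F (F' x) = x" "\<And>x. F' (F x) = x" "continuous_on UNIV F'"
      "strict_mono F'" "\<And>x. F' (x + 1) = F' x + 1"
      using lift_of_inverse[OF g(2)] by blast
    have "circle_proj (F' x) = \<phi> (inv\<^bsub>G\<^esub> g) (circle_proj x)" for x
      using reps_inverse(1)[OF assms g(1), of "circle_proj (F' x)"]
        lift_ofD(4)[OF g(2), of "F' x"] F'(1)[of x] by simp
    then have "lift_of F' (\<phi> (inv\<^bsub>G\<^esub> g))" using F' by (auto simp: lift_of_def)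
    then show ?thesis using F' g unfolding lifts_def by blast
  qed
qed

text \<open>Needed for two degrees: \<open>q = 1\<close> yields the minimal model, and the q-fold
  multiple of the same line map yields the homomorphism that it lifts. The integer shifts in the
  fibre condition ensure that the fibres of \<open>h\<close> on the circle, not only those of
  \<open>H\<close>, are mapped into fibres.\<close>

lemma factor_representation:
  fixes G :: "('g, 'm) monoid_scheme" and q :: nat
  assumes G: "group G" and \<phi>: "\<phi> \<in> reps G" and q: "q \<ge> 1"
    and cont: "continuous_on UNIV H" and mono: "mono H"
    and H_add_one: "\<And>x. H (x + 1) = H x + real q"
    and fibres: "\<And>F x y n. F \<in> lifts G \<phi> \<Longrightarrow> H x = H y + of_int n \<Longrightarrow> H (F x) = H (F y) + of_int n"
    and h: "\<And>x. h (circle_proj x) = circle_proj (H x)"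
  shows "\<exists>\<psi>\<in>reps G. \<forall>g\<in>carrier G. \<psi> g \<circ> h = h \<circ> \<phi> g \<and>
    (\<forall>F. lift_of F (\<phi> g) \<longrightarrow> (\<exists>P. lift_of P (\<psi> g) \<and> (\<forall>x. P (H x) = H (F x))))"
proof -
  interpret group G by fact
  interpret line_group "lifts G \<phi>" by (rule line_group_lifts[OF G \<phi>])
  have surjH: "\<exists>x. H x = u" for u
    using surj_of_add_one[of H "real q" u] H_add_one cont q by simp
  have surjh: "\<exists>c. h c = p" for p by (metis circle_proj_surj h surjH)
  have fib: "h (\<phi> g c) = h (\<phi> g c')" if g: "g \<in> carrier G" and eq: "h c = h c'" for g c c'
  proof -
    obtain F where F: "lift_of F (\<phi> g)" using reps_lift[OF \<phi> g] by blast
    obtain x y where xy: "c = circle_proj x" "c' = circle_proj y" using circle_proj_surj by metis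
    then have "H x - H y \<in> \<int>" using eq by (simp add: h circle_proj_eq_iff)
    then obtain n where "H x = H y + of_int n" by (metis Ints_cases add.commute diff_add_cancel)
    then have "H (F x) = H (F y) + of_int n" using fibres F g lifts_def by blast
    then have "circle_proj (H (F x)) = circle_proj (H (F y))" by simp
    then show ?thesis using lift_ofD(4)[OF F] xy by (metis h)
  qed
  define S where "S p = (SOME c. h c = p)" for p
  have S: "h (S p) = p" for p unfolding S_def by (rule someI_ex) (rule surjh)
  \<comment> \<open>Elements of \<open>reps G\<close> are undefined off the carrier, hence the
    restriction.\<close>
  define \<psi> where "\<psi> = restrict (\<lambda>g p. h (\<phi> g (S p))) (carrier G)"
  have \<psi>h: "\<psi> g (h c) = h (\<phi> g c)" if "g \<in> carrier G" for g c
    unfolding \<psi>_def using that fib[OF that, of "S (h c)" c] S[of "h c"] by simp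
  have lift: "\<exists>P. lift_of P (\<psi> g) \<and> (\<forall>x. P (H x) = H (F x))"
    if g: "g \<in> carrier G" and F: "lift_of F (\<phi> g)" for g F
  proof -
    have FL: "F \<in> lifts G \<phi>" using g F by (auto simp: lifts_def)
    have "\<exists>P. continuous_on UNIV P \<and> strict_mono P \<and> (\<forall>x. P (x + 1) = P x + 1) \<and>
      (\<forall>x. P (H x) = H (F x))"
      by (rule descend[OF mono surjH _ FL]) (rule fibres)
    then obtain P where P: "continuous_on UNIV P" "strict_mono P" "\<forall>x. P (x + 1) = P x + 1"
      "\<forall>x. P (H x) = H (F x)"
      by blast
    have "circle_proj (P u) = \<psi> g (circle_proj u)" for u
    proof -
      obtain x where x: "H x = u" using surjH by blast
      have "circle_proj (P u) = h (circle_proj (F x))" using x P(4) h by metis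
      also have "\<dots> = h (\<phi> g (circle_proj x))" using lift_ofD(4)[OF F] by simp
      also have "\<dots> = \<psi> g (circle_proj u)" using \<psi>h[OF g] h x by metis
      finally show ?thesis .
    qed
    then have "lift_of P (\<psi> g)" using P by (auto simp: lift_of_def)
    then show ?thesis using P(4) by blast
  qed
  have mult: "\<psi> (g \<otimes>\<^bsub>G\<^esub> g') = \<psi> g \<circ> \<psi> g'" if "g \<in> carrier G" "g' \<in> carrier G" for g g'
  proof
    fix p
    obtain c where "p = h c" using surjh by metis
    then show "\<psi> (g \<otimes>\<^bsub>G\<^esub> g') p = (\<psi> g \<circ> \<psi> g') p"
      using that by (simp add: \<psi>h reps_mult[OF \<phi>])
  qed
  have hp: "\<psi> g \<in> Homeo_plus" if g: "g \<in> carrier G" for g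
  proof -
    obtain F where F: "lift_of F (\<phi> g)" using reps_lift[OF \<phi> g] by blast
    obtain P where P: "lift_of P (\<psi> g)" using lift[OF g F] by blast
    show ?thesis
    proof (rule Homeo_plusI[OF P])
      fix p
      obtain c where c: "p = h c" using surjh by metis
      show "\<psi> g (\<psi> (inv\<^bsub>G\<^esub> g) p) = p" "\<psi> (inv\<^bsub>G\<^esub> g) (\<psi> g p) = p"
        using g by (simp_all add: c \<psi>h reps_inverse[OF G \<phi>])
    qed
  qed
  have "\<psi> \<in> hom G Homeo_plus_group"
    by (rule homI) (use mult hp in \<open>auto simp: Homeo_plus_group_def\<close>)
  then have "\<psi> \<in> reps G" by (auto simp: reps_def \<psi>_def)
  moreover have "\<psi> g \<circ> h = h \<circ> \<phi> g" if "g \<in> carrier G" for g using \<psi>h[OF that] by auto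
  ultimately show ?thesis using lift by blast
qed

section \<open>Quasi-lengths\<close>

text \<open>Only pairs with \<open>x \<le> y\<close> carry information: for an increasing lift,
  \<open>F x < F y\<close> forces \<open>x < y\<close>. The push clause is strict on both sides,
  which makes it an open condition on \<open>F\<close>.\<close>

definition quasi_length :: "(real \<Rightarrow> real) set \<Rightarrow> real \<Rightarrow> (real \<Rightarrow> real \<Rightarrow> real) \<Rightarrow> bool" where
  "quasi_length \<Gamma> d D \<longleftrightarrow>
     (\<forall>x y z. x \<le> y \<and> y \<le> z \<longrightarrow>
        0 \<le> D x y \<and> D x y + D y z \<le> D x z \<and> D x z \<le> D x y + D y z + d) \<and>
     (\<forall>x. D x (x + 1) = 1) \<and>
     (\<forall>F\<in>\<Gamma>. \<forall>x a b y. F x < a \<and> a \<le> b \<and> b < F y \<longrightarrow> D a b \<le> D x y)"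

definition has_quasi_length :: "(real \<Rightarrow> real) set \<Rightarrow> real \<Rightarrow> bool" where
  "has_quasi_length \<Gamma> d \<longleftrightarrow> (\<exists>D. quasi_length \<Gamma> d D)"

lemma quasi_lengthD:
  assumes "quasi_length \<Gamma> d D"
  shows "x \<le> y \<Longrightarrow> 0 \<le> D x y"
    and "x \<le> y \<Longrightarrow> y \<le> z \<Longrightarrow> D x y + D y z \<le> D x z"
    and "x \<le> y \<Longrightarrow> y \<le> z \<Longrightarrow> D x z \<le> D x y + D y z + d"
    and "D x (x + 1) = 1"
    and "F \<in> \<Gamma> \<Longrightarrow> F x < a \<Longrightarrow> a \<le> b \<Longrightarrow> b < F y \<Longrightarrow> D a b \<le> D x y"
  using assms unfolding quasi_length_def by blast+

lemma quasi_lengthI: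
  assumes "\<And>x y. x \<le> y \<Longrightarrow> 0 \<le> D x y"
    and "\<And>x y z. x \<le> y \<Longrightarrow> y \<le> z \<Longrightarrow> D x y + D y z \<le> D x z"
    and "\<And>x y z. x \<le> y \<Longrightarrow> y \<le> z \<Longrightarrow> D x z \<le> D x y + D y z + d"
    and "\<And>x. D x (x + 1) = 1"
    and "\<And>F x a b y. F \<in> \<Gamma> \<Longrightarrow> F x < a \<Longrightarrow> a \<le> b \<Longrightarrow> b < F y \<Longrightarrow> D a b \<le> D x y"
  shows "quasi_length \<Gamma> d D"
  unfolding quasi_length_def
  by (intro conjI allI impI ballI; (elim conjE)?; (rule assms; assumption)?)

lemma has_quasi_length_mono:
  assumes "has_quasi_length \<Gamma> d" "d \<le> d'"
  shows "has_quasi_length \<Gamma> d'"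
proof -
  obtain D where D: "quasi_length \<Gamma> d D" using assms(1) unfolding has_quasi_length_def by blast
  have 3: "D x z \<le> D x y + D y z + d'" if "x \<le> y" "y \<le> z" for x y z
    using quasi_lengthD(3)[OF D that] assms(2) by linarith
  have "quasi_length \<Gamma> d' D"
    by (rule quasi_lengthI; (rule 3 quasi_lengthD[OF D]; assumption)?)
  then show ?thesis unfolding has_quasi_length_def by blast
qed

lemma quasi_length_refl:
  assumes "quasi_length \<Gamma> d D"
  shows "D x x = 0"
  using quasi_lengthD(2)[OF assms, of x x x] quasi_lengthD(1)[OF assms, of x x] by auto

lemma quasi_length_mono:
  assumes "quasi_length \<Gamma> d D" "x' \<le> x" "x \<le> y" "y \<le> y'"
  shows "D x y \<le> D x' y'"
proof -
  note D = quasi_lengthD[OF assms(1)]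
  have "D x y \<le> D x y'" using D(2)[of x y y'] D(1)[of y y'] assms by linarith
  also have "\<dots> \<le> D x' y'" using D(2)[of x' x y'] D(1)[of x' x] assms by linarith
  finally show ?thesis .
qed

text \<open>The bound does not depend on \<open>D\<close>, so all quasi-lengths of bounded defect
  lie in one product of compact intervals.\<close>

lemma quasi_length_bound:
  assumes "quasi_length \<Gamma> d D" "x \<le> y"
  shows "D x y \<le> real (nat \<lceil>y - x\<rceil>) * (1 + d)"
proof -
  note D = quasi_lengthD[OF assms(1)]
  have "D x (x + real n) \<le> real n * (1 + d)" for n
  proof (induction n)
    case 0
    then show ?case using quasi_length_refl[OF assms(1)] by simp
  next
    case (Suc n)
    have "D x (x + real (Suc n)) \<le> D x (x + real n) + D (x + real n) (x + real n + 1) + d"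
      using D(3)[of x "x + real n" "x + real n + 1"] by (simp add: algebra_simps)
    then show ?case using Suc D(4)[of "x + real n"] by (simp add: algebra_simps)
  qed
  moreover have "D x y \<le> D x (x + real (nat \<lceil>y - x\<rceil>))"
    by (rule quasi_length_mono[OF assms(1)]) (use assms(2) in linarith)+
  ultimately show ?thesis using order_trans by blast
qed

section \<open>Compactness of the space of quasi-lengths\<close>

lemma compact_PiE_UNIV:
  fixes A :: "'i \<Rightarrow> real set"
  assumes "\<And>i. compact (A i)"
  shows "compact {f. \<forall>i. f i \<in> A i}"
proof -
  have "compactin (product_topology (\<lambda>i. euclidean) UNIV) (PiE UNIV A)"
    using assms by (subst compactin_PiE) auto
  moreover have "PiE UNIV A = {f. \<forall>i. f i \<in> A i}" by (auto simp: PiE_def)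
  ultimately show ?thesis by (simp add: euclidean_product_topology)
qed

text \<open>Quasi-lengths form a compact space in the topology of pointwise convergence, so the absence
  of one is witnessed by finitely many of the inequalities that define it.\<close>

lemma no_quasi_length_witness:
  assumes mono: "\<And>F. F \<in> \<Gamma> \<Longrightarrow> mono F" and "\<not> has_quasi_length \<Gamma> d"
  shows "\<exists>W \<epsilon>. finite W \<and> \<epsilon> > 0 \<and>
    (\<forall>F x a b y. (F, x, a, b, y) \<in> W \<longrightarrow> F \<in> \<Gamma> \<and> F x < a \<and> a \<le> b \<and> b < F y) \<and>
    (\<forall>\<Gamma>' d'. d' < d + \<epsilon> \<longrightarrow>
       (\<forall>F x a b y. (F, x, a, b, y) \<in> W \<longrightarrow> (\<exists>F'\<in>\<Gamma>'. F' x < a \<and> b < F' y)) \<longrightarrow>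
       \<not> has_quasi_length \<Gamma>' d')"
proof -
  \<comment> \<open>Every defect \<open>d' < d + \<epsilon>\<close> with
    \<open>\<epsilon> \<le> 1\<close> satisfies \<open>1 + d' \<le> 2 + \<bar>d\<bar>\<close>, so
    this box holds the quasi-lengths of all these defects once they are set to 0 at reversed
    pairs.\<close>
  define K where "K = {f :: real \<times> real \<Rightarrow> real.
    \<forall>p. f p \<in> {0 .. real (nat \<lceil>snd p - fst p\<rceil>) * (2 + \<bar>d\<bar>)}}"
  have K: "compact K" unfolding K_def by (rule compact_PiE_UNIV) simp
  \<comment> \<open>The defect is relaxed by every \<open>e\<close> in \<open>(0, 1]\<close> instead
    of being fixed at \<open>d\<close>; a finite subfamily then leaves a positive margin in the
    defect as well.\<close>
  define A where "A e = {f :: real \<times> real \<Rightarrow> real.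
      (\<forall>x y z. x \<le> y \<and> y \<le> z \<longrightarrow> 0 \<le> f (x, y) \<and>
        f (x, y) + f (y, z) \<le> f (x, z) \<and> f (x, z) \<le> f (x, y) + f (y, z) + (d + e)) \<and>
      (\<forall>x. f (x, x + 1) = 1)}" for e
  define B :: "(real \<Rightarrow> real) \<times> real \<times> real \<times> real \<times> real \<Rightarrow> (real \<times> real \<Rightarrow> real) set"
    where "B = (\<lambda>(F, x, a, b, y). {f. f (a, b) \<le> f (x, y)})"
  define I where "I = {(F, x, a, b, y). F \<in> \<Gamma> \<and> F x < a \<and> a \<le> b \<and> b < F y}"
  have "closed (A e)" for e
    unfolding A_def
    by (intro closed_Collect_conj closed_Collect_all closed_Collect_imp open_Collect_const
        closed_Collect_le closed_Collect_eq continuous_intros) auto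
  moreover have "closed (B w)" for w
    unfolding B_def by (cases w) (auto intro!: closed_Collect_le continuous_intros)
  ultimately have cl: "closed T" if "T \<in> A ` {0<..1} \<union> B ` I" for T using that by auto
  have "K \<inter> \<Inter>(A ` {0<..1} \<union> B ` I) = {}"
  proof (rule ccontr)
    assume "K \<inter> \<Inter>(A ` {0<..1} \<union> B ` I) \<noteq> {}"
    then obtain f where f: "f \<in> K \<inter> \<Inter>(A ` {0<..1} \<union> B ` I)" by blast
    have fA: "f \<in> A e" if "e > 0" "e \<le> 1" for e using f that by auto
    have fB: "f \<in> B w" if "w \<in> I" for w using f that by auto
    have "f (x, z) \<le> f (x, y) + f (y, z) + d" if "x \<le> y" "y \<le> z" for x y z
    proof (rule field_le_epsilon)
      fix e :: real assume "e > 0"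
      then have "f \<in> A (min e 1)" using fA by simp
      then have "f (x, z) \<le> f (x, y) + f (y, z) + (d + min e 1)" using that unfolding A_def by blast
      then show "f (x, z) \<le> f (x, y) + f (y, z) + d + e" by linarith
    qed
    moreover have "f \<in> A 1" using fA by simp
    ultimately have "quasi_length \<Gamma> d (\<lambda>x y. f (x, y))"
      using fB unfolding quasi_length_def A_def B_def I_def by fastforce
    then show False using assms(2) unfolding has_quasi_length_def by blast
  qed
  then obtain \<F> where \<F>: "finite \<F>" "\<F> \<subseteq> A ` {0<..1} \<union> B ` I" "K \<inter> \<Inter>\<F> = {}"
    using compact_imp_fip[OF K cl, of "A ` {0<..1} \<union> B ` I"] by meson
  obtain E W where E: "finite E" "E \<subseteq> {0<..1}" and W: "finite W" "W \<subseteq> I" and "\<F> = A ` E \<union> B ` W"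
  proof -
    have "finite (\<F> \<inter> A ` {0<..1})" "finite (\<F> \<inter> B ` I)" using \<F>(1) by auto
    then obtain E W where EW: "finite E" "E \<subseteq> {0<..1}" "\<F> \<inter> A ` {0<..1} = A ` E"
      "finite W" "W \<subseteq> I" "\<F> \<inter> B ` I = B ` W"
      using finite_subset_image[of "\<F> \<inter> A ` {0<..1}" A "{0<..1}"]
        finite_subset_image[of "\<F> \<inter> B ` I" B I] by (metis inf_le2)
    have "\<F> = (\<F> \<inter> A ` {0<..1}) \<union> (\<F> \<inter> B ` I)" using \<F>(2) by blast
    then have "\<F> = A ` E \<union> B ` W" unfolding EW(3,6) .
    then show thesis by (rule that[OF EW(1,2,4,5)])
  qed
  define \<epsilon> where "\<epsilon> = Min (insert 1 E)"
  have \<epsilon>: "\<epsilon> > 0" "\<epsilon> \<le> 1" "\<And>e. e \<in> E \<Longrightarrow> \<epsilon> \<le> e" using E by (auto simp: \<epsilon>_def)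
  show ?thesis
  proof (intro exI[of _ W] exI[of _ \<epsilon>] conjI W(1) \<epsilon>(1) allI impI)
    show "F \<in> \<Gamma>" "F x < a" "a \<le> b" "b < F y" if "(F, x, a, b, y) \<in> W" for F x a b y
      using that W(2) by (auto simp: I_def)
    show "\<not> has_quasi_length \<Gamma>' d'"
      if d': "d' < d + \<epsilon>"
        and W': "\<forall>F x a b y. (F, x, a, b, y) \<in> W \<longrightarrow> (\<exists>F'\<in>\<Gamma>'. F' x < a \<and> b < F' y)" for \<Gamma>' d'
    proof
      assume "has_quasi_length \<Gamma>' d'"
      then obtain D where D: "quasi_length \<Gamma>' d' D" unfolding has_quasi_length_def by blast
      \<comment> \<open>At \<open>x > y\<close> the box \<open>K\<close> allows only the value
        0.\<close>
      define f where "f = (\<lambda>(x, y). if x \<le> y then D x y else 0)"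
      have "f (x, y) \<in> {0 .. real (nat \<lceil>y - x\<rceil>) * (2 + \<bar>d\<bar>)}" for x y
      proof (cases "x \<le> y")
        case True
        have "real (nat \<lceil>y - x\<rceil>) * (1 + d') \<le> real (nat \<lceil>y - x\<rceil>) * (2 + \<bar>d\<bar>)"
          using d' \<epsilon> by (intro mult_left_mono) auto
        then show ?thesis
          using quasi_length_bound[OF D True] quasi_lengthD(1)[OF D True] True by (simp add: f_def)
      qed (simp add: f_def)
      then have "f \<in> K" by (auto simp: K_def)
      moreover have "f \<in> A e" if "e \<in> E" for e
      proof -
        have "d' \<le> d + e" using \<epsilon>(3)[OF that] d' by linarith
        then have "D x z \<le> D x y + D y z + (d + e)" if "x \<le> y" "y \<le> z" for x y z
          using quasi_lengthD(3)[OF D that] by linarith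
        then show ?thesis unfolding A_def f_def using quasi_lengthD(1,2,4)[OF D] by auto
      qed
      moreover have "f \<in> B w" if wW: "w \<in> W" for w
      proof -
        obtain F x a b y where w: "w = (F, x, a, b, y)" by (cases w) auto
        obtain F' where F': "F' \<in> \<Gamma>'" "F' x < a" "b < F' y" using W' wW w by blast
        have I: "F \<in> \<Gamma>" "F x < a" "a \<le> b" "b < F y" using W(2) wW w by (auto simp: I_def)
        have ab: "D a b \<le> D x y" using quasi_lengthD(5)[OF D F'(1,2) I(3) F'(3)] .
        show ?thesis
        proof (cases "x \<le> y")
          case True
          then show ?thesis using ab I by (simp add: w B_def f_def)
        next
          case False
          then show ?thesis using I monoD[OF mono[OF I(1)], of y x] by linarith
        qed
      qed
      ultimately have "f \<in> K \<inter> \<Inter>\<F>" using \<open>\<F> = A ` E \<union> B ` W\<close> by auto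
      then show False using \<F>(3) by blast
    qed
  qed
qed


text \<open>The group is kept and only the defect varies: the margin \<epsilon> in the witness
  against defect 0 also excludes every defect below \<epsilon>.\<close>

lemma (in line_group) has_quasi_length_zero_of_small:
  assumes "\<And>N. N \<ge> 1 \<Longrightarrow> \<exists>n\<ge>N. has_quasi_length \<Gamma> (1 / real n)"
  shows "has_quasi_length \<Gamma> 0"
proof (rule ccontr)
  assume nq: "\<not> has_quasi_length \<Gamma> 0"
  obtain W \<epsilon> where W: "finite W" "\<epsilon> > 0"
    "\<And>F x a b y. (F, x, a, b, y) \<in> W \<Longrightarrow> F \<in> \<Gamma> \<and> F x < a \<and> a \<le> b \<and> b < F y"
    "\<And>\<Gamma>' d'. d' < 0 + \<epsilon> \<Longrightarrow>
       (\<And>F x a b y. (F, x, a, b, y) \<in> W \<Longrightarrow> \<exists>F'\<in>\<Gamma>'. F' x < a \<and> b < F' y) \<Longrightarrow>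
       \<not> has_quasi_length \<Gamma>' d'"
    using no_quasi_length_witness[OF strict_mono_mono[OF strict_mono] nq] by auto
  obtain N where N: "1 / real (Suc N) < \<epsilon>" using nat_approx_posE[OF W(2)] by blast
  obtain n where n: "n \<ge> Suc N" "has_quasi_length \<Gamma> (1 / real n)" using assms[of "Suc N"] by auto
  have "1 / real n \<le> 1 / real (Suc N)" using n(1) by (intro divide_left_mono) auto
  then have "1 / real n < 0 + \<epsilon>" using N by linarith
  then show False using W(3,4) n(2) by blast
qed

section \<open>Stability under perturbation of the homomorphism\<close>

lemma bdd_above_circle_dist: "bdd_above (range (\<lambda>x. dist (f x) (h x :: circle)))"
proof (rule bdd_aboveI[of _ 1])
  have "dist p q \<le> 1" for p q :: circle
  proof -
    obtain x y where xy: "p = circle_proj x" "q = circle_proj y" using circle_proj_surj by metis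
    have "infdist (x - y) \<int> \<le> dist (x - y) (of_int \<lfloor>x - y\<rfloor>)" by (intro infdist_le) simp
    also have "\<dots> \<le> 1" by (simp add: dist_real_def) linarith
    finally show ?thesis by (simp add: xy dist_circle.abs_eq)
  qed
  then show "\<And>t. t \<in> range (\<lambda>x. dist (f x) (h x)) \<Longrightarrow> t \<le> 1" by auto
qed

lemma dist_le_homeo_dist: "dist (f x) (h x) \<le> homeo_dist f h"
  unfolding homeo_dist_def by (rule cSUP_upper[OF UNIV_I bdd_above_circle_dist])

text \<open>At each point the two lifts agree up to an integer and an error below \<epsilon>. After
  the integer at 0 is removed, the absolute difference cannot equal \<open>1 / 2\<close>, which is
  too far from all integers, so by connectedness it stays below and the integer is 0
  everywhere.\<close>

lemma close_lift:
  assumes F: "lift_of F f" and f': "lift_of F0 f'" and "homeo_dist f' f < \<epsilon>" "\<epsilon> \<le> 1 / 2"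
  shows "\<exists>F'. lift_of F' f' \<and> (\<forall>x. \<bar>F' x - F x\<bar> < \<epsilon>)"
proof -
  have near: "\<exists>n::int. \<bar>F0 x - F x - of_int n\<bar> < \<epsilon>" for x
  proof -
    have "infdist (F0 x - F x) \<int> = dist (f' (circle_proj x)) (f (circle_proj x))"
      using lift_ofD(4)[OF F, of x] lift_ofD(4)[OF f', of x] by (metis dist_circle.abs_eq)
    also have "\<dots> < \<epsilon>" using dist_le_homeo_dist assms(3) le_less_trans by blast
    finally have "infdist (F0 x - F x) \<int> < \<epsilon>" .
    then obtain n where "n \<in> \<int>" "dist (F0 x - F x) n < \<epsilon>"
      using infdist_Ints_attained by metis
    then show ?thesis by (auto simp: dist_real_def elim!: Ints_cases)
  qed
  obtain n where n: "\<bar>F0 0 - F 0 - of_int n\<bar> < \<epsilon>" using near by blast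
  define F' where "F' x = F0 x + of_int (- n)" for x
  have L: "lift_of F' f'" using lift_of_add_int[OF f', of "- n"] by (simp add: F'_def[abs_def])
  define E where "E x = F' x - F x" for x
  have E: "continuous_on UNIV E"
    unfolding E_def using lift_ofD(1)[OF L] lift_ofD(1)[OF F] by (intro continuous_intros)
  have E0: "\<bar>E 0\<bar> < 1 / 2" using n assms(4) by (simp add: E_def F'_def algebra_simps)
  have nE: "\<exists>n::int. \<bar>E x - of_int n\<bar> < \<epsilon>" for x
  proof -
    obtain m where "\<bar>F0 x - F x - of_int m\<bar> < \<epsilon>" using near by blast
    then show ?thesis
      by (intro exI[of _ "m - n"]) (simp add: E_def F'_def algebra_simps)
  qed
  have avoid: "\<bar>E x\<bar> \<noteq> 1 / 2" for x
  proof
    assume h: "\<bar>E x\<bar> = 1 / 2"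
    obtain m where "\<bar>E x - of_int m\<bar> < 1 / 2"
      using nE[of x] assms(4) order_less_le_trans by blast
    then have "\<bar>of_int m :: real\<bar> < 1" "m \<noteq> 0" using h by (linarith, fastforce)
    then show False by linarith
  qed
  have "\<bar>E x\<bar> < 1 / 2" for x
  proof (rule ccontr)
    assume "\<not> \<bar>E x\<bar> < 1 / 2"
    moreover have "connected ((\<lambda>x. \<bar>E x\<bar>) ` UNIV)"
      using E by (intro connected_continuous_image continuous_intros) auto
    ultimately have "1 / 2 \<in> range (\<lambda>x. \<bar>E x\<bar>)"
      using E0 connectedD_interval[of "range (\<lambda>x. \<bar>E x\<bar>)" "\<bar>E 0\<bar>" "\<bar>E x\<bar>" "1 / 2"] by auto
    then show False using avoid by auto
  qed
  then have "\<bar>E x\<bar> < \<epsilon>" for x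
  proof -
    obtain m where m: "\<bar>E x - of_int m\<bar> < \<epsilon>" using nE[of x] by blast
    then have "\<bar>of_int m :: real\<bar> < 1" using \<open>\<bar>E x\<bar> < 1 / 2\<close> assms(4) by linarith
    then have "m = 0" by linarith
    then show ?thesis using m by simp
  qed
  then show ?thesis using L by (auto simp: E_def)
qed

text \<open>Each condition of the finite witness concerns one lift of one group element, so it holds
  on a subbasic set around \<phi>, and finitely many of these are intersected.\<close>

lemma openin_no_quasi_length:
  assumes G: "group G"
  shows "openin (reps_topology G) {\<phi> \<in> reps G. \<not> has_quasi_length (lifts G \<phi>) d}"
proof (subst openin_subopen, intro ballI)
  fix \<phi> assume "\<phi> \<in> {\<phi> \<in> reps G. \<not> has_quasi_length (lifts G \<phi>) d}"
  then have \<phi>: "\<phi> \<in> reps G" "\<not> has_quasi_length (lifts G \<phi>) d" by auto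
  interpret line_group "lifts G \<phi>" by (rule line_group_lifts[OF G \<phi>(1)])
  obtain W \<epsilon> where W: "finite W" "\<epsilon> > 0"
    "\<And>F x a b y. (F, x, a, b, y) \<in> W \<Longrightarrow> F \<in> lifts G \<phi> \<and> F x < a \<and> a \<le> b \<and> b < F y"
    "\<And>\<Gamma>' d'. d' < d + \<epsilon> \<Longrightarrow>
       (\<And>F x a b y. (F, x, a, b, y) \<in> W \<Longrightarrow> \<exists>F'\<in>\<Gamma>'. F' x < a \<and> b < F' y) \<Longrightarrow>
       \<not> has_quasi_length \<Gamma>' d'"
    using no_quasi_length_witness[OF strict_mono_mono[OF strict_mono] \<phi>(2)] by auto
  have "\<exists>U. openin (reps_topology G) U \<and> \<phi> \<in> U \<and> (\<forall>\<phi>'\<in>U. \<forall>F x a b y. w = (F, x, a, b, y) \<longrightarrow>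
      (\<exists>F'\<in>lifts G \<phi>'. F' x < a \<and> b < F' y))" if w: "w \<in> W" for w
  proof -
    obtain F x a b y where w': "w = (F, x, a, b, y)" by (cases w) auto
    have F: "F \<in> lifts G \<phi>" "F x < a" "b < F y" using W(3) w w' by blast+
    obtain g where g: "g \<in> carrier G" "lift_of F (\<phi> g)" using F(1) by (auto simp: lifts_def)
    \<comment> \<open>The bound \<open>1 / 2\<close> is the one under which nearby homeomorphisms
      have nearby lifts; the other two are the margins in the strict inequalities.\<close>
    define \<delta> where "\<delta> = min (1 / 2) (min (a - F x) (F y - b))"
    have \<delta>: "\<delta> > 0" "\<delta> \<le> 1 / 2" "\<delta> \<le> a - F x" "\<delta> \<le> F y - b" using F unfolding \<delta>_def by linarith+
    define U where "U = reps_subbasic G \<phi> g \<delta>"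
    have "openin (reps_topology G) U"
      unfolding reps_topology_def U_def
      by (rule topology_generated_by_Basis) (use \<phi>(1) g(1) \<delta>(1) in blast)
    moreover have "\<phi> \<in> U" using \<phi>(1) \<delta>(1) by (simp add: U_def reps_subbasic_def homeo_dist_def)
    moreover have "\<exists>F'\<in>lifts G \<phi>'. F' x < a \<and> b < F' y" if "\<phi>' \<in> U" for \<phi>'
    proof -
      have \<phi>': "\<phi>' \<in> reps G" "homeo_dist (\<phi>' g) (\<phi> g) < \<delta>"
        using that by (auto simp: U_def reps_subbasic_def)
      obtain F0 where "lift_of F0 (\<phi>' g)" using reps_lift[OF \<phi>'(1) g(1)] by blast
      then obtain F' where F': "lift_of F' (\<phi>' g)" "\<And>x. \<bar>F' x - F x\<bar> < \<delta>"
        using close_lift[OF g(2) _ \<phi>'(2) \<delta>(2)] by blast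
      have "F' \<in> lifts G \<phi>'" using F'(1) g(1) by (auto simp: lifts_def)
      moreover have "F' x < a" "b < F' y" using F'(2)[of x] F'(2)[of y] \<delta> by linarith+
      ultimately show ?thesis by blast
    qed
    ultimately show ?thesis using w' by blast
  qed
  then obtain U where U: "\<And>w. w \<in> W \<Longrightarrow> openin (reps_topology G) (U w)" "\<And>w. w \<in> W \<Longrightarrow> \<phi> \<in> U w"
    "\<And>w \<phi>' F x a b y. w \<in> W \<Longrightarrow> \<phi>' \<in> U w \<Longrightarrow> w = (F, x, a, b, y) \<Longrightarrow>
      \<exists>F'\<in>lifts G \<phi>'. F' x < a \<and> b < F' y"
    by metis
  \<comment> \<open>Intersecting with \<open>reps G\<close> also covers an empty \<open>W\<close>,
    for which the second factor is everything.\<close>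
  define V where "V = reps G \<inter> \<Inter>(U ` W)"
  have V: "openin (reps_topology G) V"
  proof -
    have "openin (reps_topology G) (topspace (reps_topology G) \<inter> \<Inter>(U ` W))"
      by (rule openin_Int_Inter) (use W(1) U(1) in auto)
    then show ?thesis by (simp add: V_def topspace_reps_topology[OF G])
  qed
  have "V \<subseteq> {\<phi> \<in> reps G. \<not> has_quasi_length (lifts G \<phi>) d}"
  proof
    fix \<phi>' assume "\<phi>' \<in> V"
    then have "\<phi>' \<in> reps G" "\<And>w. w \<in> W \<Longrightarrow> \<phi>' \<in> U w" by (auto simp: V_def)
    moreover have "\<not> has_quasi_length (lifts G \<phi>') d"
    proof (rule W(4))
      show "d < d + \<epsilon>" using W(2) by simp
      show "\<exists>F'\<in>lifts G \<phi>'. F' x < a \<and> b < F' y" if "(F, x, a, b, y) \<in> W" for F x a b y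
        using U(3)[OF that] \<open>\<And>w. w \<in> W \<Longrightarrow> \<phi>' \<in> U w\<close> that by blast
    qed
    ultimately show "\<phi>' \<in> {\<phi> \<in> reps G. \<not> has_quasi_length (lifts G \<phi>) d}" by simp
  qed
  moreover have "\<phi> \<in> V" using \<phi>(1) U(2) by (auto simp: V_def)
  ultimately show "\<exists>T. openin (reps_topology G) T \<and> \<phi> \<in> T \<and>
      T \<subseteq> {\<phi> \<in> reps G. \<not> has_quasi_length (lifts G \<phi>) d}"
    using V by blast
qed

section \<open>Invariant measures are exact lengths\<close>

text \<open>The quotient type gives an arbitrary representative; \<open>frac\<close> normalises it
  to the one in \<open>[0, 1)\<close>, for which measurability can be shown.\<close>

definition circle_frac :: "circle \<Rightarrow> real" where
  "circle_frac p = frac (rep_circle p)"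

lemma circle_proj_circle_frac [simp]: "circle_proj (circle_frac p) = p"
proof -
  have "circle_proj (rep_circle p) = p" using Quotient_abs_rep[OF Quotient_circle] .
  moreover have "frac (rep_circle p) - rep_circle p \<in> \<int>" by (simp add: frac_def)
  ultimately show ?thesis unfolding circle_frac_def by (metis circle_proj_eq_iff)
qed

lemma circle_frac_bounds: "0 \<le> circle_frac p" "circle_frac p < 1"
  unfolding circle_frac_def by (auto intro: frac_lt_1)

lemma circle_frac_proj: "\<exists>n::int. circle_frac (circle_proj t) = t + of_int n"
proof -
  have "circle_proj (circle_frac (circle_proj t)) = circle_proj t" by simp
  then obtain n where "circle_frac (circle_proj t) - t = of_int n"
    unfolding circle_proj_eq_iff by (auto elim: Ints_cases)
  then show ?thesis by (intro exI[of _ n]) linarith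
qed

text \<open>The section jumps at one point, but for \<open>0 \<le> a < 1\<close> its sublevel set is
  the compact image of \<open>{0..a}\<close>.\<close>

lemma circle_frac_measurable [measurable]: "circle_frac \<in> borel_measurable borel"
proof (rule borel_measurableI_le)
  fix a :: real
  have "closed {p. circle_frac p \<le> a}" if "0 \<le> a" "a < 1"
  proof -
    have "{p. circle_frac p \<le> a} = circle_proj ` {0..a}"
    proof (intro equalityI subsetI)
      fix p assume "p \<in> {p. circle_frac p \<le> a}"
      then have "circle_frac p \<in> {0..a}" using circle_frac_bounds by auto
      then show "p \<in> circle_proj ` {0..a}" by (metis circle_proj_circle_frac imageI)
    next
      fix p assume "p \<in> circle_proj ` {0..a}"
      then obtain t where t: "p = circle_proj t" "0 \<le> t" "t \<le> a" by auto
      obtain n where n: "circle_frac p = t + of_int n" using circle_frac_proj t(1) by metis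
      then have "\<bar>of_int n :: real\<bar> < 1" using circle_frac_bounds[of p] t that by linarith
      then have "n = 0" by linarith
      then show "p \<in> {p. circle_frac p \<le> a}" using n t by simp
    qed
    moreover have "compact (circle_proj ` {0..a})"
      by (rule compact_continuous_image[OF continuous_on_circle_proj compact_Icc])
    ultimately show ?thesis using compact_imp_closed by metis
  qed
  moreover have "{p. circle_frac p \<le> a} = {}" if "a < 0"
    using circle_frac_bounds(1) that by (auto simp: not_le intro: less_le_trans)
  moreover have "{p. circle_frac p \<le> a} = UNIV" if "a \<ge> 1"
    using circle_frac_bounds(2) that by (force intro: less_imp_le less_le_trans)
  ultimately show "{p \<in> space borel. circle_frac p \<le> a} \<in> sets borel"
    by (cases "a < 0"; cases "a \<ge> 1") auto
qed

text \<open>The number of lifts of \<open>p\<close> in the interval \<open>(x, y]\<close>.\<close>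

definition lift_count :: "real \<Rightarrow> real \<Rightarrow> circle \<Rightarrow> real" where
  "lift_count x y p = of_int (\<lfloor>y - circle_frac p\<rfloor> - \<lfloor>x - circle_frac p\<rfloor>)"

lemma lift_count_proj: "lift_count x y (circle_proj t) = of_int (\<lfloor>y - t\<rfloor> - \<lfloor>x - t\<rfloor>)"
proof -
  obtain n where n: "circle_frac (circle_proj t) = t + of_int n" using circle_frac_proj by blast
  have "\<lfloor>z - (t + of_int n)\<rfloor> = \<lfloor>z - t\<rfloor> - n" for z
    using floor_diff_of_int[of "z - t" n] by (simp add: algebra_simps)
  then show ?thesis by (simp add: lift_count_def n)
qed

lemma lift_count_measurable [measurable]: "lift_count x y \<in> borel_measurable borel"
  unfolding lift_count_def by measurable

lemma lift_count_bound: "\<bar>lift_count x y p\<bar> \<le> \<bar>y - x\<bar> + 1"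
  unfolding lift_count_def by linarith

text \<open>Since \<open>F (t + n) = F t + n\<close>, a lift carries the fibre over \<open>p\<close>
  to the fibre over \<open>f p\<close> index by index and in order.\<close>

lemma lift_count_lift:
  assumes F: "lift_of F f"
  shows "lift_count (F x) (F y) (f p) = lift_count x y p"
proof -
  obtain t where t: "p = circle_proj t" using circle_proj_surj by blast
  have "\<lfloor>F z - F t\<rfloor> = \<lfloor>z - t\<rfloor>" for z
  proof -
    have "n \<le> \<lfloor>F z - F t\<rfloor> \<longleftrightarrow> n \<le> \<lfloor>z - t\<rfloor>" for n
    proof -
      have "n \<le> \<lfloor>F z - F t\<rfloor> \<longleftrightarrow> F (t + of_int n) \<le> F z"
        using add_int_of_add_one[of F 1 t n] lift_ofD(3)[OF F]
        by (simp add: le_floor_iff algebra_simps)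
      also have "\<dots> \<longleftrightarrow> t + of_int n \<le> z"
        using lift_ofD(2)[OF F] strict_mono_less_eq by blast
      also have "\<dots> \<longleftrightarrow> n \<le> \<lfloor>z - t\<rfloor>" by (simp add: le_floor_iff algebra_simps)
      finally show ?thesis .
    qed
    then show ?thesis by (meson order_antisym order_refl)
  qed
  then show ?thesis
    using lift_count_proj[of "F x" "F y" "F t"] lift_count_proj[of x y t] lift_ofD(4)[OF F, of t] t
    by simp
qed

text \<open>Integrating \<open>lift_count\<close> gives the mass of \<open>(x, y]\<close> under the
  periodic measure on the line that covers \<open>M\<close>, without constructing that
  measure.\<close>

lemma has_quasi_length_zero_of_type_zero:
  assumes \<phi>: "\<phi> \<in> reps G" and "type_zero G \<phi>"
  shows "has_quasi_length (lifts G \<phi>) 0"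
proof -
  obtain M :: "circle measure" where M: "prob_space M" "sets M = sets borel"
    "\<And>g. g \<in> carrier G \<Longrightarrow> distr M borel (\<phi> g) = M"
    using assms(2) unfolding type_zero_def by blast
  interpret prob_space M by fact
  have meas: "f \<in> borel_measurable M" if "f \<in> borel_measurable borel" for f :: "circle \<Rightarrow> real"
    using that measurable_cong_sets[OF M(2) refl] by blast
  have int: "integrable M (lift_count x y)" for x y
    by (rule integrable_const_bound[where B = "\<bar>y - x\<bar> + 1"])
      (auto simp: lift_count_bound intro!: meas)
  define D where "D x y = (\<integral>p. lift_count x y p \<partial>M)" for x y
  have add: "D x z = D x y + D y z" for x y z
  proof -
    have "D x y + D y z = (\<integral>p. lift_count x y p + lift_count y z p \<partial>M)"
      unfolding D_def using int by (simp add: Bochner_Integration.integral_add)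
    also have "(\<lambda>p. lift_count x y p + lift_count y z p) = lift_count x z"
      by (auto simp: lift_count_def)
    finally show ?thesis by (simp add: D_def)
  qed
  have nonneg: "0 \<le> D x y" if "x \<le> y" for x y
    unfolding D_def
    by (rule Bochner_Integration.integral_nonneg) (simp add: lift_count_def floor_mono that)
  have one: "D x (x + 1) = 1" for x
  proof -
    have "\<lfloor>x + 1 - c\<rfloor> = \<lfloor>x - c\<rfloor> + 1" for c by linarith
    then have "lift_count x (x + 1) = (\<lambda>_. 1)" by (simp add: lift_count_def fun_eq_iff)
    then show ?thesis by (simp add: D_def prob_space)
  qed
  have inv: "D (F x) (F y) = D x y" if "F \<in> lifts G \<phi>" for F x y
  proof -
    obtain g where g: "g \<in> carrier G" "lift_of F (\<phi> g)" using \<open>F \<in> lifts G \<phi>\<close> by (auto simp: lifts_def)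
    have "continuous_on UNIV (\<phi> g)"
      using continuous_on_lifted[of F "\<phi> g"] lift_ofD[OF g(2)] by blast
    then have "\<phi> g \<in> borel_measurable borel" by (rule borel_measurable_continuous_onI)
    then have m: "\<phi> g \<in> measurable M borel" using measurable_cong_sets[OF M(2) refl] by blast
    have "D (F x) (F y) = (\<integral>p. lift_count (F x) (F y) p \<partial>distr M borel (\<phi> g))"
      unfolding D_def by (simp add: M(3)[OF g(1)])
    also have "\<dots> = (\<integral>p. lift_count (F x) (F y) (\<phi> g p) \<partial>M)"
      by (rule integral_distr[OF m]) simp
    also have "\<dots> = D x y" by (simp add: D_def lift_count_lift[OF g(2)])
    finally show ?thesis .
  qed
  have mono: "D a b \<le> D x y" if "x \<le> a" "a \<le> b" "b \<le> y" for x a b y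
    using add[of x y a] add[of a y b] nonneg[of x a] nonneg[of b y] that by linarith
  have "quasi_length (lifts G \<phi>) 0 D"
  proof (rule quasi_lengthI)
    show "D a b \<le> D x y" if "F \<in> lifts G \<phi>" "F x < a" "a \<le> b" "b < F y" for F x a b y
      using mono[of "F x" a b "F y"] inv[OF that(1)] that by simp
  qed (use add nonneg one in \<open>simp_all add: add[symmetric]\<close>)
  then show ?thesis unfolding has_quasi_length_def by blast
qed

section \<open>From an exact length to an invariant measure\<close>

lemma emeasure_lborel_translate:
  fixes A :: "real set"
  assumes "A \<in> sets borel"
  shows "emeasure lborel {u. u + c \<in> A} = emeasure lborel A"
proof -
  have "emeasure lborel A = emeasure (distr lborel borel ((+) c)) A"
    by (simp add: lborel_distr_plus)
  also have "\<dots> = emeasure lborel ((+) c -` A \<inter> space lborel)"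
    using assms by (intro emeasure_distr) auto
  also have "(+) c -` A \<inter> space lborel = {u. u + c \<in> A}" by (auto simp: add.commute)
  finally show ?thesis by simp
qed

text \<open>Rotation invariance of Lebesgue measure on the circle. The shifted window
  \<open>[b, b + 1)\<close> is cut at 1 and its right part is moved back by 1.\<close>

lemma emeasure_periodic_translate:
  fixes S :: "real set"
  assumes S: "S \<in> sets borel" and per: "\<And>u. u + 1 \<in> S \<longleftrightarrow> u \<in> S"
  shows "emeasure lborel ({0..<1} \<inter> {u. u + c \<in> S}) = emeasure lborel ({0..<1} \<inter> S)"
proof -
  have perz: "u + of_int n \<in> S \<longleftrightarrow> u \<in> S" for u and n :: int
  proof (induction n rule: int_induct[where k = 0])
    case (step1 i)
    then show ?case using per[of "u + of_int i"] by (simp add: algebra_simps)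
  next
    case (step2 i)
    then show ?case using per[of "u + of_int (i - 1)"] by (simp add: algebra_simps)
  qed simp
  define b where "b = frac c"
  have b: "0 \<le> b" "b < 1" by (auto simp: b_def frac_lt_1)
  have "u + c \<in> S \<longleftrightarrow> u + b \<in> S" for u
    using perz[of "u + b" "\<lfloor>c\<rfloor>"] by (simp add: b_def frac_def)
  then have "emeasure lborel ({0..<1} \<inter> {u. u + c \<in> S}) = emeasure lborel {u. u + b \<in> {b..<b + 1} \<inter> S}"
    by (intro arg_cong2[where f = emeasure]) auto
  also have "\<dots> = emeasure lborel ({b..<b + 1} \<inter> S)"
    using S by (intro emeasure_lborel_translate) auto
  also have "{b..<b + 1} \<inter> S = ({b..<1} \<inter> S) \<union> ({1..<b + 1} \<inter> S)" using b by auto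
  also have "emeasure lborel \<dots> = emeasure lborel ({b..<1} \<inter> S) + emeasure lborel ({1..<b + 1} \<inter> S)"
    using S by (subst plus_emeasure) auto
  also have "emeasure lborel ({1..<b + 1} \<inter> S) = emeasure lborel {u. u + 1 \<in> {1..<b + 1} \<inter> S}"
    using S by (intro emeasure_lborel_translate[symmetric]) auto
  also have "{u. u + 1 \<in> {1..<b + 1} \<inter> S} = {0..<b} \<inter> S" using per by auto
  also have "emeasure lborel ({b..<1} \<inter> S) + emeasure lborel ({0..<b} \<inter> S) =
      emeasure lborel (({b..<1} \<inter> S) \<union> ({0..<b} \<inter> S))"
    using S by (subst plus_emeasure) auto
  also have "({b..<1} \<inter> S) \<union> ({0..<b} \<inter> S) = {0..<1} \<inter> S" using b by auto
  finally show ?thesis .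
qed

text \<open>A quasi-length of defect zero is the length with respect to a monotone function \<open>R\<close>, which
  after normalisation to be right continuous satisfies \<open>R \<circ> F = R + const\<close>.\<close>

lemma (in line_group) exact_length_cocycle:
  assumes D: "quasi_length \<Gamma> 0 D"
  shows "\<exists>R :: real \<Rightarrow> real. mono R \<and> (\<forall>x. R (x + 1) = R x + 1) \<and>
    (\<forall>F\<in>\<Gamma>. \<exists>c. \<forall>x. R (F x) = R x + c)"
proof -
  note D1 = quasi_lengthD[OF D]
  have add: "D x z = D x y + D y z" if "x \<le> y" "y \<le> z" for x y z
    using D1(2,3)[OF that] by linarith
  define H where "H x = (if x \<ge> 0 then D 0 x else - D x 0)" for x
  have HD: "H y - H x = D x y" if "x \<le> y" for x y
    using that add[of 0 x y] add[of x 0 y] add[of x y 0] quasi_length_refl[OF D, of 0]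
    by (auto simp: H_def)
  have H1: "H (x + 1) = H x + 1" for x using HD[of x "x + 1"] D1(4)[of x] by linarith
  have Hmono: "H x \<le> H y" if "x \<le> y" for x y using HD[OF that] D1(1)[OF that] by linarith
  define R where "R x = Inf (H ` {x<..})" for x
  have bdd: "bdd_below (H ` {x<..})" for x
    by (rule bdd_belowI[of _ "H x"]) (auto intro: Hmono)
  have R_le: "R x \<le> H y" if "x < y" for x y
    unfolding R_def by (rule cInf_lower) (use that bdd in auto)
  have R_approx: "\<exists>y>x. H y < R x + e" if "e > 0" for x e
    using cInf_lessD[of "H ` {x<..}" "R x + e"] that by (auto simp: R_def)
  have Rmono: "R x \<le> R y" if "x \<le> y" for x y
    unfolding R_def by (rule cInf_superset_mono) (use that bdd in auto)
  have R1: "R (x + 1) = R x + 1" for x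
  proof (rule antisym; rule field_le_epsilon)
    fix e :: real assume e: "e > 0"
    obtain y where "y > x" "H y < R x + e" using R_approx[OF e] by blast
    then show "R (x + 1) \<le> R x + 1 + e" using R_le[of "x + 1" "y + 1"] H1[of y] by linarith
    obtain z where "z > x + 1" "H z < R (x + 1) + e" using R_approx[OF e] by blast
    then show "R x + 1 \<le> R (x + 1) + e" using R_le[of x "z - 1"] H1[of "z - 1"] by simp
  qed
  \<comment> \<open>\<open>b\<close> lies right of \<open>F y\<close>, and \<open>a\<close> just
    right of \<open>F x\<close>; the interval from \<open>x'\<close>, just right of
    \<open>x\<close>, to \<open>y'\<close> is pushed over \<open>[a, b]\<close>. Replacing
    \<open>H\<close> by \<open>R\<close> at \<open>a\<close> and at \<open>y'\<close> costs
    \<open>e / 2\<close> each; at \<open>b\<close> and \<open>x'\<close> the inequality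
    \<open>R_le\<close> goes the right way.\<close>
  have le: "R (F y) - R (F x) \<le> R y - R x" if F: "F \<in> \<Gamma>" and xy: "x < y" for F x y
  proof (rule field_le_epsilon)
    fix e :: real assume e: "e > 0"
    obtain y' where y': "y' > y" "H y' < R y + e / 2" using R_approx[of "e / 2"] e by auto
    define b where "b = F ((y + y') / 2)"
    have b: "F y < b" "b < F y'" unfolding b_def using less_iff[OF F] y'(1) by auto
    obtain a0 where a0: "a0 > F x" "H a0 < R (F x) + e / 2" using R_approx[of "e / 2"] e by auto
    define a where "a = min a0 (F y)"
    have a: "F x < a" "H a < R (F x) + e / 2" "a \<le> b"
      using a0 less_iff[OF F] xy Hmono[of a a0] b(1) by (auto simp: a_def)
    obtain F' where F': "F' \<in> \<Gamma>" "\<And>x. F (F' x) = x" using inverse[OF F] by blast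
    define x' where "x' = F' ((F x + a) / 2)"
    have x': "F x < F x'" "F x' < a" using a(1) by (auto simp: x'_def F'(2))
    then have "x < x'" "x' \<le> y'"
      using less_iff[OF F, of x x'] less_iff[OF F, of x' y'] a(3) b(2) by auto
    have "D a b \<le> D x' y'" using D1(5)[OF F x'(2) a(3) b(2)] .
    then have "H b - H a \<le> H y' - H x'" using HD[OF a(3)] HD[OF \<open>x' \<le> y'\<close>] by simp
    then show "R (F y) - R (F x) \<le> R y - R x + e"
      using R_le[OF \<open>x < x'\<close>] R_le[OF b(1)] a(2) y'(2) by linarith
  qed
  have eq: "R (F y) - R (F x) = R y - R x" if F: "F \<in> \<Gamma>" and xy: "x < y" for F x y
  proof -
    obtain F' where F': "F' \<in> \<Gamma>" "\<And>x. F' (F x) = x" using inverse[OF F] by blast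
    show ?thesis using le[OF F xy] le[OF F'(1), of "F x" "F y"] less_iff[OF F] xy F'(2) by force
  qed
  have "\<exists>c. \<forall>x. R (F x) = R x + c" if F: "F \<in> \<Gamma>" for F
  proof (intro exI allI)
    fix x
    show "R (F x) = R x + (R (F 0) - R 0)"
      using eq[OF F, of x 0] eq[OF F, of 0 x] by (cases x "0 :: real" rule: linorder_cases) auto
  qed
  then show ?thesis using Rmono R1 by (intro exI[of _ R]) (auto simp: mono_def)
qed

text \<open>\<open>Q\<close> is the generalised inverse of \<open>R\<close>. It turns each lift into
  a translation of the parameter, \<open>F (Q u) = Q (u + c)\<close>, so Lebesgue measure on
  \<open>[0, 1)\<close>, carried to the circle by \<open>Q\<close>, is invariant.\<close>

lemma type_zero_of_has_quasi_length_zero: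
  assumes G: "group G" and \<phi>: "\<phi> \<in> reps G" and "has_quasi_length (lifts G \<phi>) 0"
  shows "type_zero G \<phi>"
proof -
  interpret line_group "lifts G \<phi>" by (rule line_group_lifts[OF G \<phi>])
  obtain D where D: "quasi_length (lifts G \<phi>) 0 D" using assms(3) unfolding has_quasi_length_def by blast
  obtain R :: "real \<Rightarrow> real" where R: "mono R" "\<And>x. R (x + 1) = R x + 1"
    "\<And>F. F \<in> lifts G \<phi> \<Longrightarrow> \<exists>c. \<forall>x. R (F x) = R x + c"
    using exact_length_cocycle[OF D] by blast
  have Rn: "R (x + of_int n) = R x + of_int n" for x n using add_int_of_add_one[of R 1] R(2) by simp
  define Q where "Q u = Inf {x. R x \<ge> u}" for u
  have ne: "\<exists>x. R x \<ge> u" for u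
  proof -
    have "u \<le> R (0 + of_int \<lceil>u - R 0\<rceil>)" unfolding Rn by linarith
    then show ?thesis by blast
  qed
  have bdd: "bdd_below {x. R x \<ge> u}" for u
  proof (rule bdd_belowI)
    fix x assume "x \<in> {x. R x \<ge> u}"
    moreover have "R (0 + of_int (\<lfloor>u - R 0\<rfloor> - 1)) < u" unfolding Rn by linarith
    ultimately show "0 + of_int (\<lfloor>u - R 0\<rfloor> - 1) \<le> x"
      using monoD[OF R(1), of x "0 + of_int (\<lfloor>u - R 0\<rfloor> - 1)"] by (smt (verit) mem_Collect_eq)
  qed
  have Q_le: "Q u \<le> x" if "R x \<ge> u" for u x
    unfolding Q_def by (rule cInf_lower) (use that bdd in auto)
  have Q_ge: "z \<le> Q u" if "\<And>x. R x \<ge> u \<Longrightarrow> z \<le> x" for u z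
    unfolding Q_def by (rule cInf_greatest) (use that ne in auto)
  have Q_mono: "mono Q" by (rule monoI, rule Q_ge, rule Q_le) simp
  have QF_le: "F (Q u) \<le> Q (u + c)" if F: "F \<in> lifts G \<phi>" and c: "\<And>x. R (F x) = R x + c" for F c u
  proof (rule Q_ge)
    fix z assume z: "u + c \<le> R z"
    obtain F' where F': "F' \<in> lifts G \<phi>" "\<And>x. F (F' x) = x" using inverse[OF F] by blast
    have "u \<le> R (F' z)" using c[of "F' z"] z F'(2) by simp
    then have "F (Q u) \<le> F (F' z)" using le_iff[OF F] Q_le by blast
    then show "F (Q u) \<le> z" by (simp add: F'(2))
  qed
  \<comment> \<open>The reverse inequality is the one already shown, applied to the inverse lift
    with constant \<open>- c\<close>.\<close>
  have QF: "F (Q u) = Q (u + c)" if F: "F \<in> lifts G \<phi>" and c: "\<And>x. R (F x) = R x + c" for F c u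
  proof (rule antisym[OF QF_le[OF F c]])
    obtain F' where F': "F' \<in> lifts G \<phi>" "\<And>x. F (F' x) = x" using inverse[OF F] by blast
    have "R (F' x) = R x + (- c)" for x using c[of "F' x"] F'(2) by simp
    then have "F' (Q (u + c)) \<le> Q (u + c + (- c))" by (rule QF_le[OF F'(1)])
    then have "F (F' (Q (u + c))) \<le> F (Q u)" using le_iff[OF F] by simp
    then show "Q (u + c) \<le> F (Q u)" by (simp add: F'(2))
  qed
  have Q1: "Q (u + 1) = Q u + 1" for u using QF[OF translation, of 1 u] R(2) by simp
  define U :: "real measure" where "U = uniform_measure lborel {0..<1}"
  have setsU: "sets U = sets borel" by (simp add: U_def)
  have U: "emeasure U A = emeasure lborel ({0..<1} \<inter> A)" if "A \<in> sets borel" for A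
    using that by (simp add: U_def divide_ennreal_def)
  have "prob_space U" unfolding U_def by (rule prob_space_uniform_measure) auto
  then interpret U: prob_space U .
  define P where "P u = circle_proj (Q u)" for u
  have "Q \<in> borel_measurable borel" using Q_mono by (rule borel_measurable_mono)
  moreover have "circle_proj \<in> borel_measurable borel"
    by (rule borel_measurable_continuous_onI[OF continuous_on_circle_proj])
  ultimately have Pm: "P \<in> borel_measurable borel" unfolding P_def by measurable
  then have PU: "P \<in> measurable U borel" using measurable_cong_sets[OF setsU refl] by blast
  define M where "M = distr U borel P"
  have "prob_space M" unfolding M_def by (rule U.prob_space_distr[OF PU])
  moreover have "sets M = sets borel" by (simp add: M_def)
  moreover have "distr M borel (\<phi> g) = M" if g: "g \<in> carrier G" for g
  proof -
    obtain F where F: "lift_of F (\<phi> g)" using reps_lift[OF \<phi> g] by blast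
    then have FL: "F \<in> lifts G \<phi>" using g by (auto simp: lifts_def)
    obtain c where c: "\<And>x. R (F x) = R x + c" using R(3)[OF FL] by blast
    have "continuous_on UNIV (\<phi> g)"
      using continuous_on_lifted[of F "\<phi> g"] lift_ofD[OF F] by blast
    then have m: "\<phi> g \<in> borel_measurable borel" by (rule borel_measurable_continuous_onI)
    have comp: "\<phi> g (P u) = P (u + c)" for u
      using lift_ofD(4)[OF F, of "Q u"] QF[OF FL c, of u] by (simp add: P_def)
    have P1: "P (u + 1) = P u" for u
      using circle_proj_add_int[of "Q u" 1] by (simp add: P_def Q1)
    have "distr M borel (\<phi> g) = distr U borel (\<phi> g \<circ> P)"
      unfolding M_def by (rule distr_distr) (use m PU in auto)
    also have "\<phi> g \<circ> P = (\<lambda>u. P (u + c))" using comp by auto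
    also have "distr U borel (\<lambda>u. P (u + c)) = distr U borel P"
    proof (rule measure_eqI)
      fix A assume "A \<in> sets (distr U borel (\<lambda>u. P (u + c)))"
      then have A: "A \<in> sets borel" by simp
      define S where "S = P -` A"
      have S: "S \<in> sets borel" unfolding S_def using Pm A by (metis inf_top_right measurable_sets space_borel)
      have Pc: "(\<lambda>u. P (u + c)) \<in> borel_measurable borel" using Pm by measurable
      then have S': "{u. u + c \<in> S} \<in> sets borel"
        using measurable_sets[OF Pc A] by (simp add: S_def vimage_def)
      have "emeasure (distr U borel (\<lambda>u. P (u + c))) A = emeasure U {u. u + c \<in> S}"
        using A Pc measurable_cong_sets[OF setsU refl]
        by (subst emeasure_distr) (auto simp: S_def vimage_def U_def)
      also have "\<dots> = emeasure lborel ({0..<1} \<inter> {u. u + c \<in> S})" by (rule U[OF S'])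
      also have "\<dots> = emeasure lborel ({0..<1} \<inter> S)"
        by (rule emeasure_periodic_translate[OF S]) (simp add: S_def P1)
      also have "\<dots> = emeasure U S" by (rule U[OF S, symmetric])
      also have "\<dots> = emeasure (distr U borel P) A"
        using A PU by (subst emeasure_distr) (auto simp: S_def U_def)
      finally show "emeasure (distr U borel (\<lambda>u. P (u + c))) A = emeasure (distr U borel P) A" .
    qed simp
    finally show ?thesis by (simp add: M_def)
  qed
  ultimately show ?thesis unfolding type_zero_def by blast
qed

section \<open>The centraliser of a minimal action\<close>

text \<open>A jump of a monotone function would leave an open interval without values.\<close>

lemma continuous_of_mono_dense:
  fixes H :: "real \<Rightarrow> real"
  assumes mono: "mono H" and dense: "\<And>u v. u < v \<Longrightarrow> \<exists>x. u < H x \<and> H x < v"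
  shows "continuous_on UNIV H"
  unfolding continuous_on_iff
proof (intro ballI allI impI)
  fix x e :: real assume "e > 0"
  obtain a where a: "H x - e < H a" "H a < H x" using dense[of "H x - e" "H x"] \<open>e > 0\<close> by auto
  obtain b where b: "H x < H b" "H b < H x + e" using dense[of "H x" "H x + e"] \<open>e > 0\<close> by auto
  have ab: "a < x" "x < b" using a b monoD[OF mono] by (meson not_le)+
  show "\<exists>d>0. \<forall>x'\<in>UNIV. dist x' x < d \<longrightarrow> dist (H x') (H x) < e"
  proof (intro exI[of _ "min (x - a) (b - x)"] conjI ballI impI)
    fix y assume "dist y x < min (x - a) (b - x)"
    then have "a \<le> y" "y \<le> b" by (auto simp: dist_real_def)
    then have "H a \<le> H y" "H y \<le> H b" using monoD[OF mono] by blast+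
    then show "dist (H y) (H x) < e" using a b by (simp add: dist_real_def)
  qed (use ab in auto)
qed

lemma funpow_le_funpow:
  fixes f g :: "real \<Rightarrow> real"
  assumes "mono f" "\<And>x. f x \<le> g x"
  shows "(f ^^ n) x \<le> (g ^^ n) x"
proof (induction n)
  case (Suc n)
  have "f ((f ^^ n) x) \<le> f ((g ^^ n) x)" using Suc assms(1) by (simp add: monoD)
  also have "\<dots> \<le> g ((g ^^ n) x)" by (rule assms(2))
  finally show ?case by simp
qed simp

locale minimal_line_group = line_group +
  assumes dense_orbit: "u < v \<Longrightarrow> \<exists>F\<in>\<Gamma>. u < F x \<and> F x < v"
begin

text \<open>Neither continuity nor injectivity is asked for, because a map obtained from infima is
  at first only seen to be monotone; density of the orbits supplies both afterwards.\<close>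

definition central :: "(real \<Rightarrow> real) \<Rightarrow> bool" where
  "central s \<longleftrightarrow> mono s \<and> (\<forall>F\<in>\<Gamma>. \<forall>x. s (F x) = F (s x))"

lemma centralD:
  assumes "central s"
  shows "x \<le> y \<Longrightarrow> s x \<le> s y" "F \<in> \<Gamma> \<Longrightarrow> s (F x) = F (s x)" "s (x + 1) = s x + 1"
  using assms translation unfolding central_def by (auto dest: monoD)

lemma central_id: "central (\<lambda>x. x)"
  unfolding central_def by (simp add: mono_def)

lemma central_translation: "central (\<lambda>x. x + 1)"
  unfolding central_def using add_one by (simp add: mono_def)

lemma central_comp: "central s \<Longrightarrow> central t \<Longrightarrow> central (\<lambda>x. s (t x))"
  unfolding central_def mono_def by simp

lemma central_funpow: "central s \<Longrightarrow> central (s ^^ n)"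
proof (induction n)
  case 0
  then show ?case using central_id by (simp add: id_def)
next
  case (Suc n)
  then show ?case using central_comp[of s "s ^^ n"] by (simp add: o_def)
qed

text \<open>Elements of \<Gamma> preserve order, so they commute with minima. This is what later
  makes the centraliser totally ordered.\<close>

lemma central_min: "central s \<Longrightarrow> central t \<Longrightarrow> central (\<lambda>x. min (s x) (t x))"
  unfolding central_def mono_def
  by (auto simp: min_def le_iff) (metis linear order_trans)+

text \<open>The range of \<open>s\<close> contains the orbit of \<open>s 0\<close>, which is
  dense.\<close>

lemma central_continuous:
  assumes "central s"
  shows "continuous_on UNIV s"
proof (rule continuous_of_mono_dense)
  show "mono s" using assms unfolding central_def by blast
  fix u v :: real assume "u < v"
  then obtain F where "F \<in> \<Gamma>" "u < F (s 0)" "F (s 0) < v" using dense_orbit by blast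
  then show "\<exists>x. u < s x \<and> s x < v" using centralD(2)[OF assms] by metis
qed

text \<open>If \<open>s\<close> were constant on one interval, transport by \<Gamma> would make it
  locally constant near every point. The level set of \<open>s 0\<close> is bounded because
  \<open>s\<close> commutes with the unit translation, and local constancy would extend it beyond
  its supremum.\<close>

lemma central_strict_mono:
  assumes s: "central s" and "x < y"
  shows "s x < s y"
proof (rule ccontr)
  assume "\<not> s x < s y"
  then have eq: "s x = s y" using centralD(1)[OF s, of x y] \<open>x < y\<close> by linarith
  have loc: "\<exists>a b. a < z \<and> z < b \<and> s a = s b" for z
  proof -
    obtain F where F: "F \<in> \<Gamma>" "x < F z" "F z < y" using dense_orbit[OF \<open>x < y\<close>] by blast
    obtain F' where F': "F' \<in> \<Gamma>" "\<And>x. F' (F x) = x" using inverse[OF F(1)] by blast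
    have "F' x < z" "z < F' y" using F F' less_iff[OF F'(1)] by metis+
    moreover have "s (F' x) = s (F' y)" using centralD(2)[OF s F'(1)] eq by simp
    ultimately show ?thesis by blast
  qed
  define A where "A = {z. s z = s 0}"
  have bdd: "bdd_above A"
  proof (rule bdd_aboveI)
    fix z assume "z \<in> A"
    then show "z \<le> 1"
      using centralD(1)[OF s, of 1 z] centralD(3)[OF s, of 0] by (cases "z \<le> 1") (auto simp: A_def)
  qed
  have "0 \<in> A" by (simp add: A_def)
  obtain a b where ab: "a < Sup A" "Sup A < b" "s a = s b" using loc by blast
  obtain z where z: "z \<in> A" "a < z" using less_cSupD[of A a] ab(1) \<open>0 \<in> A\<close> by blast
  have "z \<le> Sup A" using cSup_upper[OF z(1) bdd] .
  then have "s b = s z"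
    using centralD(1)[OF s, of a z] centralD(1)[OF s, of z b] ab z(2) by simp
  then have "b \<in> A" using z(1) by (simp add: A_def)
  then show False using cSup_upper[OF _ bdd, of b] ab(2) by simp
qed

text \<open>The set where the two maps agree is closed and invariant under \<Gamma>, so with one
  point it contains the closure of a dense orbit.\<close>

lemma central_eq:
  assumes s: "central s" and t: "central t" and eq: "s x = t x"
  shows "s y = t y"
proof (rule ccontr)
  assume "s y \<noteq> t y"
  have "open {y. s y \<noteq> t y}"
    by (rule open_Collect_neq) (use s t central_continuous in auto)
  then obtain e where e: "e > 0" "\<And>z. dist z y < e \<Longrightarrow> s z \<noteq> t z"
    using \<open>s y \<noteq> t y\<close> unfolding open_dist by blast
  obtain F where F: "F \<in> \<Gamma>" "y - e < F x" "F x < y + e" using dense_orbit[of "y - e" "y + e"] e(1) by auto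
  then have "s (F x) \<noteq> t (F x)" by (intro e(2)) (auto simp: dist_real_def)
  then show False using centralD(2)[OF s F(1)] centralD(2)[OF t F(1)] eq by simp
qed

text \<open>The minimum of the two is central; agreeing with \<open>s\<close> at one point, it
  agrees with \<open>s\<close> everywhere.\<close>

lemma central_le:
  assumes s: "central s" and t: "central t" and le: "s x \<le> t x"
  shows "s y \<le> t y"
proof -
  have "min (s x) (t x) = s x" using le by simp
  then have "min (s y) (t y) = s y" using central_eq[OF central_min[OF s t] s] by blast
  then show ?thesis by linarith
qed

lemma central_less:
  assumes s: "central s" and t: "central t" and "s x < t x"
  shows "s y < t y"
  using central_le[OF t s, of y x] assms(3) by linarith

lemma central_inverse:
  assumes s: "central s"
  shows "\<exists>s'. central s' \<and> (\<forall>x. s (s' x) = x) \<and> (\<forall>x. s' (s x) = x)"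
proof -
  have surj: "\<exists>x. s x = u" for u
    using surj_of_add_one[of s 1 u] centralD(3)[OF s] central_continuous[OF s] by simp
  define s' where "s' u = (SOME x. s x = u)" for u
  have 1: "s (s' u) = u" for u unfolding s'_def by (rule someI_ex[OF surj])
  have inj: "x = y" if "s x = s y" for x y
    using central_strict_mono[OF s, of x y] central_strict_mono[OF s, of y x] that
    by (cases x y rule: linorder_cases) auto
  have 2: "s' (s x) = x" for x by (rule inj) (rule 1)
  have "s' x \<le> s' y" if "x \<le> y" for x y
    using central_strict_mono[OF s, of "s' y" "s' x"] 1 that by force
  moreover have "s' (F x) = F (s' x)" if "F \<in> \<Gamma>" for F x
    by (rule inj) (simp add: 1 centralD(2)[OF s that])
  ultimately have "central s'" by (auto simp: central_def mono_def)
  then show ?thesis using 1 2 by blast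
qed

section \<open>Positive central maps and the root of the unit translation\<close>

definition positive :: "(real \<Rightarrow> real) \<Rightarrow> bool" where
  "positive s \<longleftrightarrow> central s \<and> (\<forall>x. x < s x)"

lemma positiveD: "positive s \<Longrightarrow> central s" "positive s \<Longrightarrow> x < s x"
  by (auto simp: positive_def)

lemma positiveI: "central s \<Longrightarrow> x < s x \<Longrightarrow> positive s"
  using central_less[OF central_id] unfolding positive_def by blast

lemma positive_funpow_mono:
  assumes "positive s" "m \<le> n"
  shows "(s ^^ m) x \<le> (s ^^ n) x"
proof -
  have "(s ^^ m) x \<le> (s ^^ (m + k)) x" for k
  proof (induction k)
    case (Suc k)
    then show ?case using positiveD(2)[OF assms(1), of "(s ^^ (m + k)) x"] by simp
  qed simp
  from this[of "n - m"] show ?thesis using assms(2) by simp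
qed

text \<open>The supremum of a bounded orbit would have to be a fixed point of
  \<open>s\<close>.\<close>

lemma positive_funpow_unbounded:
  assumes s: "positive s"
  shows "\<exists>k. (s ^^ k) x > y"
proof (rule ccontr)
  assume "\<not> ?thesis"
  then have le: "(s ^^ k) x \<le> y" for k by (simp add: not_less)
  define A where "A = range (\<lambda>k. (s ^^ k) x)"
  have bdd: "bdd_above A" using le by (auto simp: A_def intro!: bdd_aboveI)
  obtain s' where s': "central s'" "\<And>x. s (s' x) = x" "\<And>x. s' (s x) = x"
    using central_inverse[OF positiveD(1)[OF s]] by blast
  have "s' (Sup A) < Sup A" using positiveD(2)[OF s, of "s' (Sup A)"] s'(2) by simp
  then obtain k where "s' (Sup A) < (s ^^ k) x" using less_cSupD[of A "s' (Sup A)"] by (auto simp: A_def)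
  then have "s (s' (Sup A)) < s ((s ^^ k) x)" using central_strict_mono[OF positiveD(1)[OF s]] by blast
  moreover have "(s ^^ Suc k) x \<le> Sup A" by (rule cSup_upper[OF _ bdd]) (auto simp: A_def simp del: funpow.simps)
  ultimately show False using s'(2) by simp
qed

text \<open>The witness counts how many times \<open>s\<close> fits into an interval.\<close>

lemma has_quasi_length_of_positive:
  assumes s: "positive s" and N: "N \<ge> 1" "(s ^^ N) 0 \<le> 1" "(s ^^ Suc N) 0 > 1"
  shows "has_quasi_length \<Gamma> (1 / real N)"
proof -
  note c = positiveD(1)[OF s]
  define n where "n x y = (GREATEST k. (s ^^ k) x \<le> y)" for x y
  have n_iff: "(s ^^ k) x \<le> y \<longleftrightarrow> k \<le> n x y" if xy: "x \<le> y" for x y k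
  proof -
    obtain b where b: "(s ^^ b) x > y" using positive_funpow_unbounded[OF s] by blast
    have bound: "k \<le> b" if "(s ^^ k) x \<le> y" for k
      using positive_funpow_mono[OF s, of b k x] that b by (cases "k \<le> b") auto
    have "(s ^^ 0) x \<le> y" using xy by simp
    then have "(s ^^ n x y) x \<le> y"
      unfolding n_def by (rule GreatestI_nat[where b = b]) (use bound in blast)
    moreover have "k \<le> n x y" if "(s ^^ k) x \<le> y"
      unfolding n_def by (rule Greatest_le_nat[where b = b]) (use bound that in blast)+
    ultimately show ?thesis using positive_funpow_mono[OF s, of k "n x y" x] by (meson order_trans)
  qed
  have n_N: "n x (x + 1) = N" for x
  proof -
    have "(s ^^ N) x \<le> x + 1"
      by (rule central_le[OF central_funpow[OF c] central_translation, of _ 0]) (use N in simp)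
    moreover have "x + 1 < (s ^^ Suc N) x"
      by (rule central_less[OF central_translation central_funpow[OF c], of 0]) (use N in simp)
    ultimately have "N \<le> n x (x + 1)" "\<not> Suc N \<le> n x (x + 1)"
      using n_iff[of x "x + 1" N] n_iff[of x "x + 1" "Suc N"] by auto
    then show ?thesis by simp
  qed
  have mono: "(s ^^ k) x \<le> (s ^^ k) y" if "x \<le> y" for k x y
    using centralD(1)[OF central_funpow[OF c] that] .
  have super: "n x y + n y z \<le> n x z" if "x \<le> y" "y \<le> z" for x y z
  proof -
    have "(s ^^ n x y) x \<le> y" "(s ^^ n y z) y \<le> z" using n_iff that by blast+
    then have "(s ^^ (n y z + n x y)) x \<le> z"
      using mono[of "(s ^^ n x y) x" y "n y z"] by (simp add: funpow_add)
    then show ?thesis using n_iff[of x z "n y z + n x y"] that by simp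
  qed
  \<comment> \<open>The remainders before \<open>y\<close> and before \<open>z\<close> are each less
    than one step of \<open>s\<close>, so together they hold at most one further step.\<close>
  have sub: "n x z \<le> n x y + n y z + 1" if "x \<le> y" "y \<le> z" for x y z
  proof -
    have "y < (s ^^ Suc (n x y)) x" "z < (s ^^ Suc (n y z)) y"
      using n_iff[OF that(1), of "Suc (n x y)"] n_iff[OF that(2), of "Suc (n y z)"] by auto
    then have "z < (s ^^ (Suc (n y z) + Suc (n x y))) x"
      using mono[of y "(s ^^ Suc (n x y)) x" "Suc (n y z)"]
      by (simp only: funpow_add o_apply less_le_trans)
    then have "\<not> Suc (n y z) + Suc (n x y) \<le> n x z"
      using n_iff[of x z "Suc (n y z) + Suc (n x y)"] that by simp
    then show ?thesis by simp
  qed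
  have "quasi_length \<Gamma> (1 / real N) (\<lambda>x y. real (n x y) / real N)"
  proof (rule quasi_lengthI)
    fix x y z :: real assume xyz: "x \<le> y" "y \<le> z"
    show "real (n x y) / real N + real (n y z) / real N \<le> real (n x z) / real N"
      using super[OF xyz] by (simp add: add_divide_distrib[symmetric] divide_right_mono)
    show "real (n x z) / real N \<le> real (n x y) / real N + real (n y z) / real N + 1 / real N"
      using sub[OF xyz] by (simp add: add_divide_distrib[symmetric] divide_right_mono)
  next
    fix F x a b y assume F: "F \<in> \<Gamma>" "F x < a" "a \<le> b" "b < F y"
    have xy: "x \<le> y" using le_iff[OF F(1), of x y] F(2-4) by simp
    \<comment> \<open>Since the iterates of \<open>s\<close> commute with \<open>F\<close>, the
      steps taken from \<open>a\<close> dominate the image of the same number of steps taken from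
      \<open>x\<close>.\<close>
    have "F ((s ^^ n a b) x) \<le> (s ^^ n a b) a"
      using mono[of "F x" a "n a b"] centralD(2)[OF central_funpow[OF c] F(1)] F(2) by simp
    also have "\<dots> \<le> b" using n_iff[OF F(3)] by blast
    also have "\<dots> < F y" by (rule F(4))
    finally have "(s ^^ n a b) x \<le> y" using less_iff[OF F(1)] by simp
    then show "real (n a b) / real N \<le> real (n x y) / real N"
      using n_iff[OF xy] by (simp add: divide_right_mono)
  qed (use N n_N in auto)
  then show ?thesis unfolding has_quasi_length_def by blast
qed

lemma positive_count_exists:
  assumes s: "positive s" and "(s ^^ n) 0 \<le> 1"
  shows "\<exists>N\<ge>n. (s ^^ N) 0 \<le> 1 \<and> (s ^^ Suc N) 0 > 1"
proof -
  obtain b where b: "(s ^^ b) 0 > 1" using positive_funpow_unbounded[OF s] by blast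
  have bound: "k \<le> b" if "(s ^^ k) 0 \<le> 1" for k
    using positive_funpow_mono[OF s, of b k 0] that b by (cases "k \<le> b") auto
  define N where "N = (GREATEST k. (s ^^ k) 0 \<le> 1)"
  have "(s ^^ N) 0 \<le> 1" unfolding N_def using assms(2) by (rule GreatestI_nat[where b = b]) (use bound in blast)
  moreover have le: "k \<le> N" if "(s ^^ k) 0 \<le> 1" for k
    unfolding N_def by (rule Greatest_le_nat[where b = b]) (use bound that in blast)+
  moreover have "(s ^^ Suc N) 0 > 1" using le[of "Suc N"] by (meson Suc_n_not_le_n not_less)
  ultimately show ?thesis using assms(2) by blast
qed

text \<open>\<open>q\<close> is the largest number of steps that a positive central map can fit into
  \<open>[0, 1]\<close>. A positive \<open>r\<close> with \<open>r (r x) \<le> \<tau> x\<close>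
  would fit \<open>2 * q\<close> steps. A positive map below \<open>\<tau>\<close> would produce
  such an \<open>r\<close>: either itself, or its quotient \<open>t\<close> with
  \<open>r (t x) = \<tau> x\<close>.\<close>

theorem minimal_positive_root:
  assumes "\<not> has_quasi_length \<Gamma> 0"
  shows "\<exists>\<tau> q. q \<ge> 1 \<and> positive \<tau> \<and> (\<forall>x. (\<tau> ^^ q) x = x + 1) \<and> (\<forall>r. positive r \<longrightarrow> \<tau> 0 \<le> r 0)"
proof -
  define S where "S = {n. \<exists>s. positive s \<and> (s ^^ n) 0 \<le> 1}"
  have T: "positive (\<lambda>x. x + 1)" by (rule positiveI[OF central_translation, of 0]) simp
  then have "1 \<in> S" unfolding S_def by (auto intro!: exI[of _ "\<lambda>x. x + 1"])
  have "\<exists>b. \<forall>n\<in>S. n \<le> b"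
  proof (rule ccontr)
    assume nb: "\<nexists>b. \<forall>n\<in>S. n \<le> b"
    have "\<exists>n\<ge>N. has_quasi_length \<Gamma> (1 / real n)" if "N \<ge> 1" for N
    proof -
      obtain n where "n \<in> S" "N \<le> n" using nb by (meson nle_le)
      then obtain s where s: "positive s" "(s ^^ n) 0 \<le> 1" by (auto simp: S_def)
      obtain k where k: "k \<ge> n" "(s ^^ k) 0 \<le> 1" "(s ^^ Suc k) 0 > 1"
        using positive_count_exists[OF s] by blast
      have "has_quasi_length \<Gamma> (1 / real k)"
        by (rule has_quasi_length_of_positive[OF s(1)]) (use k \<open>N \<le> n\<close> that in auto)
      then show ?thesis using k(1) \<open>N \<le> n\<close> by (intro exI[of _ k]) simp
    qed
    then show False using has_quasi_length_zero_of_small assms by blast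
  qed
  then obtain b where b: "\<And>n. n \<in> S \<Longrightarrow> n \<le> b" by blast
  define q where "q = (GREATEST n. n \<in> S)"
  have "q \<in> S" unfolding q_def by (rule GreatestI_nat[where b = b]) (use \<open>1 \<in> S\<close> b in auto)
  have q_max: "n \<le> q" if "n \<in> S" for n
    unfolding q_def by (rule Greatest_le_nat[where b = b]) (use that b in auto)
  have "q \<ge> 1" using q_max[OF \<open>1 \<in> S\<close>] .
  obtain \<tau> where \<tau>: "positive \<tau>" "(\<tau> ^^ q) 0 \<le> 1" using \<open>q \<in> S\<close> by (auto simp: S_def)
  note c = positiveD(1)[OF \<tau>(1)]
  have no_sqrt: "\<not> (\<forall>x. r (r x) \<le> \<tau> x)" if r: "positive r" for r
  proof
    assume le: "\<forall>x. r (r x) \<le> \<tau> x"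
    have "mono (r ^^ 2)" using central_funpow[OF positiveD(1)[OF r]] unfolding central_def by blast
    then have "((r ^^ 2) ^^ q) 0 \<le> (\<tau> ^^ q) 0"
      by (rule funpow_le_funpow) (use le in \<open>simp add: numeral_2_eq_2\<close>)
    then have "(r ^^ (2 * q)) 0 \<le> 1" using \<tau>(2) by (simp add: funpow_mult mult.commute)
    then have "2 * q \<in> S" using r by (auto simp: S_def)
    then show False using q_max[of "2 * q"] \<open>q \<ge> 1\<close> by simp
  qed
  have least: "\<tau> 0 \<le> r 0" if r: "positive r" for r
  proof (rule ccontr)
    assume "\<not> \<tau> 0 \<le> r 0"
    then have less: "r x < \<tau> x" for x using central_less[OF positiveD(1)[OF r] c, of 0 x] by simp
    note cr = positiveD(1)[OF r]
    show False
    proof (cases "r (r 0) \<le> \<tau> 0")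
      case True
      then have "r (r x) \<le> \<tau> x" for x using central_le[OF central_comp[OF cr cr] c, of 0] by blast
      then show False using no_sqrt[OF r] by blast
    next
      case False
      then have gt: "\<tau> x < r (r x)" for x using central_less[OF c central_comp[OF cr cr], of 0 x] by simp
      obtain r' where r': "central r'" "\<And>x. r (r' x) = x" "\<And>x. r' (r x) = x"
        using central_inverse[OF cr] by blast
      define t where "t x = r' (\<tau> x)" for x
      have ct: "central t" unfolding t_def by (rule central_comp[OF r'(1) c])
      have rt: "r (t x) = \<tau> x" for x by (simp add: t_def r'(2))
      have "positive t"
      proof (rule positiveI[OF ct, of 0])
        show "0 < t 0" using central_strict_mono[OF r'(1) less[of 0]] r'(3) by (simp add: t_def)
      qed
      moreover have "t x < r x" for x
        using central_strict_mono[OF r'(1) gt[of x]] r'(3) by (simp add: t_def)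
      then have "t (t x) \<le> \<tau> x" for x using rt[of x] by (metis less_imp_le)
      ultimately show False using no_sqrt by blast
    qed
  qed
  \<comment> \<open>If the q-th power fell short of the unit translation, the remainder between the
    two would be positive, hence at least \<open>\<tau>\<close>, and \<open>q + 1\<close> steps
    would fit.\<close>
  have "(\<tau> ^^ q) 0 = 0 + 1"
  proof (rule ccontr)
    assume "(\<tau> ^^ q) 0 \<noteq> 0 + 1"
    then have lt: "(\<tau> ^^ q) 0 < 1" using \<tau>(2) by simp
    obtain s' where s': "central s'" "\<And>x. (\<tau> ^^ q) (s' x) = x" "\<And>x. s' ((\<tau> ^^ q) x) = x"
      using central_inverse[OF central_funpow[OF c]] by blast
    have cr: "central (\<lambda>x. s' (x + 1))" by (rule central_comp[OF s'(1) central_translation])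
    have "positive (\<lambda>x. s' (x + 1))"
      by (rule positiveI[OF cr, of 0]) (use central_strict_mono[OF s'(1) lt] s'(3) in simp)
    then have "\<tau> 0 \<le> s' (0 + 1)" by (rule least)
    then have "(\<tau> ^^ q) (\<tau> 0) \<le> (\<tau> ^^ q) (s' 1)"
      using centralD(1)[OF central_funpow[OF c]] by simp
    then have "(\<tau> ^^ (q + 1)) 0 \<le> 1" using s'(2) by (simp add: funpow_swap1)
    then have "q + 1 \<in> S" using \<tau>(1) unfolding S_def by blast
    then show False using q_max[of "q + 1"] by simp
  qed
  then have "(\<tau> ^^ q) x = x + 1" for x
    using central_eq[OF central_funpow[OF c] central_translation] by blast
  then show ?thesis using \<open>q \<ge> 1\<close> \<tau>(1) least by blast
qed

text \<open>The infimum of the right ends of the images of \<open>(x, y)\<close> to the right of a given point commutes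
  with \<open>\<Gamma>\<close>, so an interval shorter than the minimal positive element can be contracted.\<close>

lemma contractible:
  assumes least: "\<forall>r. positive r \<longrightarrow> \<tau> 0 \<le> r 0" and \<tau>: "positive \<tau>"
    and xy: "x < y" "y < \<tau> x" and e: "e > 0"
  shows "\<exists>F\<in>\<Gamma>. z \<le> F x \<and> F y < z + e"
proof -
  define A where "A z = {F y | F. F \<in> \<Gamma> \<and> z \<le> F x}" for z
  define s where "s z = Inf (A z)" for z
  have A_gt: "z < w" if "w \<in> A z" for w z
    using that less_iff xy(1) unfolding A_def by (auto intro: le_less_trans)
  then have bdd: "bdd_below (A z)" for z by (intro bdd_belowI[of _ z]) (simp add: less_imp_le)
  have ne: "A z \<noteq> {}" for z
  proof -
    have "z \<le> x + of_int \<lceil>z - x\<rceil>" by linarith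
    then show ?thesis unfolding A_def using int_translation[of "\<lceil>z - x\<rceil>"] by blast
  qed
  have s_le: "s z \<le> F y" if "F \<in> \<Gamma>" "z \<le> F x" for F z
    unfolding s_def by (rule cInf_lower[OF _ bdd]) (use that in \<open>auto simp: A_def\<close>)
  have s_ge: "w \<le> s z" if "\<And>F. F \<in> \<Gamma> \<Longrightarrow> z \<le> F x \<Longrightarrow> w \<le> F y" for w z
    unfolding s_def by (rule cInf_greatest[OF ne]) (use that in \<open>auto simp: A_def\<close>)
  have sF: "F (s w) \<le> s (F w)" if F: "F \<in> \<Gamma>" for F w
  proof (rule s_ge)
    fix F1 assume F1: "F1 \<in> \<Gamma>" "F w \<le> F1 x"
    obtain F' where F': "F' \<in> \<Gamma>" "\<And>x. F (F' x) = x" "\<And>x. F' (F x) = x" using inverse[OF F] by blast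
    have "w \<le> (F' \<circ> F1) x" using le_iff[OF F'(1), of "F w" "F1 x"] F1(2) F'(3) by simp
    then have "s w \<le> (F' \<circ> F1) y" using s_le[OF comp[OF F'(1) F1(1)]] by blast
    then have "F (s w) \<le> F (F' (F1 y))" using le_iff[OF F] by simp
    then show "F (s w) \<le> F1 y" by (simp add: F'(2))
  qed
  have "s (F w) = F (s w)" if F: "F \<in> \<Gamma>" for F w
  proof (rule antisym[OF _ sF[OF F]])
    obtain F' where F': "F' \<in> \<Gamma>" "\<And>x. F (F' x) = x" "\<And>x. F' (F x) = x" using inverse[OF F] by blast
    have "F (F' (s (F w))) \<le> F (s w)" using sF[OF F'(1), of "F w"] le_iff[OF F] F'(3) by simp
    then show "s (F w) \<le> F (s w)" by (simp add: F'(2))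
  qed
  moreover have "s w \<le> s w'" if "w \<le> w'" for w w' using that by (intro s_ge s_le) auto
  ultimately have cs: "central s" by (auto simp: central_def mono_def)
  have "s z = z"
  proof (rule ccontr)
    assume "s z \<noteq> z"
    moreover have "z \<le> s z" by (rule s_ge) (use less_iff xy(1) in \<open>force intro: order_trans less_imp_le\<close>)
    ultimately have "positive s" by (intro positiveI[OF cs, of z]) simp
    then have "\<tau> 0 \<le> s 0" using least by blast
    then have "\<tau> x \<le> s x" using central_le[OF positiveD(1)[OF \<tau>] cs] by blast
    also have "s x \<le> y" using s_le[OF id_mem] by simp
    finally show False using xy(2) by simp
  qed
  then have "\<exists>w\<in>A z. w < z + e" using cInf_lessD[OF ne, of z "z + e"] e by (auto simp: s_def)
  then show ?thesis by (auto simp: A_def)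
qed

text \<open>Contraction bounds \<open>D a b\<close> by the quasi-length of any interval, however
  short. Applied to \<open>n\<close> consecutive intervals of length \<open>1 / n\<close>,
  superadditivity gives \<open>n * D a b \<le> 1\<close>.\<close>

lemma quasi_length_zero_short:
  assumes least: "\<forall>r. positive r \<longrightarrow> \<tau> 0 \<le> r 0" and \<tau>: "positive \<tau>"
    and D: "quasi_length \<Gamma> d D" and ab: "a \<le> b" "b < \<tau> a"
  shows "D a b = 0"
proof -
  note D1 = quasi_lengthD[OF D]
  obtain t where t: "central t" "\<And>x. \<tau> (t x) = x" "\<And>x. t (\<tau> x) = x"
    using central_inverse[OF positiveD(1)[OF \<tau>]] by blast
  \<comment> \<open>The closed interval is first enlarged to \<open>(x, y)\<close>, still shorter
    than one step of \<open>\<tau>\<close>, because the push clause needs room at both ends.\<close>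
  have "t b < a" using central_strict_mono[OF t(1) ab(2)] t(3) by simp
  then obtain x where x: "t b < x" "x < a" using dense by blast
  have "b < \<tau> x" using central_strict_mono[OF positiveD(1)[OF \<tau>] x(1)] t(2) by simp
  then obtain y where y: "b < y" "y < \<tau> x" using dense by blast
  have small: "D a b \<le> D z (z + e)" if e: "e > 0" for z e
  proof -
    have "x < y" using x y ab by simp
    obtain F where F: "F \<in> \<Gamma>" "z \<le> F x" "F y < z + e"
      using contractible[OF least \<tau> \<open>x < y\<close> y(2) e, of z] by blast
    obtain F' where F': "F' \<in> \<Gamma>" "\<And>x. F' (F x) = x" using inverse[OF F(1)] by blast
    have "F' z \<le> F' (F x)" "F' (F y) \<le> F' (z + e)"
      using le_iff[OF F'(1), of z "F x"] le_iff[OF F'(1), of "F y" "z + e"] F(2,3) by simp_all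
    then have "F' z < a" "b < F' (z + e)" unfolding F'(2) using x(2) y(1) by linarith+
    then show ?thesis using D1(5)[OF F'(1) _ ab(1)] by blast
  qed
  have bound: "real n * D a b \<le> 1" if n: "n > 0" for n :: nat
  proof -
    have "real k * D a b \<le> D 0 (real k / real n)" for k
    proof (induction k)
      case 0
      then show ?case using quasi_length_refl[OF D] by simp
    next
      case (Suc k)
      have eq: "real (Suc k) / real n = real k / real n + 1 / real n" by (simp add: add_divide_distrib)
      have "D 0 (real k / real n) + D (real k / real n) (real k / real n + 1 / real n) \<le>
          D 0 (real k / real n + 1 / real n)"
        by (rule D1(2)) auto
      moreover have "D a b \<le> D (real k / real n) (real k / real n + 1 / real n)"
        by (rule small) (use n in simp)
      ultimately show ?case unfolding eq using Suc by (simp add: algebra_simps)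
    qed
    from this[of n] show ?thesis using n D1(4)[of 0] by simp
  qed
  show ?thesis
  proof (rule ccontr)
    assume "D a b \<noteq> 0"
    then have pos: "D a b > 0" using D1(1)[OF ab(1)] by simp
    obtain n :: nat where n: "real n > 1 / D a b" using reals_Archimedean2 by blast
    then have "n > 0" using pos by (cases "n = 0") (auto simp: field_simps)
    moreover have "real n * D a b > 1" using n pos by (simp add: field_simps)
    ultimately show False using bound[of n] by simp
  qed
qed

text \<open>An interval shorter than \<open>n + 1\<close> steps of \<open>\<tau>\<close> is cut into
  at most \<open>n + 1\<close> pieces of quasi-length 0, and each of the at most \<open>n\<close>
  cuts costs \<open>d\<close>.\<close>

lemma quasi_length_defect_bound:
  assumes least: "\<forall>r. positive r \<longrightarrow> \<tau> 0 \<le> r 0" and \<tau>: "positive \<tau>"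
    and D: "quasi_length \<Gamma> d D" and root: "\<And>x. (\<tau> ^^ q) x = x + 1"
  shows "1 \<le> real q * d"
proof -
  note D1 = quasi_lengthD[OF D]
  note c = positiveD(1)[OF \<tau>]
  have "D x z \<le> real n * d" if "x \<le> z" "z < (\<tau> ^^ Suc n) x" for n x z
    using that
  proof (induction n arbitrary: x)
    case 0
    then show ?case using quasi_length_zero_short[OF least \<tau> D] by simp
  next
    case (Suc n)
    show ?case
    proof (cases "z < (\<tau> ^^ Suc n) x")
      case True
      then have "D x z \<le> real n * d" using Suc by blast
      moreover have "0 \<le> d" using D1(3)[of x x x] quasi_length_refl[OF D, of x] by simp
      ultimately show ?thesis by (simp add: algebra_simps)
    next
      case False
      obtain s where s: "central s" "\<And>x. (\<tau> ^^ Suc n) (s x) = x" "\<And>x. s ((\<tau> ^^ Suc n) x) = x"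
        using central_inverse[OF central_funpow[OF c]] by blast
      have "s z < \<tau> x"
        using central_strict_mono[OF s(1) Suc.prems(2)] s(3)[of "\<tau> x"] by (simp add: funpow_swap1)
      \<comment> \<open>Any such \<open>y\<close> leaves both a first piece shorter than one step
        and a remainder shorter than \<open>n + 1\<close> steps.\<close>
      then obtain y where y: "s z < y" "y < \<tau> x" using dense by blast
      have "x \<le> s z" using centralD(1)[OF s(1), of "(\<tau> ^^ Suc n) x" z] False s(3) by simp
      have zy: "z < (\<tau> ^^ Suc n) y"
        using central_strict_mono[OF central_funpow[OF c] y(1), of "Suc n"] s(2) by simp
      show ?thesis
      proof (cases "y \<le> z")
        case True
        have "D y z \<le> real n * d" by (rule Suc.IH[OF True zy])
        moreover have "D x y = 0"
          using quasi_length_zero_short[OF least \<tau> D _ y(2)] \<open>x \<le> s z\<close> y(1) by simp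
        moreover have "D x z \<le> D x y + D y z + d" using D1(3)[of x y z] \<open>x \<le> s z\<close> y(1) True by simp
        ultimately show ?thesis by (simp add: algebra_simps)
      next
        case False
        then have "z < \<tau> x" using y(2) by simp
        then have "D x z = 0" using quasi_length_zero_short[OF least \<tau> D Suc.prems(1)] by simp
        moreover have "0 \<le> d" using D1(3)[of x x x] quasi_length_refl[OF D, of x] by simp
        ultimately show ?thesis by simp
      qed
    qed
  qed
  \<comment> \<open>\<open>[0, 1]\<close> is exactly \<open>q\<close> steps long and the claim wants
    strictly fewer than \<open>n + 1\<close>, so \<open>n\<close> is \<open>q\<close> and not
    \<open>q - 1\<close>.\<close>
  from this[of 0 1 q] have "D 0 1 \<le> real q * d"
    using positiveD(2)[OF \<tau>, of 1] root[of 0] by simp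
  then show ?thesis using D1(4)[of 0] by simp
qed

end

section \<open>Collapsing the gaps of a perfect set\<close>

text \<open>The setting for a Cantor function of \<open>K\<close>: continuous, monotone, of degree
  one and constant exactly on the intervals that miss \<open>K\<close>. A set without gaps is
  allowed.\<close>

locale perfect_periodic_set =
  fixes K :: "real set"
  assumes perfect: "x \<in> K \<Longrightarrow> x islimpt K"
    and nonempty: "K \<noteq> {}"
    and periodic: "x + 1 \<in> K \<longleftrightarrow> x \<in> K"
begin

lemma periodic_int: "x + of_int n \<in> K \<longleftrightarrow> x \<in> K"
proof (induction n rule: int_induct[where k = 0])
  case (step1 i)
  then show ?case using periodic[of "x + of_int i"] by (simp add: algebra_simps)
next
  case (step2 i)
  then show ?case using periodic[of "x + of_int (i - 1)"] by (simp add: algebra_simps)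
qed simp

lemma gapI: "x \<in> K \<Longrightarrow> a < x \<Longrightarrow> x < b \<Longrightarrow> {a<..<b} \<inter> K \<noteq> {}"
  by auto

lemma gap_mono: "{a<..<b} \<inter> K \<noteq> {} \<Longrightarrow> a' \<le> a \<Longrightarrow> b \<le> b' \<Longrightarrow> {a'<..<b'} \<inter> K \<noteq> {}"
  by force

text \<open>By perfectness the interval contains three points of \<open>K\<close>, and the middle
  one can be taken.\<close>

lemma split:
  assumes "{a<..<b} \<inter> K \<noteq> {}"
  shows "\<exists>m\<in>K. a < m \<and> m < b \<and> {a<..<m} \<inter> K \<noteq> {} \<and> {m<..<b} \<inter> K \<noteq> {}"
proof -
  obtain c where c: "c \<in> K" "a < c" "c < b" using assms by auto
  have "infinite (K \<inter> ball c (min (c - a) (b - c)))"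
    using perfect[OF c(1)] c unfolding islimpt_eq_infinite_ball by auto
  moreover have "K \<inter> ball c (min (c - a) (b - c)) \<subseteq> {a<..<b} \<inter> K"
    by (auto simp: dist_real_def)
  ultimately have "infinite ({a<..<b} \<inter> K)" using finite_subset by blast
  then obtain B where B: "finite B" "card B = 3" "B \<subseteq> {a<..<b} \<inter> K"
    using infinite_arbitrarily_large by blast
  have "B \<noteq> {}" using B(2) by auto
  have "card {Min B, Max B} \<le> 2" by (simp add: card_insert_if)
  then have "\<not> B \<subseteq> {Min B, Max B}" using B(2) card_mono[of "{Min B, Max B}" B] by auto
  then obtain m where m: "m \<in> B" "m \<noteq> Min B" "m \<noteq> Max B" by auto
  have "Min B \<in> B" "Max B \<in> B" using B(1) \<open>B \<noteq> {}\<close> by auto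
  moreover have "Min B < m" "m < Max B" using m B(1) by (simp_all add: less_le)
  ultimately have "{a<..<m} \<inter> K \<noteq> {}" "{m<..<b} \<inter> K \<noteq> {}"
    using B(3) by (intro gapI[of "Min B"] gapI[of "Max B"]; auto)+
  then show ?thesis using B(3) m(1) by (intro bexI[of _ m]) auto
qed

text \<open>At step \<open>n\<close> the subdivision point is placed inside a translate of the \<open>n\<close>-th rational interval
  whenever one fits, so that in the end the subdivision points meet every interval that meets \<open>K\<close>.\<close>

definition test_interval :: "nat \<Rightarrow> real \<times> real" where
  "test_interval n = (of_rat (fst (from_nat n :: rat \<times> rat)), of_rat (snd (from_nat n :: rat \<times> rat)))"

text \<open>If any integer translate of the test interval fits into \<open>[a, b]\<close>, then
  \<open>m\<close> lies in some translate, possibly a different one; periodicity moves it back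
  later.\<close>

definition good_mid :: "nat \<Rightarrow> real \<Rightarrow> real \<Rightarrow> real \<Rightarrow> bool" where
  "good_mid n a b m \<longleftrightarrow> m \<in> K \<and> a < m \<and> m < b \<and> {a<..<m} \<inter> K \<noteq> {} \<and> {m<..<b} \<inter> K \<noteq> {} \<and>
     (\<forall>j::int. a \<le> fst (test_interval n) + j \<and> snd (test_interval n) + j \<le> b \<and>
        {fst (test_interval n)<..<snd (test_interval n)} \<inter> K \<noteq> {} \<longrightarrow>
        (\<exists>j::int. fst (test_interval n) + j < m \<and> m < snd (test_interval n) + j))"

lemma shift_Int: "{a + of_int j<..<b + of_int j} \<inter> K \<noteq> {} \<longleftrightarrow> {a<..<b} \<inter> K \<noteq> {}"
proof -
  have imp: "{a + of_int j<..<b + of_int j} \<inter> K \<noteq> {}" if "{a<..<b} \<inter> K \<noteq> {}" for a b and j :: int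
  proof -
    obtain x where "x \<in> K" "a < x" "x < b" using \<open>{a<..<b} \<inter> K \<noteq> {}\<close> by auto
    then have "x + of_int j \<in> {a + of_int j<..<b + of_int j} \<inter> K" using periodic_int by auto
    then show ?thesis by blast
  qed
  show ?thesis using imp[of a b j] imp[of "a + of_int j" "b + of_int j" "- j"] by auto
qed

lemma good_mid_exists:
  assumes "{a<..<b} \<inter> K \<noteq> {}"
  shows "\<exists>m. good_mid n a b m"
proof (cases "\<exists>j::int. a \<le> fst (test_interval n) + j \<and> snd (test_interval n) + j \<le> b \<and>
        {fst (test_interval n)<..<snd (test_interval n)} \<inter> K \<noteq> {}")
  case True
  then obtain j :: int where j: "a \<le> fst (test_interval n) + j" "snd (test_interval n) + j \<le> b"
    "{fst (test_interval n)<..<snd (test_interval n)} \<inter> K \<noteq> {}" by blast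
  then have "{fst (test_interval n) + j<..<snd (test_interval n) + j} \<inter> K \<noteq> {}"
    using shift_Int by blast
  then obtain m where m: "m \<in> K" "fst (test_interval n) + j < m" "m < snd (test_interval n) + j"
    "{fst (test_interval n) + j<..<m} \<inter> K \<noteq> {}" "{m<..<snd (test_interval n) + j} \<inter> K \<noteq> {}"
    using split by blast
  have "{a<..<m} \<inter> K \<noteq> {}" "{m<..<b} \<inter> K \<noteq> {}"
    by (rule gap_mono[OF m(4) j(1) order_refl], rule gap_mono[OF m(5) order_refl j(2)])
  then show ?thesis using m(1-3) j(1,2) unfolding good_mid_def by (intro exI[of _ m]) auto
next
  case False
  then show ?thesis using split[OF assms] unfolding good_mid_def by blast
qed

text \<open>The choice is made with \<open>a\<close> reduced modulo one, to make it commute with translations.\<close>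

definition mid :: "nat \<Rightarrow> real \<Rightarrow> real \<Rightarrow> real" where
  "mid n a b = of_int \<lfloor>a\<rfloor> + (SOME m. good_mid n (a - of_int \<lfloor>a\<rfloor>) (b - of_int \<lfloor>a\<rfloor>) m)"

lemma mid_add_int: "mid n (a + of_int j) (b + of_int j) = mid n a b + of_int j"
  by (simp add: mid_def)

lemma good_mid_shift:
  assumes "good_mid n (a - of_int i) (b - of_int i) m"
  shows "good_mid n a b (of_int i + m)"
  unfolding good_mid_def
proof (intro conjI allI impI)
  show "of_int i + m \<in> K" using assms periodic_int[of m i] by (simp add: good_mid_def add.commute)
  show "a < of_int i + m" "of_int i + m < b" using assms by (auto simp: good_mid_def)
  show "{a<..<of_int i + m} \<inter> K \<noteq> {}"
    using assms shift_Int[of "a - of_int i" i m] by (simp add: good_mid_def add.commute)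
  show "{of_int i + m<..<b} \<inter> K \<noteq> {}"
    using assms shift_Int[of m i "b - of_int i"] by (simp add: good_mid_def add.commute)
  fix j :: int
  assume j: "a \<le> fst (test_interval n) + j \<and> snd (test_interval n) + j \<le> b \<and>
        {fst (test_interval n)<..<snd (test_interval n)} \<inter> K \<noteq> {}"
  have "a - of_int i \<le> fst (test_interval n) + of_int (j - i)"
    "snd (test_interval n) + of_int (j - i) \<le> b - of_int i" using j by auto
  then obtain j' :: int where "fst (test_interval n) + j' < m" "m < snd (test_interval n) + j'"
    using assms j unfolding good_mid_def by blast
  then have "fst (test_interval n) + of_int (j' + i) < of_int i + m"
    "of_int i + m < snd (test_interval n) + of_int (j' + i)" by auto
  then show "\<exists>j::int. fst (test_interval n) + j < of_int i + m \<and> of_int i + m < snd (test_interval n) + j"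
    by blast
qed

lemma good_mid_mid:
  assumes "{a<..<b} \<inter> K \<noteq> {}"
  shows "good_mid n a b (mid n a b)"
proof -
  have "{a - of_int \<lfloor>a\<rfloor><..<b - of_int \<lfloor>a\<rfloor>} \<inter> K \<noteq> {}"
    using shift_Int[of a "- \<lfloor>a\<rfloor>" b] assms by simp
  then have "good_mid n (a - of_int \<lfloor>a\<rfloor>) (b - of_int \<lfloor>a\<rfloor>)
      (SOME m. good_mid n (a - of_int \<lfloor>a\<rfloor>) (b - of_int \<lfloor>a\<rfloor>) m)"
    by (rule someI_ex[OF good_mid_exists])
  then show ?thesis unfolding mid_def by (rule good_mid_shift)
qed

section \<open>Dyadic subdivision by points of the set\<close>

definition base :: real where "base = (SOME x. x \<in> K)"

lemma base_mem: "base \<in> K"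
  unfolding base_def using nonempty by (simp add: some_in_eq)

text \<open>\<open>point n k\<close> is destined for the value \<open>k / 2 ^ n\<close>. Indices run
  over all integers, so that an integer translation becomes an index shift by a multiple of
  \<open>2 ^ n\<close>.\<close>

fun point :: "nat \<Rightarrow> int \<Rightarrow> real" where
  "point 0 k = base + of_int k"
| "point (Suc n) k = (if even k then point n (k div 2)
     else mid n (point n (k div 2)) (point n (k div 2 + 1)))"

lemma point_even [simp]: "point (Suc n) (2 * k) = point n k"
  by simp

lemma point_odd: "point (Suc n) (2 * k + 1) = mid n (point n k) (point n (k + 1))"
  by simp

declare point.simps(2) [simp del]

lemma gap_base: "{base<..<base + 1} \<inter> K \<noteq> {}"
proof -
  obtain y where y: "y \<in> K" "y \<noteq> base" "dist y base < 1"
    using perfect[OF base_mem] unfolding islimpt_approachable by (metis zero_less_one)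
  show ?thesis
  proof (cases "y > base")
    case True
    then show ?thesis using y by (intro gapI[of y]) (auto simp: dist_real_def)
  next
    case False
    then have "y + 1 \<in> {base<..<base + 1} \<inter> K" using y periodic[of y] by (auto simp: dist_real_def)
    then show ?thesis by blast
  qed
qed

lemma point_gap: "{point n k<..<point n (k + 1)} \<inter> K \<noteq> {}"
proof (induction n arbitrary: k)
  case 0
  then show ?case using shift_Int[of base k "base + 1"] gap_base by (simp add: algebra_simps)
next
  case (Suc n)
  obtain j where j: "k = 2 * j \<or> k = 2 * j + 1" using oddE evenE by metis
  have g: "good_mid n (point n j) (point n (j + 1)) (mid n (point n j) (point n (j + 1)))"
    by (rule good_mid_mid[OF Suc.IH])
  have e: "point (Suc n) (2 * j + 1 + 1) = point n (j + 1)"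
    using point_even[of n "j + 1"] by (simp add: algebra_simps)
  from j show ?case
  proof
    assume k: "k = 2 * j"
    show ?thesis unfolding k point_odd point_even using g unfolding good_mid_def by blast
  next
    assume k: "k = 2 * j + 1"
    show ?thesis unfolding k e point_odd using g unfolding good_mid_def by blast
  qed
qed

lemma point_less: "point n k < point n (k + 1)"
  using point_gap[of n k] by auto

lemma point_mem: "point n k \<in> K"
proof (induction n arbitrary: k)
  case 0
  then show ?case using periodic_int base_mem by simp
next
  case (Suc n)
  obtain j where j: "k = 2 * j \<or> k = 2 * j + 1" using oddE evenE by metis
  have "good_mid n (point n j) (point n (j + 1)) (mid n (point n j) (point n (j + 1)))"
    by (rule good_mid_mid[OF point_gap])
  then show ?case using j Suc unfolding good_mid_def by (auto simp: point_odd)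
qed

lemma point_strict_mono: "k < k' \<Longrightarrow> point n k < point n k'"
proof (induction k' rule: int_gr_induct)
  case base
  then show ?case by (rule point_less)
next
  case (step i)
  then show ?case using point_less[of n i] by linarith
qed

lemma point_add_power: "point n (k + j * 2 ^ n) = point n k + of_int j"
proof (induction n arbitrary: k)
  case 0
  then show ?case by simp
next
  case (Suc n)
  obtain i where "k = 2 * i \<or> k = 2 * i + 1" using oddE evenE by metis
  then show ?case
  proof
    assume k: "k = 2 * i"
    have "k + j * 2 ^ Suc n = 2 * (i + j * 2 ^ n)" by (simp add: k algebra_simps)
    then show ?thesis using Suc[of i] by (simp only: k point_even)
  next
    assume k: "k = 2 * i + 1"
    have "k + j * 2 ^ Suc n = 2 * (i + j * 2 ^ n) + 1" by (simp add: k algebra_simps)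
    moreover have "i + j * 2 ^ n + 1 = (i + 1) + j * 2 ^ n" by simp
    ultimately show ?thesis
      unfolding k using point_odd mid_add_int Suc[of i] Suc[of "i + 1"] by metis
  qed
qed

lemma point_refine: "point (n + i) (k * 2 ^ i) = point n k"
proof (induction i)
  case (Suc i)
  have "k * 2 ^ Suc i = 2 * (k * 2 ^ i)" by simp
  then show ?case using Suc point_even[of "n + i" "k * 2 ^ i"] by (metis add_Suc_right)
qed simp

text \<open>Both points reappear at the common level \<open>n + m\<close>, where they are ordered by
  index.\<close>

lemma point_less_iff: "point n k < point m j \<longleftrightarrow> of_int k / 2 ^ n < (of_int j / 2 ^ m :: real)"
proof -
  have "point n k < point m j \<longleftrightarrow> point (n + m) (k * 2 ^ m) < point (n + m) (j * 2 ^ n)"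
    using point_refine[of n m k] point_refine[of m n j] by (simp add: add.commute)
  also have "\<dots> \<longleftrightarrow> k * 2 ^ m < j * 2 ^ n"
    using point_strict_mono by (metis linorder_neqE not_less_iff_gr_or_eq)
  also have "\<dots> \<longleftrightarrow> real_of_int (k * 2 ^ m) < real_of_int (j * 2 ^ n)" by (rule of_int_less_iff[symmetric])
  also have "\<dots> \<longleftrightarrow> of_int k / 2 ^ n < (of_int j / 2 ^ m :: real)" by (simp add: field_simps)
  finally show ?thesis .
qed

lemma point_between: "\<exists>k. point n k \<le> x \<and> x < point n (k + 1)"
proof (induction n)
  case 0
  have "point 0 \<lfloor>x - base\<rfloor> \<le> x \<and> x < point 0 (\<lfloor>x - base\<rfloor> + 1)" by simp linarith
  then show ?case by blast
next
  case (Suc n)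
  then obtain k where k: "point n k \<le> x" "x < point n (k + 1)" by blast
  have e: "point (Suc n) (2 * k + 1 + 1) = point n (k + 1)"
    using point_even[of n "k + 1"] by (simp add: algebra_simps)
  show ?case
  proof (cases "point (Suc n) (2 * k + 1) \<le> x")
    case True
    then show ?thesis using k e by (intro exI[of _ "2 * k + 1"]) simp
  next
    case False
    then show ?thesis using k by (intro exI[of _ "2 * k"]) simp
  qed
qed

text \<open>A test interval \<open>(r, s)\<close> inside \<open>(x, y)\<close> either contains a
  point of its level or fits between two neighbouring ones. In the second case the next midpoint
  lies in a translate of it and is shifted back.\<close>

lemma point_dense:
  assumes "{x<..<y} \<inter> K \<noteq> {}"
  shows "\<exists>n k. x < point n k \<and> point n k < y"
proof -
  obtain c where c: "c \<in> K" "x < c" "c < y" using assms by auto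
  obtain r where r: "x < of_rat r" "of_rat r < c" using of_rat_dense[OF c(2)] by blast
  obtain s where s: "c < of_rat s" "of_rat s < y" using of_rat_dense[OF c(3)] by blast
  obtain n where n: "from_nat n = (r, s)" by (metis from_nat_to_nat)
  have ti: "fst (test_interval n) = of_rat r" "snd (test_interval n) = of_rat s"
    by (auto simp: test_interval_def n)
  obtain k where k: "point n k \<le> of_rat r" "of_rat r < point n (k + 1)" using point_between by blast
  show ?thesis
  proof (cases "point n (k + 1) < of_rat s")
    case True
    then show ?thesis using k(2) r s by (intro exI[of _ n] exI[of _ "k + 1"]) linarith
  next
    case False
    have g: "good_mid n (point n k) (point n (k + 1)) (point (Suc n) (2 * k + 1))"
      unfolding point_odd by (rule good_mid_mid[OF point_gap])
    have "point n k \<le> fst (test_interval n) + of_int 0" "snd (test_interval n) + of_int 0 \<le> point n (k + 1)"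
      using k False by (simp_all add: ti)
    moreover have "{fst (test_interval n)<..<snd (test_interval n)} \<inter> K \<noteq> {}"
      using c r s by (auto simp: ti)
    ultimately obtain j :: int where j: "of_rat r + j < point (Suc n) (2 * k + 1)"
      "point (Suc n) (2 * k + 1) < of_rat s + j"
      using g unfolding good_mid_def ti by blast
    have "point (Suc n) (2 * k + 1 + (- j) * 2 ^ Suc n) = point (Suc n) (2 * k + 1) + of_int (- j)"
      by (rule point_add_power)
    then have "x < point (Suc n) (2 * k + 1 + (- j) * 2 ^ Suc n)"
      "point (Suc n) (2 * k + 1 + (- j) * 2 ^ Suc n) < y"
      using j r s by simp_all
    then show ?thesis by blast
  qed
qed

section \<open>The collapsing map\<close>

definition collapse :: "real \<Rightarrow> real" where
  "collapse x = Sup {of_int k / 2 ^ n | n k. point n k \<le> x}"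

lemma collapse_bdd: "bdd_above {real_of_int k / 2 ^ n | n k. point n k \<le> x}"
proof (rule bdd_aboveI)
  fix t :: real assume "t \<in> {of_int k / 2 ^ n | n k. point n k \<le> x}"
  then obtain n k where t: "t = of_int k / 2 ^ n" "point n k \<le> x" by blast
  have "x < point 0 (\<lfloor>x - base\<rfloor> + 1)" by simp linarith
  then have "point n k < point 0 (\<lfloor>x - base\<rfloor> + 1)" using t(2) by linarith
  then show "t \<le> of_int (\<lfloor>x - base\<rfloor> + 1)" unfolding point_less_iff using t(1) by simp
qed

lemma collapse_nonempty: "{real_of_int k / 2 ^ n | n k. point n k \<le> x} \<noteq> {}"
  using point_between[of 0 x] by blast

lemma le_collapse: "point n k \<le> x \<Longrightarrow> of_int k / 2 ^ n \<le> collapse x"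
  unfolding collapse_def by (rule cSup_upper[OF _ collapse_bdd]) blast

lemma collapse_le: "(\<And>n k. point n k \<le> x \<Longrightarrow> of_int k / 2 ^ n \<le> t) \<Longrightarrow> collapse x \<le> t"
  unfolding collapse_def by (rule cSup_least[OF collapse_nonempty]) blast

lemma collapse_mono: "x \<le> y \<Longrightarrow> collapse x \<le> collapse y"
  by (rule collapse_le) (auto intro: le_collapse)

lemma collapse_point: "collapse (point n k) = of_int k / 2 ^ n"
proof (rule antisym)
  show "collapse (point n k) \<le> of_int k / 2 ^ n"
    using point_less_iff by (intro collapse_le) (meson not_less)
qed (simp add: le_collapse)

lemma collapse_add_one: "collapse (x + 1) = collapse x + 1"
proof -
  have le: "collapse x + of_int j \<le> collapse (x + of_int j)" for x and j :: int
  proof -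
    have "collapse x \<le> collapse (x + of_int j) - of_int j"
    proof (rule collapse_le)
      fix n k assume "point n k \<le> x"
      then have "point n (k + j * 2 ^ n) \<le> x + of_int j" by (simp add: point_add_power)
      then have "of_int (k + j * 2 ^ n) / 2 ^ n \<le> collapse (x + of_int j)" by (rule le_collapse)
      then show "of_int k / 2 ^ n \<le> collapse (x + of_int j) - of_int j" by (simp add: field_simps)
    qed
    then show ?thesis by simp
  qed
  show ?thesis using le[of x 1] le[of "x + 1" "- 1"] by simp
qed

lemma dyadic_dense:
  fixes u v :: real
  assumes "u < v"
  shows "\<exists>n (k::int). u < of_int k / 2 ^ n \<and> of_int k / 2 ^ n < v"
proof -
  obtain n where n: "(1 / 2) ^ n < v - u" using real_arch_pow_inv[of "v - u" "1 / 2"] assms by auto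
  then have "1 < (v - u) * 2 ^ n" by (simp add: power_divide field_simps)
  then have "u * 2 ^ n < of_int (\<lfloor>u * 2 ^ n\<rfloor> + 1)" "of_int (\<lfloor>u * 2 ^ n\<rfloor> + 1) < v * 2 ^ n"
    by (linarith, simp add: algebra_simps) linarith
  then show ?thesis by (intro exI[of _ n] exI[of _ "\<lfloor>u * 2 ^ n\<rfloor> + 1"]) (simp add: field_simps)
qed

lemma collapse_continuous: "continuous_on UNIV collapse"
proof (rule continuous_of_mono_dense)
  show "mono collapse" by (rule monoI) (rule collapse_mono)
  show "\<exists>x. u < collapse x \<and> collapse x < v" if "u < v" for u v
    using dyadic_dense[OF that] collapse_point by metis
qed

text \<open>If \<open>K\<close> meets the interval, splitting gives two subdivision points with
  different labels inside. If \<open>collapse\<close> differs at the ends, some label lies strictly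
  between the values, and its point belongs to \<open>K\<close>.\<close>

lemma collapse_eq_iff:
  assumes "x < y"
  shows "collapse x = collapse y \<longleftrightarrow> {x<..<y} \<inter> K = {}"
proof
  assume eq: "collapse x = collapse y"
  show "{x<..<y} \<inter> K = {}"
  proof (rule ccontr)
    assume "{x<..<y} \<inter> K \<noteq> {}"
    then obtain m where m: "{x<..<m} \<inter> K \<noteq> {}" "{m<..<y} \<inter> K \<noteq> {}" using split by blast
    obtain n k where k: "x < point n k" "point n k < m" using point_dense[OF m(1)] by blast
    obtain n' k' where k': "m < point n' k'" "point n' k' < y" using point_dense[OF m(2)] by blast
    have "collapse x \<le> collapse (point n k)" "collapse (point n' k') \<le> collapse y"
      using collapse_mono k(1) k'(2) by simp_all
    moreover have "collapse (point n k) < collapse (point n' k')"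
      using point_less_iff[of n k n' k'] k(2) k'(1) by (simp add: collapse_point)
    ultimately show False using eq by simp
  qed
next
  assume emp: "{x<..<y} \<inter> K = {}"
  show "collapse x = collapse y"
  proof (rule ccontr)
    assume "collapse x \<noteq> collapse y"
    then have "collapse x < collapse y" using collapse_mono[of x y] assms by simp
    then obtain n k where nk: "collapse x < of_int k / 2 ^ n" "of_int k / 2 ^ n < collapse y"
      using dyadic_dense by blast
    then have "collapse x < collapse (point n k)" "collapse (point n k) < collapse y"
      by (simp_all add: collapse_point)
    then have "x < point n k" "point n k < y" using collapse_mono by (meson not_less)+
    then show False using emp point_mem by auto
  qed
qed

end

section \<open>Minimal sets\<close>

context line_group
begin

text \<open>Zorn is applied to the complements of nonempty closed invariant sets. The line is not
  compact, but such a complement cannot contain \<open>[0, 1]\<close>, since integer translations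
  would make it everything; so compactness of \<open>[0, 1]\<close> keeps the union of a chain
  proper.\<close>

lemma minimal_set_exists:
  "\<exists>K. closed K \<and> K \<noteq> {} \<and> (\<forall>F\<in>\<Gamma>. \<forall>x\<in>K. F x \<in> K) \<and>
     (\<forall>C. closed C \<and> C \<noteq> {} \<and> (\<forall>F\<in>\<Gamma>. \<forall>x\<in>C. F x \<in> C) \<and> C \<subseteq> K \<longrightarrow> C = K)"
proof -
  define \<A> where "\<A> = {U :: real set. open U \<and> U \<noteq> UNIV \<and> (\<forall>F\<in>\<Gamma>. \<forall>x. x \<notin> U \<longrightarrow> F x \<notin> U)}"
  have "\<exists>M\<in>\<A>. \<forall>X\<in>\<A>. M \<subseteq> X \<longrightarrow> X = M"
  proof (rule subset_Zorn)
    fix \<C> assume C: "subset.chain \<A> \<C>"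
    have sub: "\<C> \<subseteq> \<A>" using C unfolding subset.chain_def by blast
    show "\<exists>U\<in>\<A>. \<forall>X\<in>\<C>. X \<subseteq> U"
    proof (cases "\<C> = {}")
      case True
      have "{} \<in> \<A>" by (auto simp: \<A>_def)
      then show ?thesis using True by blast
    next
      case False
      have "\<Union>\<C> \<noteq> UNIV"
      proof
        assume "\<Union>\<C> = UNIV"
        then have "{0..1} \<subseteq> \<Union>\<C>" by simp
        moreover have "\<And>U. U \<in> \<C> \<Longrightarrow> open U" using sub by (auto simp: \<A>_def)
        ultimately obtain \<D> where D: "\<D> \<subseteq> \<C>" "finite \<D>" "{0..1} \<subseteq> \<Union>\<D>"
          using compactE[of "{0..1::real}" \<C>] compact_Icc by metis
        have "\<D> \<noteq> {}" using D(3) by auto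
        moreover have "subset.chain \<A> \<D>" using C D(1) unfolding subset.chain_def by blast
        ultimately have "\<Union>\<D> \<in> \<D>" using Union_in_chain[OF D(2)] by blast
        then have U: "\<Union>\<D> \<in> \<A>" using D(1) sub by blast
        have "x \<in> \<Union>\<D>" for x
        proof -
          have "x + of_int (- \<lfloor>x\<rfloor>) \<in> {0..1}" by simp linarith
          then have "x + of_int (- \<lfloor>x\<rfloor>) \<in> \<Union>\<D>" using D(3) by blast
          moreover have "y \<notin> \<Union>\<D> \<Longrightarrow> F y \<notin> \<Union>\<D>" if "F \<in> \<Gamma>" for F y
            using U that by (simp add: \<A>_def)
          ultimately show ?thesis using int_translation[of "- \<lfloor>x\<rfloor>"] by blast
        qed
        then show False using U by (auto simp: \<A>_def)
      qed
      then have "\<Union>\<C> \<in> \<A>" using sub unfolding \<A>_def by blast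
      then show ?thesis by blast
    qed
  qed
  then obtain M where M: "M \<in> \<A>" "\<And>X. X \<in> \<A> \<Longrightarrow> M \<subseteq> X \<Longrightarrow> X = M" by blast
  show ?thesis
  proof (intro exI[of _ "- M"] conjI allI impI)
    show "closed (- M)" "- M \<noteq> {}" "\<forall>F\<in>\<Gamma>. \<forall>x\<in>- M. F x \<in> - M" using M(1) by (auto simp: \<A>_def)
    fix C assume C: "closed C \<and> C \<noteq> {} \<and> (\<forall>F\<in>\<Gamma>. \<forall>x\<in>C. F x \<in> C) \<and> C \<subseteq> - M"
    then have "- C \<in> \<A>" by (auto simp: \<A>_def)
    then have "- C = M" using M(2) C by blast
    then show "C = - M" by blast
  qed
qed

lemma invariant_iff:
  assumes inv: "\<forall>F\<in>\<Gamma>. \<forall>x\<in>K. F x \<in> K" and F: "F \<in> \<Gamma>"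
  shows "F x \<in> K \<longleftrightarrow> x \<in> K"
proof -
  obtain F' where "F' \<in> \<Gamma>" "\<And>x. F' (F x) = x" using inverse[OF F] by blast
  then show ?thesis using inv F by metis
qed

lemma islimpt_image:
  assumes inv: "\<forall>F\<in>\<Gamma>. \<forall>x\<in>K. F x \<in> K" and F: "F \<in> \<Gamma>" and x: "x islimpt K"
  shows "F x islimpt K"
proof (rule islimptI)
  fix T assume T: "F x \<in> T" "open T"
  then have "open (F -` T)" using continuous[OF F] by (simp add: open_vimage)
  then obtain y where "y \<in> K" "y \<in> F -` T" "y \<noteq> x" using x T(1) by (metis islimptE vimageI)
  then show "\<exists>y\<in>K. y \<in> T \<and> y \<noteq> F x" using inv F less_iff[OF F] by (metis linorder_neqE vimageE less_irrefl)
qed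

text \<open>Without limit points, \<open>K\<close> is finite on bounded intervals. Counting its
  points, normalised by the number in one period, is an exact length.\<close>

lemma has_quasi_length_zero_of_discrete:
  assumes inv: "\<forall>F\<in>\<Gamma>. \<forall>x\<in>K. F x \<in> K" and "K \<noteq> {}" and disc: "\<And>x. \<not> x islimpt K"
  shows "has_quasi_length \<Gamma> 0"
proof -
  have fin: "finite ({x<..y} \<inter> K)" for x y
  proof -
    have "finite ({x..y} \<inter> K)" by (rule finite_not_islimpt_in_compact) (use disc in auto)
    then show ?thesis by (rule finite_subset[rotated]) auto
  qed
  define n where "n x y = card ({x<..y} \<inter> K)" for x y
  have add: "n x z = n x y + n y z" if "x \<le> y" "y \<le> z" for x y z
  proof -
    have "{x<..z} \<inter> K = ({x<..y} \<inter> K) \<union> ({y<..z} \<inter> K)" using that by auto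
    then show ?thesis unfolding n_def using fin by (subst card_Un_disjoint[symmetric]) auto
  qed
  have nF: "n (F x) (F y) = n x y" if F: "F \<in> \<Gamma>" for F x y
  proof -
    obtain F' where F': "F' \<in> \<Gamma>" "\<And>x. F (F' x) = x" using inverse[OF F] by blast
    have "{F x<..F y} \<inter> K = F ` ({x<..y} \<inter> K)"
    proof (intro equalityI subsetI)
      fix z assume z: "z \<in> {F x<..F y} \<inter> K"
      then have "F' z \<in> {x<..y} \<inter> K"
        using less_iff[OF F, of x "F' z"] le_iff[OF F, of "F' z" y] inv F' by auto
      then show "z \<in> F ` ({x<..y} \<inter> K)" using F'(2) by (metis imageI)
    qed (use inv F less_iff[OF F] le_iff[OF F] in auto)
    moreover have "inj_on F A" for A
      using strict_mono[OF F] strict_mono_imp_inj_on inj_on_subset by blast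
    ultimately show ?thesis unfolding n_def by (simp add: card_image)
  qed
  define N where "N = n 0 1"
  have eq: "n x (x + 1) = n y (y + 1)" if "x \<le> y" for x y
    using add[of x y "y + 1"] add[of x "x + 1" "y + 1"] nF[OF translation, of x y] that by simp
  then have nN: "n x (x + 1) = N" for x
    using eq[of x 0] eq[of 0 x] unfolding N_def by (cases "x \<le> 0") auto
  have "N > 0"
  proof -
    obtain k where "k \<in> K" using \<open>K \<noteq> {}\<close> by blast
    then have "k \<in> {k - 1<..k - 1 + 1} \<inter> K" by simp
    then have "n (k - 1) (k - 1 + 1) > 0" unfolding n_def using fin card_gt_0_iff by blast
    then show ?thesis using nN[of "k - 1"] by simp
  qed
  have "quasi_length \<Gamma> 0 (\<lambda>x y. real (n x y) / real N)"
  proof (rule quasi_lengthI)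
    fix x y z :: real assume xyz: "x \<le> y" "y \<le> z"
    show "real (n x y) / real N + real (n y z) / real N \<le> real (n x z) / real N"
      "real (n x z) / real N \<le> real (n x y) / real N + real (n y z) / real N + 0"
      using add[OF xyz] by (simp_all add: add_divide_distrib)
  next
    fix F x a b y assume F: "F \<in> \<Gamma>" "F x < a" "a \<le> b" "b < F y"
    have "n a b \<le> n (F x) (F y)" unfolding n_def by (rule card_mono[OF fin]) (use F in auto)
    then show "real (n a b) / real N \<le> real (n x y) / real N"
      using nF[OF F(1)] by (simp add: divide_right_mono)
  qed (use \<open>N > 0\<close> nN in auto)
  then show ?thesis unfolding has_quasi_length_def by blast
qed

text \<open>The limit points of a minimal set form a closed invariant subset, so the set is perfect
  or has no limit points; the latter would give defect 0. Collapsing the gaps of the perfect set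
  makes all orbits dense.\<close>

theorem minimal_factor:
  assumes nq: "\<not> has_quasi_length \<Gamma> 0"
  shows "\<exists>H :: real \<Rightarrow> real. continuous_on UNIV H \<and> mono H \<and> (\<forall>x. H (x + 1) = H x + 1) \<and>
    (\<forall>F\<in>\<Gamma>. \<forall>x y. H x = H y \<longrightarrow> H (F x) = H (F y)) \<and>
    (\<forall>x u v. u < v \<longrightarrow> (\<exists>F\<in>\<Gamma>. u < H (F x) \<and> H (F x) < v))"
proof -
  obtain K where K: "closed K" "K \<noteq> {}" "\<forall>F\<in>\<Gamma>. \<forall>x\<in>K. F x \<in> K"
    and min: "\<forall>C. closed C \<and> C \<noteq> {} \<and> (\<forall>F\<in>\<Gamma>. \<forall>x\<in>C. F x \<in> C) \<and> C \<subseteq> K \<longrightarrow> C = K"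
    using minimal_set_exists by (elim exE conjE)
  have perfect: "x islimpt K" if "x \<in> K" for x
  proof -
    have "\<exists>x. x islimpt K" using has_quasi_length_zero_of_discrete[OF K(3,2)] nq by blast
    then have "{x. x islimpt K} = K"
      using K islimpt_image[OF K(3)] closed_limpts[of K]
      by (intro min[rule_format]) (auto simp: closed_limpt)
    then show ?thesis using that by blast
  qed
  interpret perfect_periodic_set K
  proof
    show "x + 1 \<in> K \<longleftrightarrow> x \<in> K" for x using invariant_iff[OF K(3) translation] by simp
  qed (use perfect K(2) in auto)
  have fib: "collapse (F x) = collapse (F y)" if F: "F \<in> \<Gamma>" and eq: "collapse x = collapse y" for F x y
  proof -
    have *: "collapse (F x) = collapse (F y)" if xy: "x < y" and eq: "collapse x = collapse y" for x y
    proof -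
      have emp: "{x<..<y} \<inter> K = {}" using collapse_eq_iff[OF xy] eq by blast
      have "F x < F y" using less_iff[OF F] xy by blast
      moreover have "{F x<..<F y} \<inter> K = {}"
      proof (rule ccontr)
        assume "{F x<..<F y} \<inter> K \<noteq> {}"
        then obtain k where k: "k \<in> K" "F x < k" "k < F y" by auto
        obtain F' where F': "F' \<in> \<Gamma>" "\<And>x. F (F' x) = x" using inverse[OF F] by blast
        have "F' k \<in> {x<..<y} \<inter> K"
          using less_iff[OF F, of x "F' k"] less_iff[OF F, of "F' k" y] F' k K(3) by auto
        then show False using emp by blast
      qed
      ultimately show ?thesis using collapse_eq_iff by blast
    qed
    show ?thesis
    proof (cases x y rule: linorder_cases)
      case less
      then show ?thesis using *[OF less eq] by simp
    next
      case greater
      then show ?thesis using *[OF greater eq[symmetric]] by simp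
    qed simp
  qed
  have dense_K: "\<exists>F\<in>\<Gamma>. u < collapse (F x) \<and> collapse (F x) < v" if x: "x \<in> K" and uv: "u < v" for x u v
  proof -
    define C where "C = closure ((\<lambda>F. F x) ` \<Gamma>)"
    have "C = K"
    proof (rule min[rule_format], intro conjI)
      show "closed C" "C \<noteq> {}" using id_mem by (auto simp: C_def)
      show "C \<subseteq> K" unfolding C_def by (rule closure_minimal) (use K(1,3) x in auto)
      show "\<forall>F\<in>\<Gamma>. \<forall>x\<in>C. F x \<in> C"
      proof (intro ballI)
        fix F z assume F: "F \<in> \<Gamma>" and z: "z \<in> C"
        have "F ` closure ((\<lambda>F. F x) ` \<Gamma>) \<subseteq> closure ((\<lambda>F. F x) ` \<Gamma>)"
        proof (rule image_closure_subset)
          show "F ` ((\<lambda>F. F x) ` \<Gamma>) \<subseteq> closure ((\<lambda>F. F x) ` \<Gamma>)"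
          proof (rule subsetI)
            fix w assume "w \<in> F ` ((\<lambda>F. F x) ` \<Gamma>)"
            then obtain F1 where "F1 \<in> \<Gamma>" "w = (F \<circ> F1) x" by auto
            then have "w \<in> (\<lambda>F. F x) ` \<Gamma>" using comp[OF F] by blast
            then show "w \<in> closure ((\<lambda>F. F x) ` \<Gamma>)" by (rule subsetD[OF closure_subset])
          qed
        qed (auto intro: continuous_on_subset[OF continuous[OF F]])
        then show "F z \<in> C" using z by (auto simp: C_def)
      qed
    qed
    have dense_range: "\<exists>a. u < collapse a \<and> collapse a < v" if "u < v" for u v
      using dyadic_dense[OF that] by (metis collapse_point)
    \<comment> \<open>Two values are taken so that \<open>collapse\<close> differs at
      \<open>a\<close> and \<open>b\<close>; then \<open>K\<close>, and with it the orbit of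
      \<open>x\<close>, meets the interval between them.\<close>
    obtain a where a: "u < collapse a" "collapse a < v" using dense_range[OF uv] by blast
    obtain b where b: "collapse a < collapse b" "collapse b < v" using dense_range[OF a(2)] by blast
    have "a < b" using b(1) collapse_mono[of b a] by (cases "a < b") auto
    then obtain k where k: "k \<in> K" "a < k" "k < b" using collapse_eq_iff[OF \<open>a < b\<close>] b(1) by auto
    have "k \<in> closure ((\<lambda>F. F x) ` \<Gamma>)" using k(1) \<open>C = K\<close> by (simp add: C_def)
    then have "{a<..<b} \<inter> ((\<lambda>F. F x) ` \<Gamma>) \<noteq> {}"
      using open_Int_closure_eq_empty[of "{a<..<b}" "(\<lambda>F. F x) ` \<Gamma>"] k(2,3) by auto
    then obtain F where F: "F \<in> \<Gamma>" "a < F x" "F x < b" by auto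
    then have "collapse a \<le> collapse (F x)" "collapse (F x) \<le> collapse b"
      using collapse_mono by simp_all
    then show ?thesis using F(1) a(1) b(2) by (intro bexI[of _ F]) auto
  qed
  have dense_all: "\<exists>F\<in>\<Gamma>. u < collapse (F x) \<and> collapse (F x) < v" if uv: "u < v" for x u v
  proof -
    \<comment> \<open>No point of \<open>K\<close> lies between \<open>z\<close>, the last one up to
      \<open>x\<close>, and \<open>x\<close> itself. So \<open>collapse\<close> takes the same value
      at both, and density carries over from \<open>K\<close>.\<close>
    define z where "z = Sup (K \<inter> {..x})"
    have ne: "K \<inter> {..x} \<noteq> {}"
    proof -
      have "base + of_int \<lfloor>x - base\<rfloor> \<in> K \<inter> {..x}" using periodic_int base_mem by (simp; linarith)
      then show ?thesis by blast
    qed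
    have bdd: "bdd_above (K \<inter> {..x})" by (rule bdd_aboveI[of _ x]) auto
    have "z \<in> K \<inter> {..x}"
      unfolding z_def by (rule closed_contains_Sup[OF ne bdd]) (use K(1) in auto)
    moreover have "w \<le> z" if "w \<in> K" "w \<le> x" for w
      unfolding z_def by (rule cSup_upper[OF _ bdd]) (use that in auto)
    then have "{z<..<x} \<inter> K = {}" by force
    ultimately have "z \<in> K" "collapse z = collapse x"
      using collapse_eq_iff[of z x] by (cases "z = x"; force)+
    then show ?thesis using dense_K[OF _ uv, of z] fib by metis
  qed
  have mono: "mono collapse" by (rule monoI) (rule collapse_mono)
  show ?thesis
    by (intro exI[of _ collapse] conjI allI ballI impI;
        (rule collapse_continuous mono collapse_add_one fib dense_all; assumption)?)
qed

end

section \<open>Minimal models and their rotation symmetry\<close>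

locale line_factor = line_group +
  fixes H :: "real \<Rightarrow> real"
  assumes factor_continuous: "continuous_on UNIV H"
    and factor_mono: "mono H"
    and factor_add_one: "H (x + 1) = H x + 1"
    and factor_fibres: "F \<in> \<Gamma> \<Longrightarrow> H x = H y \<Longrightarrow> H (F x) = H (F y)"
    and factor_dense: "u < v \<Longrightarrow> \<exists>F\<in>\<Gamma>. u < H (F x) \<and> H (F x) < v"
begin

text \<open>\<open>H\<close> is onto, so \<open>P\<close> is determined by \<open>F\<close>, and its
  continuity and monotonicity are consequences rather than requirements.\<close>

definition factor_group :: "(real \<Rightarrow> real) set" where
  "factor_group = {P. \<exists>F\<in>\<Gamma>. \<forall>x. P (H x) = H (F x)}"

lemma factor_surj: "\<exists>x. H x = u"
  using surj_of_add_one[of H 1 u] factor_add_one factor_continuous by simp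

lemma factor_add_int: "H (x + of_int n) = H x + of_int n"
  using add_int_of_add_one[of H 1] factor_add_one by simp

lemma factor_less: "H x < H y \<Longrightarrow> x < y"
  using monoD[OF factor_mono, of y x] by (meson not_le)

lemma factor_fibres_int:
  assumes "F \<in> \<Gamma>" "H x = H y + of_int n"
  shows "H (F x) = H (F y) + of_int n"
  using factor_fibres[OF assms(1), of x "y + of_int n"] assms(2) factor_add_int add_int[OF assms(1)] by simp

lemma factor_descend:
  assumes "F \<in> \<Gamma>"
  shows "\<exists>P. continuous_on UNIV P \<and> strict_mono P \<and> (\<forall>x. P (x + 1) = P x + 1) \<and>
    (\<forall>x. P (H x) = H (F x))"
  by (rule descend[OF factor_mono factor_surj _ assms]) (rule factor_fibres_int)

lemma factor_groupD:
  assumes "P \<in> factor_group"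
  shows "continuous_on UNIV P \<and> strict_mono P \<and> (\<forall>x. P (x + 1) = P x + 1)"
proof -
  obtain F where F: "F \<in> \<Gamma>" "\<And>x. P (H x) = H (F x)" using assms by (auto simp: factor_group_def)
  obtain Q where Q: "continuous_on UNIV Q" "strict_mono Q" "\<forall>x. Q (x + 1) = Q x + 1"
    "\<forall>x. Q (H x) = H (F x)"
    using factor_descend[OF F(1)] by blast
  have "P u = Q u" for u using factor_surj[of u] F(2) Q(4) by force
  then have "P = Q" by blast
  then show ?thesis using Q by blast
qed

lemma minimal_factor_group: "minimal_line_group factor_group"
proof
  show "continuous_on UNIV F" if "F \<in> factor_group" for F using factor_groupD[OF that] by blast
  show "strict_mono F" if "F \<in> factor_group" for F using factor_groupD[OF that] by blast
  show "F (x + 1) = F x + 1" if "F \<in> factor_group" for F x using factor_groupD[OF that] by blast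
  show "P \<circ> P' \<in> factor_group" if PP: "P \<in> factor_group" "P' \<in> factor_group" for P P'
  proof -
    obtain F F' where F: "F \<in> \<Gamma>" "\<And>x. P (H x) = H (F x)" "F' \<in> \<Gamma>" "\<And>x. P' (H x) = H (F' x)"
      using PP by (auto simp: factor_group_def)
    have "(P \<circ> P') (H x) = H ((F \<circ> F') x)" for x using F(2,4) by simp
    then show ?thesis using comp[OF F(1,3)] unfolding factor_group_def by blast
  qed
  show "\<exists>P'\<in>factor_group. (\<forall>x. P (P' x) = x) \<and> (\<forall>x. P' (P x) = x)" if P: "P \<in> factor_group" for P
  proof -
    obtain F where F: "F \<in> \<Gamma>" "\<And>x. P (H x) = H (F x)" using P by (auto simp: factor_group_def)
    obtain F' where F': "F' \<in> \<Gamma>" "\<And>x. F (F' x) = x" "\<And>x. F' (F x) = x" using inverse[OF F(1)] by blast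
    obtain P' where P': "\<forall>x. P' (H x) = H (F' x)" using factor_descend[OF F'(1)] by blast
    have "P (P' u) = u" "P' (P u) = u" for u
    proof -
      obtain x where "H x = u" using factor_surj by blast
      then show "P (P' u) = u" "P' (P u) = u" using F(2) F'(2,3) P' by metis+
    qed
    moreover have "P' \<in> factor_group" using P' F'(1) by (auto simp: factor_group_def)
    ultimately show ?thesis by blast
  qed
  show "(\<lambda>x. x + 1) \<in> factor_group"
    unfolding factor_group_def using factor_add_one translation by (auto intro!: bexI[of _ "\<lambda>x. x + 1"])
  show "\<exists>P\<in>factor_group. u < P x \<and> P x < v" if uv: "u < v" for u v x
  proof -
    obtain y where y: "H y = x" using factor_surj by blast
    obtain F where F: "F \<in> \<Gamma>" "u < H (F y)" "H (F y) < v" using factor_dense[OF uv] by blast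
    obtain P where P: "\<forall>x. P (H x) = H (F x)" using factor_descend[OF F(1)] by blast
    then have "P \<in> factor_group" using F(1) by (auto simp: factor_group_def)
    moreover have "P x = H (F y)" using P y by blast
    ultimately show ?thesis using F(2,3) by metis
  qed
qed

text \<open>The quasi-length is restricted to a section \<open>S\<close> of \<open>H\<close>, chosen
  on one period and extended by translation so that unit intervals stay unit intervals.
  \<open>H p < H q\<close> implies \<open>p < q\<close>, whereas weak inequalities need not lift;
  here the strict form of the push clause is used.\<close>

lemma has_quasi_length_factor_group:
  assumes "has_quasi_length \<Gamma> d"
  shows "has_quasi_length factor_group d"
proof -
  obtain D where D: "quasi_length \<Gamma> d D" using assms by (auto simp: has_quasi_length_def)
  define S where "S u = (SOME x. H x = u - of_int \<lfloor>u\<rfloor>) + of_int \<lfloor>u\<rfloor>" for u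
  have HS: "H (S u) = u" for u
  proof -
    have "H (SOME x. H x = u - of_int \<lfloor>u\<rfloor>) = u - of_int \<lfloor>u\<rfloor>" by (rule someI_ex[OF factor_surj])
    then show ?thesis by (simp add: S_def factor_add_int)
  qed
  have S1: "S (u + 1) = S u + 1" for u by (simp add: S_def)
  have S_le: "S u \<le> S v" if "u \<le> v" for u v
    using factor_less[of "S u" "S v"] HS that by (cases "u = v") auto
  have "quasi_length factor_group d (\<lambda>u v. D (S u) (S v))"
  proof (rule quasi_lengthI)
    fix P x a b y assume P: "P \<in> factor_group" "P x < a" "a \<le> b" "b < P y"
    obtain F where F: "F \<in> \<Gamma>" "\<And>x. P (H x) = H (F x)" using P(1) by (auto simp: factor_group_def)
    have "H (F (S x)) < H (S a)" "H (S b) < H (F (S y))"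
      using P(2,4) F(2)[of "S x"] F(2)[of "S y"] HS by simp_all
    then have "F (S x) < S a" "S b < F (S y)" using factor_less by blast+
    then show "D (S a) (S b) \<le> D (S x) (S y)" using quasi_lengthD(5)[OF D F(1)] S_le[OF P(3)] by blast
  qed (use S_le quasi_lengthD[OF D] S1 in auto)
  then show ?thesis by (auto simp: has_quasi_length_def)
qed

text \<open>\<open>H\<close> turns strict inequalities into weak ones, so a quasi-length cannot
  simply be pulled back. An exact length is first replaced by a monotone \<open>R\<close> that each
  \<open>P\<close> shifts by a constant, and for \<open>R\<close> weak inequalities suffice.\<close>

lemma has_quasi_length_zero_of_factor_group:
  assumes "has_quasi_length factor_group 0"
  shows "has_quasi_length \<Gamma> 0"
proof -
  interpret M: minimal_line_group factor_group by (rule minimal_factor_group)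
  obtain D where D: "quasi_length factor_group 0 D" using assms by (auto simp: has_quasi_length_def)
  obtain R :: "real \<Rightarrow> real" where R: "mono R" "\<And>x. R (x + 1) = R x + 1"
    "\<And>P. P \<in> factor_group \<Longrightarrow> \<exists>c. \<forall>x. R (P x) = R x + c"
    using M.exact_length_cocycle[OF D] by blast
  have RH: "R (H x) \<le> R (H y)" if "x \<le> y" for x y
    using monoD[OF R(1) monoD[OF factor_mono that]] .
  have "quasi_length \<Gamma> 0 (\<lambda>x y. R (H y) - R (H x))"
  proof (rule quasi_lengthI)
    fix F x a b y assume F: "F \<in> \<Gamma>" "F x < a" "a \<le> b" "b < F y"
    obtain P where P: "\<forall>x. P (H x) = H (F x)" using factor_descend[OF F(1)] by blast
    then have "P \<in> factor_group" using F(1) by (auto simp: factor_group_def)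
    then obtain c where c: "\<And>x. R (P x) = R x + c" using R(3) by blast
    have "R (H (F z)) = R (H z) + c" for z using c[of "H z"] P by simp
    moreover have "R (H (F x)) \<le> R (H a)" "R (H b) \<le> R (H (F y))" using RH F(2,4) by simp_all
    ultimately show "R (H b) - R (H a) \<le> R (H y) - R (H x)" by simp
  qed (use RH R(2) factor_add_one in auto)
  then show ?thesis by (auto simp: has_quasi_length_def)
qed

text \<open>Averaging over the powers of the root \<open>\<tau>\<close> of the translation by one turns \<open>\<tau>\<close> into the
  translation by \<open>1 / q\<close>.\<close>

lemma rotation_symmetric_factor:
  assumes nq: "\<not> has_quasi_length \<Gamma> 0"
  shows "\<exists>(B :: real \<Rightarrow> real) q. q \<ge> 1 \<and> continuous_on UNIV B \<and> mono B \<and> (\<forall>x. B (x + 1) = B x + 1) \<and>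
    (\<forall>F\<in>\<Gamma>. \<forall>x y. \<forall>n::int. B x = B y + of_int n / real q \<longrightarrow> B (F x) = B (F y) + of_int n / real q) \<and>
    (\<forall>x u v. u < v \<longrightarrow> (\<exists>F\<in>\<Gamma>. u < B (F x) \<and> B (F x) < v)) \<and>
    (\<forall>d. has_quasi_length \<Gamma> d \<longrightarrow> 1 \<le> real q * d)"
proof -
  interpret M: minimal_line_group factor_group by (rule minimal_factor_group)
  have "\<not> has_quasi_length factor_group 0" using nq has_quasi_length_zero_of_factor_group by blast
  then obtain \<tau> q where q: "q \<ge> 1" and \<tau>: "M.positive \<tau>" "\<forall>x. (\<tau> ^^ q) x = x + 1"
    "\<forall>r. M.positive r \<longrightarrow> \<tau> 0 \<le> r 0"
    using M.minimal_positive_root by blast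
  have c: "M.central (\<tau> ^^ i)" for i by (rule M.central_funpow[OF M.positiveD(1)[OF \<tau>(1)]])
  define A where "A u = (\<Sum>i<q. (\<tau> ^^ i) u) / real q" for u
  have A_less: "A u < A v" if "u < v" for u v
  proof -
    have "(\<Sum>i<q. (\<tau> ^^ i) u) < (\<Sum>i<q. (\<tau> ^^ i) v)"
      by (rule sum_strict_mono) (use q M.central_strict_mono[OF c that] in \<open>auto simp: lessThan_empty_iff\<close>)
    then show ?thesis using q by (simp add: A_def divide_strict_right_mono)
  qed
  have A_inj: "u = v" if "A u = A v" for u v
    using A_less[of u v] A_less[of v u] that by (cases u v rule: linorder_cases) auto
  have A_cont: "continuous_on UNIV A"
    unfolding A_def using q M.central_continuous[OF c] by (intro continuous_intros) auto
  have A1: "A (u + 1) = A u + 1" for u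
    using q M.centralD(3)[OF c] by (simp add: A_def sum.distrib add_divide_distrib)
  have A\<tau>: "A (\<tau> u) = A u + 1 / real q" for u
  proof -
    \<comment> \<open>The sums at \<open>\<tau> u\<close> and at \<open>u\<close> differ only in
      their end terms, and the q-th power of \<open>\<tau>\<close> is the unit translation.\<close>
    have "(\<Sum>i<q. (\<tau> ^^ Suc i) u - (\<tau> ^^ i) u) = (\<tau> ^^ q) u - (\<tau> ^^ 0) u"
      by (rule sum_lessThan_telescope)
    then have "(\<Sum>i<q. (\<tau> ^^ i) (\<tau> u)) = (\<Sum>i<q. (\<tau> ^^ i) u) + 1"
      using \<tau>(2) by (simp add: sum_subtractf funpow_swap1)
    then show ?thesis by (simp add: A_def add_divide_distrib)
  qed
  have A\<tau>n: "A ((\<tau> ^^ k) u) = A u + real k / real q" for k u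
  proof (induction k)
    case (Suc k)
    then show ?case using A\<tau>[of "(\<tau> ^^ k) u"] by (simp add: add_divide_distrib)
  qed simp
  have Aint: "A (u + of_int n) = A u + of_int n" for u n
    using add_int_of_add_one[of A 1] A1 by simp
  define B where "B x = A (H x)" for x
  have "continuous_on UNIV B"
    unfolding B_def using continuous_on_compose2[OF A_cont factor_continuous] by auto
  moreover have "mono B"
  proof (rule monoI)
    fix x y :: real assume "x \<le> y"
    then have "H x \<le> H y" by (rule monoD[OF factor_mono])
    then show "B x \<le> B y" unfolding B_def using A_less[of "H x" "H y"] by (cases "H x = H y") auto
  qed
  moreover have "B (x + 1) = B x + 1" for x by (simp add: B_def factor_add_one A1)
  moreover have "B (F x) = B (F y) + of_int n / real q"
    if F: "F \<in> \<Gamma>" and eq: "B x = B y + of_int n / real q" for F x y and n :: int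
  proof -
    \<comment> \<open>Division by \<open>q\<close> writes the shift by \<open>n / q\<close> as an
      integer translation followed by a nonnegative power of \<open>\<tau>\<close>; both commute
      with \<open>P\<close>.\<close>
    define j r where "j = n div int q" and "r = nat (n mod int q)"
    have "n = j * int q + int r" using q by (simp add: j_def r_def)
    then have "of_int n = of_int j * real q + real r" by simp
    then have n: "of_int n / real q = of_int j + real r / real q"
      using q by (simp add: field_simps)
    have "A (H x) = A ((\<tau> ^^ r) (H y) + of_int j)"
      using eq n by (simp add: B_def Aint A\<tau>n)
    then have Hx: "H x = (\<tau> ^^ r) (H y) + of_int j" by (rule A_inj)
    obtain P where P: "\<forall>x. P (H x) = H (F x)" using factor_descend[OF F] by blast
    then have PG: "P \<in> factor_group" using F by (auto simp: factor_group_def)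
    have "H (F x) = P ((\<tau> ^^ r) (H y) + of_int j)" using P Hx by metis
    also have "\<dots> = P ((\<tau> ^^ r) (H y)) + of_int j" by (rule M.add_int[OF PG])
    also have "P ((\<tau> ^^ r) (H y)) = (\<tau> ^^ r) (P (H y))" by (rule M.centralD(2)[OF c PG, symmetric])
    finally have "H (F x) = (\<tau> ^^ r) (H (F y)) + of_int j" using P by simp
    then show ?thesis by (simp add: B_def Aint A\<tau>n n)
  qed
  moreover have "\<exists>F\<in>\<Gamma>. u < B (F x) \<and> B (F x) < v" if uv: "u < v" for u v x
  proof -
    have surj: "\<exists>a. A a = u" for u using surj_of_add_one[of A 1 u] A1 A_cont by simp
    obtain a b where ab: "A a = u" "A b = v" using surj by metis
    have "a < b" using uv ab A_less[of b a] by (cases a b rule: linorder_cases) auto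
    then obtain F where F: "F \<in> \<Gamma>" "a < H (F x)" "H (F x) < b" using factor_dense by blast
    then show ?thesis using A_less ab unfolding B_def by metis
  qed
  moreover have "1 \<le> real q * d" if d: "has_quasi_length \<Gamma> d" for d
  proof -
    obtain D where D: "quasi_length factor_group d D"
      using has_quasi_length_factor_group[OF d] by (auto simp: has_quasi_length_def)
    show ?thesis by (rule M.quasi_length_defect_bound[OF \<tau>(3,1) D]) (use \<tau>(2) in blast)
  qed
  ultimately show ?thesis using q by (intro exI[of _ B] exI[of _ q] conjI allI ballI impI) auto
qed

end

section \<open>The minimal model and the homomorphism that it lifts\<close>

lemma circle_map_of_lift:
  fixes H :: "real \<Rightarrow> real"
  assumes "\<And>x. H (x + 1) = H x + real k"
  shows "\<exists>h. \<forall>x. h (circle_proj x) = circle_proj (H x)"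
proof (intro exI allI)
  fix x
  obtain n where n: "circle_frac (circle_proj x) = x + of_int n" using circle_frac_proj by blast
  have "H (x + of_int n) = H x + of_int (n * int k)" using add_int_of_add_one[of H "real k"] assms by simp
  then show "circle_proj (H (circle_frac (circle_proj x))) = circle_proj (H x)"
    using circle_proj_add_int[of "H x" "n * int k"] by (simp add: n)
qed

lemma dist_circle_proj_le: "dist (circle_proj x) (circle_proj y) \<le> \<bar>x - y\<bar>"
  using infdist_le[of 0 "\<int>" "x - y"] by (simp add: dist_circle.abs_eq dist_real_def)

lemma minimal_not_reps_fix:
  assumes "minimal_action G \<psi>" "group G"
  shows "\<psi> \<notin> reps_fix G"
proof
  assume "\<psi> \<in> reps_fix G"
  then obtain p where p: "\<And>g. g \<in> carrier G \<Longrightarrow> \<psi> g p = p" by (auto simp: reps_fix_def)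
  have "(\<lambda>g. \<psi> g p) ` carrier G \<subseteq> {p}" using p by auto
  then have "closure ((\<lambda>g. \<psi> g p) ` carrier G) \<subseteq> {p}" by (intro closure_minimal) auto
  then have "UNIV \<subseteq> {p}" using assms(1) by (simp add: minimal_action_def)
  then have "circle_proj 0 = p" "circle_proj (1 / 2) = p" by auto
  then have "circle_proj 0 = circle_proj (1 / 2)" by simp
  then have "(1 / 2 :: real) \<in> \<int>" by (simp add: circle_proj_eq_iff)
  then obtain n :: int where "(1 / 2 :: real) = of_int n" by (auto elim: Ints_cases)
  then have "(1::real) = of_int (2 * n)" by simp
  then have "1 = 2 * n" by linarith
  then show False by presburger
qed

text \<open>The point mass at the fixed point is invariant. Semiconjugacy treats homomorphisms with
  a common fixed point separately, and this keeps them out of the positive types.\<close>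

lemma type_zero_reps_fix:
  assumes "\<phi> \<in> reps_fix G"
  shows "type_zero G \<phi>"
proof -
  have \<phi>: "\<phi> \<in> reps G" using assms by (simp add: reps_fix_def)
  obtain p where p: "\<And>g. g \<in> carrier G \<Longrightarrow> \<phi> g p = p" using assms by (auto simp: reps_fix_def)
  have "distr (return borel p) borel (\<phi> g) = return borel p" if g: "g \<in> carrier G" for g
  proof -
    obtain F where F: "lift_of F (\<phi> g)" using reps_lift[OF \<phi> g] by blast
    have "continuous_on UNIV (\<phi> g)"
      using continuous_on_lifted[of F "\<phi> g"] lift_ofD[OF F] by blast
    then have "\<phi> g \<in> borel_measurable borel" by (rule borel_measurable_continuous_onI)
    then show ?thesis using p[OF g] distr_return[of "\<phi> g" borel borel p] by simp
  qed
  then show ?thesis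
    unfolding type_zero_def by (intro exI[of _ "return borel p"]) (auto intro: prob_space_return)
qed

text \<open>\<open>B\<close> defines the model and \<open>real q * B\<close> the homomorphism below
  it. Multiplication by \<open>q\<close> on the circle connects the two factor maps, which is the
  fold lift relation.\<close>

lemma fold_lift_model_exists:
  assumes G: "group G" and \<phi>: "\<phi> \<in> reps G" and nq: "\<not> has_quasi_length (lifts G \<phi>) 0"
  shows "\<exists>q. model_is_fold_lift G \<phi> q \<and> (\<forall>d. has_quasi_length (lifts G \<phi>) d \<longrightarrow> 1 \<le> real q * d)"
proof -
  interpret line_group "lifts G \<phi>" by (rule line_group_lifts[OF G \<phi>])
  obtain H :: "real \<Rightarrow> real" where H: "continuous_on UNIV H" "mono H" "\<forall>x. H (x + 1) = H x + 1"
    "\<forall>F\<in>lifts G \<phi>. \<forall>x y. H x = H y \<longrightarrow> H (F x) = H (F y)"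
    "\<forall>x u v. u < v \<longrightarrow> (\<exists>F\<in>lifts G \<phi>. u < H (F x) \<and> H (F x) < v)"
    using minimal_factor[OF nq] by blast
  interpret line_factor "lifts G \<phi>" H
    by unfold_locales (fact H(1), fact H(2), rule H(3)[rule_format], rule H(4)[rule_format],
      assumption, assumption, rule H(5)[rule_format])
  obtain B :: "real \<Rightarrow> real" and q where q: "q \<ge> 1"
    and B: "continuous_on UNIV B" "mono B" "\<forall>x. B (x + 1) = B x + 1"
    and Bfib: "\<forall>F\<in>lifts G \<phi>. \<forall>x y. \<forall>n::int. B x = B y + of_int n / real q \<longrightarrow>
        B (F x) = B (F y) + of_int n / real q"
    and Bdense: "\<forall>x u v. u < v \<longrightarrow> (\<exists>F\<in>lifts G \<phi>. u < B (F x) \<and> B (F x) < v)"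
    and bound: "\<forall>d. has_quasi_length (lifts G \<phi>) d \<longrightarrow> 1 \<le> real q * d"
    using rotation_symmetric_factor[OF nq] by (elim exE conjE) (rule that; assumption)
  define B' where "B' x = real q * B x" for x
  have B'1: "B' (x + 1) = B' x + real q" for x using B(3) by (simp add: B'_def distrib_left)
  obtain h where h: "\<And>x. h (circle_proj x) = circle_proj (B x)"
    using circle_map_of_lift[of B 1] B(3) by auto
  obtain h' where h': "\<And>x. h' (circle_proj x) = circle_proj (B' x)"
    using circle_map_of_lift[of B' q] B'1 by blast
  have "\<exists>\<psi>\<in>reps G. \<forall>g\<in>carrier G. \<psi> g \<circ> h = h \<circ> \<phi> g \<and>
    (\<forall>F. lift_of F (\<phi> g) \<longrightarrow> (\<exists>P. lift_of P (\<psi> g) \<and> (\<forall>x. P (B x) = B (F x))))"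
  proof (rule factor_representation[OF G \<phi>, where q = 1])
    show "B (F x) = B (F y) + of_int n" if "F \<in> lifts G \<phi>" "B x = B y + of_int n" for F x y n
      using Bfib[rule_format, OF that(1), of x y "n * int q"] that(2) q by simp
  qed (use B h in auto)
  then obtain \<psi> where \<psi>: "\<psi> \<in> reps G" "\<And>g. g \<in> carrier G \<Longrightarrow> \<psi> g \<circ> h = h \<circ> \<phi> g" by blast
  have "\<exists>\<theta>\<in>reps G. \<forall>g\<in>carrier G. \<theta> g \<circ> h' = h' \<circ> \<phi> g \<and>
    (\<forall>F. lift_of F (\<phi> g) \<longrightarrow> (\<exists>P. lift_of P (\<theta> g) \<and> (\<forall>x. P (B' x) = B' (F x))))"
  proof (rule factor_representation[OF G \<phi> q])
    show "continuous_on UNIV B'" unfolding B'_def using B(1) by (intro continuous_intros)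
    show "mono B'" using B(2) by (auto simp: mono_def B'_def intro: mult_left_mono)
    show "B' (F x) = B' (F y) + of_int n" if "F \<in> lifts G \<phi>" "B' x = B' y + of_int n" for F x y n
    proof -
      have "B x = B y + of_int n / real q" using that(2) q by (simp add: B'_def field_simps)
      then have "B (F x) = B (F y) + of_int n / real q" using Bfib that(1) by blast
      then show ?thesis using q by (simp add: B'_def field_simps)
    qed
  qed (use B'1 h' in auto)
  then obtain \<theta> where \<theta>: "\<theta> \<in> reps G" "\<And>g. g \<in> carrier G \<Longrightarrow> \<theta> g \<circ> h' = h' \<circ> \<phi> g" by blast
  have surj: "\<exists>c. p = h c" for p
  proof -
    obtain u where u: "p = circle_proj u" using circle_proj_surj by blast
    obtain x where "B x = u" using surj_of_add_one[of B 1 u] B by auto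
    then show ?thesis using h u by metis
  qed
  have "fold_lift G q \<psi> \<theta>"
    unfolding fold_lift_def
  proof (intro ballI ext)
    fix g p assume g: "g \<in> carrier G"
    have m: "circle_mult q (h c) = h' c" for c
    proof -
      obtain x where "c = circle_proj x" using circle_proj_surj by blast
      then show ?thesis by (simp add: h h' circle_mult.abs_eq B'_def)
    qed
    obtain c where c: "p = h c" using surj by blast
    have "\<theta> g (h' c) = h' (\<phi> g c)" using \<theta>(2)[OF g] by (metis comp_apply)
    moreover have "\<psi> g (h c) = h (\<phi> g c)" using \<psi>(2)[OF g] by (metis comp_apply)
    ultimately show "(\<theta> g \<circ> circle_mult q) p = (circle_mult q \<circ> \<psi> g) p" by (simp add: c m)
  qed
  moreover have min: "minimal_action G \<psi>"
    unfolding minimal_action_def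
  proof (intro allI)
    fix p
    obtain c where c: "p = h c" using surj by blast
    obtain x where x: "c = circle_proj x" using circle_proj_surj by blast
    have "w \<in> closure ((\<lambda>g. \<psi> g p) ` carrier G)" for w
      unfolding closure_approachable
    proof (intro allI impI)
      fix e :: real assume e: "e > 0"
      obtain v where v: "w = circle_proj v" using circle_proj_surj by blast
      have "v - e < v + e" using e by simp
      then obtain F where F: "F \<in> lifts G \<phi>" "v - e < B (F x)" "B (F x) < v + e" using Bdense by blast
      obtain g where g: "g \<in> carrier G" "lift_of F (\<phi> g)" using F(1) by (auto simp: lifts_def)
      have "\<psi> g p = h (\<phi> g c)" using \<psi>(2)[OF g(1)] c by (metis comp_apply)
      also have "\<dots> = circle_proj (B (F x))" using lift_ofD(4)[OF g(2), of x] h x by metis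
      finally have "dist (\<psi> g p) w \<le> \<bar>B (F x) - v\<bar>" using dist_circle_proj_le v by simp
      then have "dist (\<psi> g p) w < e" using F(2,3) by linarith
      then show "\<exists>y\<in>(\<lambda>g. \<psi> g p) ` carrier G. dist y w < e" using g(1) by blast
    qed
    then show "closure ((\<lambda>g. \<psi> g p) ` carrier G) = UNIV" by blast
  qed
  moreover have "\<phi> \<notin> reps_fix G"
    using type_zero_reps_fix has_quasi_length_zero_of_type_zero[OF \<phi>] nq by blast
  moreover have "\<psi> \<notin> reps_fix G" by (rule minimal_not_reps_fix[OF min G])
  moreover have "degree_one_monotone h" unfolding degree_one_monotone_def using B h by (intro exI[of _ B]) auto
  ultimately have "minimal_model G \<phi> \<psi>" "fold_lift G q \<psi> \<theta>"
    unfolding minimal_model_def semiconjugate_def using \<phi> \<psi> by blast+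
  then have "model_is_fold_lift G \<phi> q" unfolding model_is_fold_lift_def using q \<theta>(1) by blast
  then show ?thesis using bound by blast
qed

text \<open>The given model and semiconjugacy are arbitrary, so lifts compatible with
  \<open>H\<close> and commuting with the translation by \<open>1 / m\<close> have to be produced.
  The fold lift relation makes \<open>m * P\<close> advance by a fixed integer over a step of
  \<open>1 / m\<close>, and this integer is 1 because \<open>m\<close> steps make up one
  period.\<close>

lemma has_quasi_length_of_fold_lift_model:
  assumes G: "group G" and \<phi>: "\<phi> \<in> reps G" and m: "model_is_fold_lift G \<phi> m"
  shows "has_quasi_length (lifts G \<phi>) (1 / real m)"
proof -
  obtain \<psi> \<theta> where "m \<ge> 1" and \<psi>: "\<psi> \<in> reps G" "semiconjugate G \<phi> \<psi>" "minimal_action G \<psi>"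
    and \<theta>: "fold_lift G m \<psi> \<theta>"
    using m unfolding model_is_fold_lift_def minimal_model_def by blast
  have "\<psi> \<notin> reps_fix G" by (rule minimal_not_reps_fix[OF \<psi>(3) G])
  then obtain h where h: "degree_one_monotone h" "\<forall>g\<in>carrier G. \<psi> g \<circ> h = h \<circ> \<phi> g"
    using \<psi>(2) unfolding semiconjugate_def by blast
  obtain H :: "real \<Rightarrow> real" where H: "mono H" "\<forall>x. H (x + 1) = H x + 1"
    "\<forall>x. circle_proj (H x) = h (circle_proj x)"
    using h(1) unfolding degree_one_monotone_def by blast
  have Hint: "H (x + of_int n) = H x + of_int n" for x n using add_int_of_add_one[of H 1] H(2) by simp
  have conj: "\<psi> g (h p) = h (\<phi> g p)" if "g \<in> carrier G" for g p using h(2) that by (metis comp_apply)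
  \<comment> \<open>The orbit of a value of \<open>h\<close> is dense by minimality and stays in the
    range of \<open>h\<close>, so \<open>H\<close> has dense range.\<close>
  have H_cont: "continuous_on UNIV H"
  proof (rule continuous_of_mono_dense[OF H(1)])
    fix u v :: real assume uv: "u < v"
    define t e where "t = (u + v) / 2" and "e = (v - u) / 2"
    have "circle_proj t \<in> closure ((\<lambda>g. \<psi> g (h (circle_proj 0))) ` carrier G)"
      using \<psi>(3) by (simp add: minimal_action_def)
    moreover have "e > 0" using uv by (simp add: e_def)
    ultimately obtain g where g: "g \<in> carrier G" "dist (\<psi> g (h (circle_proj 0))) (circle_proj t) < e"
      unfolding closure_approachable by blast
    obtain y where y: "\<phi> g (circle_proj 0) = circle_proj y" using circle_proj_surj by blast
    have "\<psi> g (h (circle_proj 0)) = circle_proj (H y)" using conj[OF g(1)] y H(3) by simp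
    then have "infdist (H y - t) \<int> < e" using g(2) by (simp add: dist_circle.abs_eq)
    then obtain s where "s \<in> \<int>" "dist (H y - t) s < e" using infdist_Ints_attained by metis
    then obtain n where n: "\<bar>H y - t - of_int n\<bar> < e" by (auto simp: dist_real_def elim: Ints_cases)
    have "H (y + of_int (- n)) = H y - of_int n" using Hint[of y "- n"] by simp
    moreover have "t - e = u" "t + e = v" by (auto simp: t_def e_def field_simps)
    ultimately have "u < H (y + of_int (- n))" "H (y + of_int (- n)) < v" using n by linarith+
    then show "\<exists>x. u < H x \<and> H x < v" by blast
  qed
  have lift: "\<exists>P. strict_mono P \<and> (\<forall>x. P (H x) = H (F x)) \<and>
      (\<forall>u. \<forall>j::int. P (u + of_int j / real m) = P u + of_int j / real m)" if F: "F \<in> lifts G \<phi>" for F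
  proof -
    obtain g where g: "g \<in> carrier G" "lift_of F (\<phi> g)" using F by (auto simp: lifts_def)
    obtain P where P: "lift_of P (\<psi> g)" using reps_lift[OF \<psi>(1) g(1)] by blast
    note PD = lift_ofD[OF P]
    \<comment> \<open>An arbitrary lift of the model agrees with \<open>F\<close> through
      \<open>H\<close> up to an integer at each point. Continuity makes it one integer, and shifting
      \<open>P\<close> by it makes the agreement exact.\<close>
    have "H (F x) - P (H x) \<in> \<int>" for x
    proof -
      have "circle_proj (P (H x)) = circle_proj (H (F x))"
        using PD(4) H(3) conj[OF g(1)] lift_ofD(4)[OF g(2)] by simp
      then show ?thesis by (metis circle_proj_eq_iff)
    qed
    moreover have "continuous_on UNIV (\<lambda>x. H (F x) - P (H x))"
      by (intro continuous_intros continuous_on_compose2[OF H_cont lift_ofD(1)[OF g(2)]]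
          continuous_on_compose2[OF PD(1) H_cont]) auto
    ultimately have E: "H (F x) - P (H x) = H (F 0) - P (H 0)" "H (F 0) - P (H 0) \<in> \<int>" for x
      using continuous_Ints_valued_constant[of "\<lambda>x. H (F x) - P (H x)"] by blast+
    obtain n where n: "H (F 0) - P (H 0) = of_int n" using E(2) by (auto elim: Ints_cases)
    have "circle_proj (real m * P u) = \<theta> g (circle_proj (real m * u))" for u
    proof -
      have "circle_proj (real m * P u) = circle_mult m (\<psi> g (circle_proj u))"
        using PD(4)[of u] circle_mult.abs_eq[of m "P u"] by simp
      also have "\<dots> = \<theta> g (circle_mult m (circle_proj u))"
        using \<theta> g(1) unfolding fold_lift_def by (metis comp_apply)
      finally show ?thesis by (simp add: circle_mult.abs_eq)
    qed
    moreover have "circle_proj (real m * (u + 1 / real m)) = circle_proj (real m * u)" for u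
      using \<open>m \<ge> 1\<close> circle_proj_add_int[of "real m * u" 1] by (simp add: algebra_simps)
    ultimately have "circle_proj (real m * P (u + 1 / real m)) = circle_proj (real m * P u)" for u
      by metis
    then have "real m * P (u + 1 / real m) - real m * P u \<in> \<int>" for u by (simp add: circle_proj_eq_iff)
    moreover have "continuous_on UNIV (\<lambda>u. real m * P (u + 1 / real m) - real m * P u)"
      by (intro continuous_intros continuous_on_compose2[OF PD(1)] PD(1)) auto
    ultimately have const: "real m * P (u + 1 / real m) - real m * P u = real m * P (0 + 1 / real m) - real m * P 0" for u
      using continuous_Ints_valued_constant[of "\<lambda>u. real m * P (u + 1 / real m) - real m * P u" u 0] by blast
    define c where "c = P (0 + 1 / real m) - P 0"
    have step: "P (u + 1 / real m) = P u + c" for u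
    proof -
      have "real m * (P (u + 1 / real m) - P u) = real m * c"
        using const[of u] by (simp add: c_def algebra_simps)
      then show ?thesis using \<open>m \<ge> 1\<close> by simp
    qed
    have steps: "P (u + of_int j / real m) = P u + of_int j * c" for u and j :: int
    proof -
      have "P ((x + 1) / real m) = P (x / real m) + c" for x
        using step[of "x / real m"] by (simp add: add_divide_distrib)
      then have "P ((u * real m + of_int j) / real m) = P (u * real m / real m) + of_int j * c"
        by (rule add_int_of_add_one)
      then show ?thesis using \<open>m \<ge> 1\<close> by (simp add: add_divide_distrib)
    qed
    have "P 0 + 1 = P 0 + real m * c" using steps[of 0 "int m"] PD(3)[of 0] \<open>m \<ge> 1\<close> by simp
    then have "c = 1 / real m" using \<open>m \<ge> 1\<close> by (simp add: field_simps)
    then have "P (u + of_int j / real m) + of_int n = P u + of_int n + of_int j / real m" for u and j :: int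
      using steps by simp
    moreover have "P (H x) + of_int n = H (F x)" for x using E(1)[of x] n by simp
    moreover have "strict_mono (\<lambda>x. P x + of_int n)" using PD(2) by (auto simp: strict_mono_def)
    ultimately show ?thesis by (intro exI[of _ "\<lambda>x. P x + of_int n"]) blast
  qed
  define D where "D x y = of_int \<lfloor>real m * (H y - H x)\<rfloor> / real m" for x y
  have "quasi_length (lifts G \<phi>) (1 / real m) D"
  proof (rule quasi_lengthI)
    show "0 \<le> D x y" if "x \<le> y" for x y
      using monoD[OF H(1) that] by (simp add: D_def)
    show "D x (x + 1) = 1" for x using \<open>m \<ge> 1\<close> H(2) by (simp add: D_def)
    have split: "real m * (H z - H x) = real m * (H y - H x) + real m * (H z - H y)" for x y z
      by (simp add: algebra_simps)
    show "D x y + D y z \<le> D x z" for x y z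
    proof -
      have "\<lfloor>real m * (H y - H x)\<rfloor> + \<lfloor>real m * (H z - H y)\<rfloor> \<le> \<lfloor>real m * (H z - H x)\<rfloor>"
        unfolding split[of z x y] by (rule le_floor_add)
      then have "real_of_int (\<lfloor>real m * (H y - H x)\<rfloor> + \<lfloor>real m * (H z - H y)\<rfloor>) / real m \<le>
          of_int \<lfloor>real m * (H z - H x)\<rfloor> / real m"
        by (intro divide_right_mono) (simp_all only: of_int_le_iff of_nat_0_le_iff)
      then show ?thesis by (simp add: D_def add_divide_distrib)
    qed
    show "D x z \<le> D x y + D y z + 1 / real m" for x y z
    proof -
      have "\<lfloor>real m * (H z - H x)\<rfloor> \<le> \<lfloor>real m * (H y - H x)\<rfloor> + \<lfloor>real m * (H z - H y)\<rfloor> + 1"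
        unfolding split[of z x y] by linarith
      then have "of_int \<lfloor>real m * (H z - H x)\<rfloor> / real m \<le>
          real_of_int (\<lfloor>real m * (H y - H x)\<rfloor> + \<lfloor>real m * (H z - H y)\<rfloor> + 1) / real m"
        by (intro divide_right_mono) (simp_all only: of_int_le_iff of_nat_0_le_iff)
      then show ?thesis by (simp add: D_def add_divide_distrib)
    qed
    fix F x a b y assume F: "F \<in> lifts G \<phi>" "F x < a" "a \<le> b" "b < F y"
    obtain P where P: "strict_mono P" "\<And>x. P (H x) = H (F x)"
      "\<And>u j. P (u + of_int j / real m) = P u + of_int j / real m"
      using lift[OF F(1)] by blast
    \<comment> \<open>\<open>j\<close> is the least integer strictly above the scaled length. The
      strict inequality survives the increasing \<open>P\<close> and bounds the new integer part by
      \<open>j - 1\<close>.\<close>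
    define j where "j = \<lfloor>real m * (H y - H x)\<rfloor> + 1"
    have "real m * (H y - H x) < of_int j" unfolding j_def by linarith
    then have "H y < H x + of_int j / real m" using \<open>m \<ge> 1\<close> by (simp add: field_simps)
    then have "P (H y) < P (H x) + of_int j / real m" using strict_monoD[OF P(1)] P(3) by metis
    moreover have "H (F x) \<le> H a" "H b \<le> H (F y)" using F(2,4) monoD[OF H(1)] by simp_all
    ultimately have "H b - H a < of_int j / real m" unfolding P(2) by linarith
    then have "real m * (H b - H a) < of_int j" using \<open>m \<ge> 1\<close> by (simp add: field_simps)
    then have "\<lfloor>real m * (H b - H a)\<rfloor> \<le> \<lfloor>real m * (H y - H x)\<rfloor>" unfolding j_def by linarith
    then show "D a b \<le> D x y" by (simp add: D_def divide_right_mono)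
  qed
  then show ?thesis by (auto simp: has_quasi_length_def)
qed

section \<open>Types in terms of quasi-lengths\<close>

lemma type_zero_iff:
  assumes "group G" "\<phi> \<in> reps G"
  shows "type_zero G \<phi> \<longleftrightarrow> has_quasi_length (lifts G \<phi>) 0"
  using has_quasi_length_zero_of_type_zero type_zero_of_has_quasi_length_zero assms by blast

text \<open>A type between 1 and k bounds the fold number of the constructed model by k, which
  excludes defect \<open>1 / (k + 1)\<close>. Conversely, without that defect all fold numbers are
  at most k, and their maximum is the type.\<close>

lemma type_between_iff:
  assumes G: "group G" and \<phi>: "\<phi> \<in> reps G"
  shows "(\<exists>i\<in>{1..k}. has_type G \<phi> i) \<longleftrightarrow> \<not> has_quasi_length (lifts G \<phi>) (1 / real (k + 1))"
proof
  assume "\<exists>i\<in>{1..k}. has_type G \<phi> i"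
  then obtain i where i: "1 \<le> i" "i \<le> k" "has_type G \<phi> i" by auto
  then have "\<not> type_zero G \<phi>" and max: "\<And>m. model_is_fold_lift G \<phi> m \<Longrightarrow> m \<le> i"
    by (auto simp: has_type_def)
  then have "\<not> has_quasi_length (lifts G \<phi>) 0" using type_zero_iff[OF G \<phi>] by blast
  then obtain q where q: "model_is_fold_lift G \<phi> q"
    "\<And>d. has_quasi_length (lifts G \<phi>) d \<Longrightarrow> 1 \<le> real q * d"
    using fold_lift_model_exists[OF G \<phi>] by blast
  show "\<not> has_quasi_length (lifts G \<phi>) (1 / real (k + 1))"
  proof
    assume "has_quasi_length (lifts G \<phi>) (1 / real (k + 1))"
    then have "1 \<le> real q * (1 / real (k + 1))" by (rule q(2))
    then have "real (k + 1) \<le> real q" by (simp add: field_simps)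
    then show False using max[OF q(1)] i(2) by simp
  qed
next
  assume nq: "\<not> has_quasi_length (lifts G \<phi>) (1 / real (k + 1))"
  \<comment> \<open>A quasi-length of defect 0 would also have defect \<open>1 / (k + 1)\<close>, so
    type 0 is excluded too.\<close>
  then have nq0: "\<not> has_quasi_length (lifts G \<phi>) 0"
    using has_quasi_length_mono[of "lifts G \<phi>" 0 "1 / real (k + 1)"] by auto
  have le: "m \<le> k" if m: "model_is_fold_lift G \<phi> m" for m
  proof (rule ccontr)
    assume "\<not> m \<le> k"
    then have "1 / real m \<le> 1 / real (k + 1)" by (intro divide_left_mono) auto
    then show False
      using has_quasi_length_mono[OF has_quasi_length_of_fold_lift_model[OF G \<phi> m]] nq by blast
  qed
  obtain q where "model_is_fold_lift G \<phi> q" using fold_lift_model_exists[OF G \<phi> nq0] by blast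
  define i where "i = (GREATEST m. model_is_fold_lift G \<phi> m)"
  have i: "model_is_fold_lift G \<phi> i"
    unfolding i_def using \<open>model_is_fold_lift G \<phi> q\<close> by (rule GreatestI_nat[where b = k]) (use le in blast)
  have "m \<le> i" if "model_is_fold_lift G \<phi> m" for m
    unfolding i_def using that by (rule Greatest_le_nat[where b = k]) (use le in blast)
  moreover have "1 \<le> i" using i by (simp add: model_is_fold_lift_def)
  moreover have "\<not> type_zero G \<phi>" using nq0 type_zero_iff[OF G \<phi>] by blast
  ultimately have "has_type G \<phi> i" using i by (auto simp: has_type_def)
  then show "\<exists>i\<in>{1..k}. has_type G \<phi> i" using \<open>1 \<le> i\<close> le[OF i] by (intro bexI[of _ i]) auto
qed

theorem proposition1p11:
  fixes G :: "('g, 'm) monoid_scheme" and k :: nat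
  assumes "group G" and "k \<ge> 1"
  shows "closedin (reps_topology G) (reps_of_type G 0) \<and>
         openin (reps_topology G) (\<Union>i\<in>{1..k}. reps_of_type G i)"
proof
  note G = assms(1)
  have "topspace (reps_topology G) - reps_of_type G 0 =
      {\<phi> \<in> reps G. \<not> has_quasi_length (lifts G \<phi>) 0}"
    unfolding topspace_reps_topology[OF G]
    by (auto simp: reps_of_type_def has_type_def type_zero_iff[OF G])
  then show "closedin (reps_topology G) (reps_of_type G 0)"
    using openin_no_quasi_length[OF G, of 0]
    by (auto simp: closedin_def topspace_reps_topology[OF G] reps_of_type_def)
  have "(\<Union>i\<in>{1..k}. reps_of_type G i) =
      {\<phi> \<in> reps G. \<not> has_quasi_length (lifts G \<phi>) (1 / real (k + 1))}"
    unfolding reps_of_type_def using type_between_iff[OF G, of _ k] by blast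
  then show "openin (reps_topology G) (\<Union>i\<in>{1..k}. reps_of_type G i)"
    using openin_no_quasi_length[OF G, of "1 / real (k + 1)"] by simp
qed

end
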